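(* Fix $a_1<a_2$ in $(0,1)$, let $\Theta$ be a compact subset of $(0,1)$, and for $\theta=p\in\Theta$ let $\nu_p=p\,\delta_{a_1}+(1-p)\,\delta_{a_2}$. Suppose $a_1,a_2,\Theta$ are such that for every $\theta\in\Theta$: $\mathbb{E}^\theta|\log\rho_0|<\infty$, $\mathbb{E}^\theta(\log\rho_0)<0$ and $\mathbb{E}^\theta(\rho_0)\in[1,+\infty)$. Then all of the following properties are satisfied: (2.i) for any $(x,y)\in\mathbb{Z}_+^2$, $\theta\mapsto\phi_\theta(x,y)$ is continuous on $\Theta$; (2.ii) for any $(\theta,\theta')\in\Theta^2$, $\nu_\theta\neq\nu_{\theta'}\iff\theta\neq\theta'$; (2.iii) for any $\theta\in\Theta$, $\tilde\pi_\theta\big(\sup_{\theta'\in\Theta}|\phi_{\theta'}-\phi_{\theta_0}|\big)<\infty$; (3.i) for any $(x,y)\in\mathbb{Z}_+^2$, $\theta\mapsto\phi_\theta(x,y)$ is twice continuously differentiable on $\Theta$; (3.ii) for any $\theta\in\Theta$ there exists $q>1$ with $\tilde\pi_\theta\big(\|\dot\phi_\theta\|^{2q}\big)<+\infty$; (3.iii) for any $\theta\in\Theta$ and $u\in\mathbb{Z}_+$, $\sum_{v\in\mathbb{Z}_+}\dot Q_\theta(u,v)=\partial_\theta\big(\sum_{v\in\mathbb{Z}_+}Q_\theta(u,v)\big)$; (3.iv) for any $\theta\in\Theta$ there exists a neighborhood $\mathcal{V}(\theta)$ of $\theta$ with $\tilde\pi_\theta\big(\sup_{\theta'\in\mathcal{V}(\theta)}\|\dot\phi_{\theta'}\|^2\big)<+\infty$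 and $\tilde\pi_\theta\big(\sup_{\theta'\in\mathcal{V}(\theta)}\|\ddot\phi_{\theta'}\|\big)<+\infty$; (3.v) for any $\theta\in\Theta$, the matrix (here a scalar) $\Sigma_\theta=\tilde\pi_\theta\big(\dot\phi_\theta\dot\phi_\theta^{\top}\big)=-\tilde\pi_\theta(\ddot\phi_\theta)$ is nonsingular. Hence the maximum likelihood estimator of $p$ is consistent and asymptotically normal: for any measurable choice $\widehat\theta_n\in\mathrm{Argmax}_{\theta\in\Theta}\,\ell_n^{\mathrm{sb}}(\theta)$, $\widehat\theta_n\to\theta^\star$ in $\mathbf{P}^\star$-probability, and $\sqrt{n}(\widehat\theta_n-\theta^\star)$ converges in $\mathbf{P}^\star$-distribution to a centered Gaussian random variable with variance $\Sigma_{\theta^\star}^{-1}$.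
   Context: Notation: $\mathbb{Z}_+=\{0,1,2,\dots\}$; $\delta_a$ is the Dirac mass at $a$. For $\theta\in\Theta$, let $\omega=(\omega_x)_{x\in\mathbb{Z}}$ be the environment, with law $\mathbb{P}^\theta=\nu_\theta^{\otimes\mathbb{Z}}$ on $(0,1)^{\mathbb{Z}}$ and expectation $\mathbb{E}^\theta$, and let $\rho_x=(1-\omega_x)/\omega_x$. For fixed $\omega$, let $X=(X_t)_{t\in\mathbb{Z}_+}$ be the Markov chain on $\mathbb{Z}$ with $X_0=0$ which jumps from $x$ to $x+1$ with probability $\omega_x$ and to $x-1$ with probability $1-\omega_x$; its law is $P_\omega$. The annealed law is $\mathbf{P}^\theta(\cdot)=\int P_\omega(\cdot)\,d\mathbb{P}^\theta(\omega)$. The process $X$ is generated under a true parameter $\theta^\star=p^\star$, an interior point of $\Theta$, and $\mathbf{P}^\star=\mathbf{P}^{\theta^\star}$. Hitting times: $T_n=\inf\{t: X_t=n\}$. Numbers of left steps: $L_x^n=\sum_{t=0}^{T_n-1}\mathbf{1}\{X_t=x,\,X_{t+1}=x-1\}$ for $x\in\{0,\dots,n\}$. For $u,v\in\mathbb{Z}_+$: $\phi_\theta(u,v)=\log\int_0^1 a^{u+1}(1-a)^v\,d\nu_\theta(a)$, i.e. here $\phi_p(u,v)=\log\big[p\,a_1^{u+1}(1-a_1)^v+(1-p)\,a_2^{u+1}(1-a_2)^v\big]$, and $Q_\theta(u,v)=\binom{u+v}{v}e^{\phi_\theta(u,v)}$. Let $S=(1+\rho_1+\rho_1\rho_2+\cdots+\rho_1\cdots\rho_k+\cdots)^{-1}$,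 $\pi_\theta(u)=\mathbb{E}^\theta[S(1-S)^u]$, $\tilde\pi_\theta(u,v)=\pi_\theta(u)Q_\theta(u,v)$, and $\tilde\pi_\theta(g)=\sum_{(x,y)\in\mathbb{Z}_+^2}\tilde\pi_\theta(x,y)g(x,y)$. Fix an arbitrary $\theta_0\in\Theta$ and define the criterion $\ell_n^{\mathrm{sb}}(\theta)=\sum_{x=0}^{n-1}\big[\phi_\theta(L_{x+1}^n,L_x^n)-\phi_{\theta_0}(L_{x+1}^n,L_x^n)\big]$. $\dot g_\theta$ or $\partial_\theta g_\theta$ denotes the gradient and $\ddot g_\theta$ the Hessian with respect to $\theta$ (here the first and second derivatives in $p$). *)

theory Defs
  imports "HOL-Probability.Probability"
begin

section \<open>The environment\<close>

definition unit_borel :: "real measure" where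
  "unit_borel = restrict_space borel {0<..<1}"

definition two_point :: "real \<Rightarrow> real \<Rightarrow> real \<Rightarrow> real measure" where
  "two_point a1 a2 p = measure_of (space unit_borel) (sets unit_borel)
     (\<lambda>A. ennreal p * emeasure (return unit_borel a1) A
        + ennreal (1 - p) * emeasure (return unit_borel a2) A)"

definition env_law :: "real measure \<Rightarrow> (int \<Rightarrow> real) measure" where
  "env_law \<nu> = (\<Pi>\<^sub>M x\<in>(UNIV :: int set). \<nu>)"

definition rho :: "(int \<Rightarrow> real) \<Rightarrow> int \<Rightarrow> real" where
  "rho \<omega> x = (1 - \<omega> x) / \<omega> x"


section \<open>The walk: quenched and annealed laws on the path space\<close>

definition path_space :: "(nat \<Rightarrow> int) measure" where
  "path_space = (\<Pi>\<^sub>M t\<in>(UNIV :: nat set). count_space (UNIV :: int set))"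

text \<open>\<open>bernoulli_pmf q\<close> gives mass \<open>q\<close> to \<open>True\<close>. \<open>walk_kernel \<omega> t X\<close> is the conditional law of
  the position at time \<open>t\<close> given the earlier positions \<open>X 0, \<dots>, X (t - 1)\<close>.\<close>

definition walk_step :: "(int \<Rightarrow> real) \<Rightarrow> int \<Rightarrow> int pmf" where
  "walk_step \<omega> x = map_pmf (\<lambda>right. if right then x + 1 else x - 1) (bernoulli_pmf (\<omega> x))"

definition walk_kernel :: "(int \<Rightarrow> real) \<Rightarrow> nat \<Rightarrow> (nat \<Rightarrow> int) \<Rightarrow> int measure" where
  "walk_kernel \<omega> t X =
     (case t of 0 \<Rightarrow> measure_pmf (return_pmf 0) | Suc s \<Rightarrow> measure_pmf (walk_step \<omega> (X s)))"

text \<open>The Ionescu-Tulcea extension of the kernels; \<open>quenched_path\<close> below gives its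
  finite-dimensional marginals.\<close>

definition quenched :: "(int \<Rightarrow> real) \<Rightarrow> (nat \<Rightarrow> int) measure" where
  "quenched \<omega> = projective_family.lim UNIV
     (Ionescu_Tulcea.CI (walk_kernel \<omega>) (\<lambda>_. count_space UNIV)) (\<lambda>_. count_space UNIV)"

definition annealed :: "real measure \<Rightarrow> (nat \<Rightarrow> int) measure" where
  "annealed \<nu> = env_law \<nu> \<bind> quenched"


section \<open>Hitting times, left steps, and the criterion\<close>

definition hit_time :: "(nat \<Rightarrow> int) \<Rightarrow> nat \<Rightarrow> enat" where
  "hit_time X n = (INF t\<in>{t. X t = int n}. enat t)"

text \<open>Meaningful when \<open>hit_time X n < \<infinity>\<close>, which holds almost surely for the walks considered.\<close>

definition left_steps :: "(nat \<Rightarrow> int) \<Rightarrow> nat \<Rightarrow> nat \<Rightarrow> nat" where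
  "left_steps X n x =
     (\<Sum>t | enat t < hit_time X n. of_bool (X t = int x \<and> X (t + 1) = int x - 1))"

definition phi :: "real measure \<Rightarrow> nat \<Rightarrow> nat \<Rightarrow> real" where
  "phi \<nu> u v = ln (\<integral>a. a ^ (u + 1) * (1 - a) ^ v \<partial>\<nu>)"

definition criterion ::
  "(real \<Rightarrow> real measure) \<Rightarrow> real \<Rightarrow> nat \<Rightarrow> (nat \<Rightarrow> int) \<Rightarrow> real \<Rightarrow> real" where
  "criterion \<nu> \<theta>0 n X \<theta> =
     (\<Sum>x<n. phi (\<nu> \<theta>) (left_steps X n (x + 1)) (left_steps X n x)
           - phi (\<nu> \<theta>0) (left_steps X n (x + 1)) (left_steps X n x))"


section \<open>The weights on pairs\<close>

definition Qker :: "real measure \<Rightarrow> nat \<Rightarrow> nat \<Rightarrow> real" where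
  "Qker \<nu> u v = real ((u + v) choose v) * exp (phi \<nu> u v)"

text \<open>The series is taken in \<open>[0, \<infinity>]\<close>, so that \<open>S_env \<omega> = 0\<close> when it diverges.\<close>

definition S_env :: "(int \<Rightarrow> real) \<Rightarrow> real" where
  "S_env \<omega> = enn2real (inverse (\<Sum>k. ennreal (\<Prod>j=1..k. rho \<omega> (int j))))"

definition pi_wt :: "real measure \<Rightarrow> nat \<Rightarrow> real" where
  "pi_wt \<nu> u = (\<integral>\<omega>. S_env \<omega> * (1 - S_env \<omega>) ^ u \<partial>env_law \<nu>)"

definition tpi_wt :: "real measure \<Rightarrow> nat \<Rightarrow> nat \<Rightarrow> real" where
  "tpi_wt \<nu> u v = pi_wt \<nu> u * Qker \<nu> u v"

text \<open>The sum of \<open>g\<close> against the weights, for \<open>g\<close> with values in \<open>[0, \<infinity>]\<close> (always defined) and for real-valued \<open>g\<close>.\<close>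

definition tpi_nn :: "real measure \<Rightarrow> (nat \<Rightarrow> nat \<Rightarrow> ennreal) \<Rightarrow> ennreal" where
  "tpi_nn \<nu> g = (\<Sum>\<^sub>\<infinity>(x, y)\<in>UNIV. ennreal (tpi_wt \<nu> x y) * g x y)"

definition tpi :: "real measure \<Rightarrow> (nat \<Rightarrow> nat \<Rightarrow> real) \<Rightarrow> real" where
  "tpi \<nu> g = (\<Sum>\<^sub>\<infinity>(x, y)\<in>UNIV. tpi_wt \<nu> x y * g x y)"

definition tpi_summable :: "real measure \<Rightarrow> (nat \<Rightarrow> nat \<Rightarrow> real) \<Rightarrow> bool" where
  "tpi_summable \<nu> g \<longleftrightarrow> (\<lambda>(x, y). tpi_wt \<nu> x y * g x y) summable_on UNIV"


section \<open>Derivatives in the parameter\<close>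

text \<open>For a compact \<open>\<Theta>\<close> inside \<open>(0, 1)\<close> the derivatives at a point of \<open>\<Theta>\<close> are those of the
  functions on \<open>(0, 1)\<close>, where all of them are defined; \<open>\<Theta>\<close> itself may have isolated points.\<close>

definition dphi :: "(real \<Rightarrow> real measure) \<Rightarrow> real \<Rightarrow> nat \<Rightarrow> nat \<Rightarrow> real" where
  "dphi \<nu> \<theta> u v = deriv (\<lambda>t. phi (\<nu> t) u v) \<theta>"

definition ddphi :: "(real \<Rightarrow> real measure) \<Rightarrow> real \<Rightarrow> nat \<Rightarrow> nat \<Rightarrow> real" where
  "ddphi \<nu> \<theta> u v = deriv (\<lambda>t. dphi \<nu> t u v) \<theta>"

definition Sigma_info :: "(real \<Rightarrow> real measure) \<Rightarrow> real \<Rightarrow> real" where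
  "Sigma_info \<nu> \<theta> = tpi (\<nu> \<theta>) (\<lambda>x y. (dphi \<nu> \<theta> x y)\<^sup>2)"

definition C2_on :: "real set \<Rightarrow> (real \<Rightarrow> real) \<Rightarrow> bool" where
  "C2_on T f \<longleftrightarrow> (\<exists>U. open U \<and> T \<subseteq> U \<and>
     (\<forall>t\<in>U. f differentiable at t \<and> deriv f differentiable at t) \<and>
     continuous_on U (deriv (deriv f)))"


section \<open>Estimators and convergence in probability\<close>

definition argmax_estimator ::
  "(real \<Rightarrow> real measure) \<Rightarrow> real set \<Rightarrow> real \<Rightarrow> real
     \<Rightarrow> (nat \<Rightarrow> (nat \<Rightarrow> int) \<Rightarrow> real) \<Rightarrow> bool" where
  "argmax_estimator \<nu> \<Theta> \<theta>0 \<theta>s est \<longleftrightarrow>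
     (\<forall>n. est n \<in> borel_measurable path_space \<and>
       (AE X in annealed (\<nu> \<theta>s). hit_time X n < \<infinity> \<longrightarrow>
          is_arg_max (criterion \<nu> \<theta>0 n X) (\<lambda>\<theta>. \<theta> \<in> \<Theta>) (est n X)))"

definition tendsto_in_prob :: "'a measure \<Rightarrow> (nat \<Rightarrow> 'a \<Rightarrow> real) \<Rightarrow> real \<Rightarrow> bool" where
  "tendsto_in_prob M Y c \<longleftrightarrow>
     (\<forall>\<epsilon>>0. (\<lambda>n. measure M {X \<in> space M. \<bar>Y n X - c\<bar> > \<epsilon>}) \<longlonglongrightarrow> 0)"


section \<open>Well-posedness of the laws\<close>

lemma space_two_point: "space (two_point a1 a2 p) = {0<..<1}"
proof -
  have "space (two_point a1 a2 p) = space unit_borel"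
    unfolding two_point_def by (rule sets.space_measure_of_eq)
  then show ?thesis by (simp add: unit_borel_def space_restrict_space)
qed

lemma sets_two_point: "sets (two_point a1 a2 p) = sets unit_borel"
  unfolding two_point_def by (rule sets.sets_measure_of_eq)

lemma emeasure_two_point:
  assumes "A \<in> sets unit_borel"
  shows "emeasure (two_point a1 a2 p) A =
    ennreal p * emeasure (return unit_borel a1) A + ennreal (1 - p) * emeasure (return unit_borel a2) A"
  unfolding two_point_def
proof (rule emeasure_measure_of_sigma)
  show "sigma_algebra (space unit_borel) (sets unit_borel)" ..
  show "positive (sets unit_borel) (\<lambda>A. ennreal p * emeasure (return unit_borel a1) A +
      ennreal (1 - p) * emeasure (return unit_borel a2) A)"
    by (simp add: positive_def)
  show "countably_additive (sets unit_borel) (\<lambda>A. ennreal p * emeasure (return unit_borel a1) A +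
      ennreal (1 - p) * emeasure (return unit_borel a2) A)"
  proof (rule countably_additiveI)
    fix A :: "nat \<Rightarrow> real set" assume A: "range A \<subseteq> sets unit_borel" "disjoint_family A"
    have *: "(\<Sum>i. emeasure (return unit_borel c) (A i)) = emeasure (return unit_borel c) (\<Union>i. A i)" for c
      using A by (intro suminf_emeasure) auto
    show "(\<Sum>i. ennreal p * emeasure (return unit_borel a1) (A i) + ennreal (1 - p) * emeasure (return unit_borel a2) (A i))
      = ennreal p * emeasure (return unit_borel a1) (\<Union> (range A)) + ennreal (1 - p) * emeasure (return unit_borel a2) (\<Union> (range A))"
      by (simp add: suminf_add[symmetric] *)
  qed
qed (use assms in auto)

lemma nn_integral_two_point:
  assumes "0 < a1" "a1 < 1" "0 < a2" "a2 < 1" and [measurable]: "f \<in> borel_measurable unit_borel"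
  shows "(\<integral>\<^sup>+x. f x \<partial>two_point a1 a2 p) = ennreal p * f a1 + ennreal (1 - p) * f a2"
  using assms(5)
proof (induction rule: borel_measurable_induct)
  case (cong f g)
  then show ?case using assms(1-4)
    by (subst nn_integral_cong[of _ f g])
       (auto simp: space_two_point unit_borel_def space_restrict_space)
next
  case (set A)
  then show ?case by (simp add: sets_two_point emeasure_two_point)
next
  case (mult u c)
  have [measurable]: "u \<in> borel_measurable (two_point a1 a2 p)"
    using mult by (simp cong: measurable_cong_sets add: sets_two_point)
  show ?case using mult by (simp add: nn_integral_cmult algebra_simps)
next
  case (add u v)
  have [measurable]: "u \<in> borel_measurable (two_point a1 a2 p)" "v \<in> borel_measurable (two_point a1 a2 p)"
    using add by (simp_all cong: measurable_cong_sets add: sets_two_point)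
  show ?case using add by (simp add: nn_integral_add algebra_simps)
next
  case (seq U)
  have [measurable]: "U i \<in> borel_measurable (two_point a1 a2 p)" for i
    using seq by (simp cong: measurable_cong_sets add: sets_two_point)
  have inc: "incseq (\<lambda>i. U i x)" for x
    using seq(3) by (auto simp: incseq_def le_fun_def)
  have "(\<integral>\<^sup>+x. (SUP i. U i) x \<partial>two_point a1 a2 p) = (SUP i. \<integral>\<^sup>+x. U i x \<partial>two_point a1 a2 p)"
    unfolding SUP_apply by (rule nn_integral_monotone_convergence_SUP[OF seq(3)]) simp
  also have "\<dots> = (SUP i. ennreal p * U i a1 + ennreal (1 - p) * U i a2)"
    using seq by simp
  also have "\<dots> = (SUP i. ennreal p * U i a1) + (SUP i. ennreal (1 - p) * U i a2)"
    using inc by (intro ennreal_SUP_add) (auto simp: incseq_def intro!: mult_left_mono)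
  also have "\<dots> = ennreal p * (SUP i. U i) a1 + ennreal (1 - p) * (SUP i. U i) a2"
    by (simp add: SUP_mult_left_ennreal SUP_apply image_image)
  finally show ?case .
qed

lemma prob_space_two_point:
  assumes "0 < a1" "a1 < 1" "0 < a2" "a2 < 1" "0 \<le> p" "p \<le> 1"
  shows "prob_space (two_point a1 a2 p)"
proof
  have "emeasure (two_point a1 a2 p) (space (two_point a1 a2 p)) = (\<integral>\<^sup>+x. 1 \<partial>two_point a1 a2 p)"
    by simp
  also have "\<dots> = 1"
    using assms by (subst nn_integral_two_point) (auto simp flip: ennreal_plus)
  finally show "emeasure (two_point a1 a2 p) (space (two_point a1 a2 p)) = 1" .
qed

lemma phi_two_point:
  assumes "0 < a1" "a1 < 1" "0 < a2" "a2 < 1" "0 \<le> p" "p \<le> 1"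
  shows "phi (two_point a1 a2 p) u v =
    ln (p * (a1 ^ (u + 1) * (1 - a1) ^ v) + (1 - p) * (a2 ^ (u + 1) * (1 - a2) ^ v))"
proof -
  have m: "(\<lambda>a::real. a ^ (u + 1) * (1 - a) ^ v) \<in> borel_measurable unit_borel"
    unfolding unit_borel_def by (rule measurable_restrict_space1) measurable
  have "(\<integral>a. a ^ (u + 1) * (1 - a) ^ v \<partial>two_point a1 a2 p)
    = enn2real (\<integral>\<^sup>+a. ennreal (a ^ (u + 1) * (1 - a) ^ v) \<partial>two_point a1 a2 p)"
    using m by (intro integral_eq_nn_integral AE_I2)
      (auto cong: measurable_cong_sets simp: sets_two_point space_two_point)
  also have "\<dots> = enn2real (ennreal p * ennreal (a1 ^ (u + 1) * (1 - a1) ^ v)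
                    + ennreal (1 - p) * ennreal (a2 ^ (u + 1) * (1 - a2) ^ v))"
    using m assms by (subst nn_integral_two_point) auto
  also have "\<dots> = p * (a1 ^ (u + 1) * (1 - a1) ^ v) + (1 - p) * (a2 ^ (u + 1) * (1 - a2) ^ v)"
    using assms by (simp flip: ennreal_mult ennreal_plus)
  finally show ?thesis unfolding phi_def by simp
qed

lemma Ionescu_Tulcea_walk: "Ionescu_Tulcea (walk_kernel \<omega>) (\<lambda>_. count_space UNIV)"
proof (rule Ionescu_Tulcea.intro)
  show "walk_kernel \<omega> i \<in> measurable (PiM {0..<i} (\<lambda>_. count_space UNIV)) (subprob_algebra (count_space UNIV))" for i
  proof (cases i)
    case 0
    then show ?thesis
      by (simp add: walk_kernel_def[abs_def] measure_pmf_in_subprob_algebra)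
  next
    case (Suc s)
    have "(\<lambda>X. X s) \<in> measurable (PiM {0..<i} (\<lambda>_. count_space UNIV)) (count_space (UNIV::int set))"
      using Suc by (intro measurable_component_singleton) auto
    then have "(\<lambda>X. measure_pmf (walk_step \<omega> (X s))) \<in> measurable (PiM {0..<i} (\<lambda>_. count_space UNIV)) (subprob_algebra (count_space UNIV))"
      by (rule measurable_compose) (auto simp: measure_pmf_in_subprob_algebra)
    then show ?thesis using Suc by (simp add: walk_kernel_def[abs_def])
  qed
  show "prob_space (walk_kernel \<omega> i x)" for i x
    by (cases i) (auto simp: walk_kernel_def prob_space_measure_pmf)
qed

lemma sets_quenched: "sets (quenched \<omega>) = sets path_space"
  and prob_space_quenched: "prob_space (quenched \<omega>)"
proof -
  interpret IT: Ionescu_Tulcea "walk_kernel \<omega>" "\<lambda>_. count_space UNIV"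
    by (rule Ionescu_Tulcea_walk)
  show "sets (quenched \<omega>) = sets path_space"
    unfolding quenched_def path_space_def by simp
  have "emeasure IT.PF.lim (IT.PF.emb UNIV {} {\<lambda>_. undefined}) = emeasure (IT.CI {}) {\<lambda>_. undefined}"
    by (rule IT.lim) (auto simp: sets_PiM_empty)
  moreover have "prob_space (IT.CI {})" by (rule IT.PF.prob_space_P) auto
  moreover have "space (IT.CI {}) = {\<lambda>_. undefined}"
    by (simp add: IT.CI_def space_PiM)
  ultimately show "prob_space (quenched \<omega>)"
    unfolding quenched_def
    by (intro prob_spaceI) (auto simp: prod_emb_def space_PiM restrict_def vimage_def dest: prob_space.emeasure_space_1)
qed

lemma quenched_path:
  "emeasure (quenched \<omega>) {X. \<forall>i\<le>n. X i = x i} =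
     (if x 0 = 0 then (\<Prod>i<n. ennreal (pmf (walk_step \<omega> (x i)) (x (Suc i)))) else 0)"
proof -
  interpret IT: Ionescu_Tulcea "walk_kernel \<omega>" "\<lambda>_. count_space UNIV"
    by (rule Ionescu_Tulcea_walk)
  let ?M = "\<lambda>_::nat. count_space (UNIV::int set)"
  let ?r = "\<lambda>n. restrict x {0..<n}"
  have sp: "?r n \<in> space (PiM {0..<n} ?M)" for n by (auto simp: space_PiM)
  have st: "{?r n} \<in> sets (PiM {0..<n} ?M)" for n
  proof -
    have "{?r n} = PiE {0..<n} (\<lambda>i. {x i})"
      by (auto simp: PiE_iff extensional_def restrict_def fun_eq_iff)
    then show ?thesis by (auto intro!: sets_PiM_I_finite)
  qed
  have C: "emeasure (IT.C 0 (Suc n) (\<lambda>_. undefined)) {?r (Suc n)} =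
     (if x 0 = 0 then (\<Prod>i<n. ennreal (pmf (walk_step \<omega> (x i)) (x (Suc i)))) else 0)" for n
  proof -
    have u: "(\<lambda>_. undefined) \<in> space (PiM {0..<0} ?M)" by (simp add: space_PiM)
    have step: "emeasure (IT.C 0 (Suc m) (\<lambda>_. undefined)) {?r (Suc m)} =
       emeasure (walk_kernel \<omega> m (?r m)) {x m} * emeasure (IT.C 0 m (\<lambda>_. undefined)) {?r m}" for m
    proof -
      have [simp]: "space (IT.C 0 m (\<lambda>_. undefined)) = space (PiM {0..<m} ?M)" "sets (IT.C 0 m (\<lambda>_. undefined)) = sets (PiM {0..<m} ?M)"
        using IT.space_C[OF u, of m] IT.sets_C[OF u, of m] by simp_all
      have "emeasure (IT.C 0 (Suc m) (\<lambda>_. undefined)) {?r (Suc m)} =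
        (\<integral>\<^sup>+y. emeasure (IT.eP m y) {?r (Suc m)} \<partial>IT.C 0 m (\<lambda>_. undefined))"
      proof -
        have "IT.eP m \<in> measurable (IT.C 0 m (\<lambda>_. undefined)) (subprob_algebra (PiM {0..<Suc m} ?M))"
          using IT.measurable_eP[of m] by (simp cong: measurable_cong_sets)
        moreover have "space (IT.C 0 m (\<lambda>_. undefined)) \<noteq> {}" using sp by auto
        ultimately show ?thesis using st[of "Suc m"]
          by (simp del: restrict_apply) (subst emeasure_bind, auto)
      qed
      also have "\<dots> = (\<integral>\<^sup>+y. emeasure (walk_kernel \<omega> m (?r m)) {x m} * indicator {?r m} y \<partial>IT.C 0 m (\<lambda>_. undefined))"
      proof (intro nn_integral_cong)
        fix y assume "y \<in> space (IT.C 0 m (\<lambda>_. undefined))"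
        then have y: "y \<in> space (PiM {0..<m} ?M)" by simp
        have "(\<lambda>z. y(m := z)) -` {?r (Suc m)} \<inter> space (?M m) = (if y = ?r m then {x m} else {})"
          using y by (auto simp: space_PiM PiE_iff extensional_def fun_eq_iff restrict_def less_Suc_eq) (metis less_irrefl)+
        then show "emeasure (IT.eP m y) {?r (Suc m)} = emeasure (walk_kernel \<omega> m (?r m)) {x m} * indicator {?r m} y"
          using IT.emeasure_eP[OF y st] by (auto simp: indicator_def)
      qed
      also have "\<dots> = emeasure (walk_kernel \<omega> m (?r m)) {x m} * emeasure (IT.C 0 m (\<lambda>_. undefined)) {?r m}"
        using st by (subst nn_integral_cmult_indicator) auto
      finally show ?thesis .
    qed
    show ?thesis
    proof (induction n)
      case 0
      have "emeasure (IT.C 0 0 (\<lambda>_. undefined)) {?r 0} = 1"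
        using st[of 0] by (simp add: restrict_def)
      then show ?case using step[of 0]
        by (simp del: IT.C.simps restrict_apply add: walk_kernel_def[of _ 0] emeasure_pmf_single)
    next
      case (Suc n)
      show ?case
        unfolding step[of "Suc n"] Suc.IH
        by (simp add: walk_kernel_def emeasure_pmf_single mult.commute)
    qed
  qed
  have "{X. \<forall>i\<le>n. X i = x i} = IT.PF.emb UNIV {0..<Suc n} {?r (Suc n)}"
  proof -
    have "(restrict X {0..<Suc n} = ?r (Suc n)) = (\<forall>i\<le>n. X i = x i)" for X
    proof
      assume eq: "restrict X {0..<Suc n} = ?r (Suc n)"
      show "\<forall>i\<le>n. X i = x i"
      proof (intro allI impI)
        fix i assume "i \<le> n"
        then show "X i = x i" using fun_cong[OF eq, of i] by simp
      qed
    qed (auto intro!: restrict_ext)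
    then show ?thesis by (simp add: prod_emb_def space_PiM set_eq_iff)
  qed
  then have "emeasure (quenched \<omega>) {X. \<forall>i\<le>n. X i = x i} = emeasure (IT.CI {0..<Suc n}) {?r (Suc n)}"
    unfolding quenched_def using IT.lim[OF _ st[of "Suc n"]] by simp
  also have "\<dots> = emeasure (IT.C 0 (Suc n) (\<lambda>_. undefined)) (IT.PF.emb {0..<Suc n} {0..<Suc n} {?r (Suc n)})"
    by (rule IT.emeasure_CI[OF _ st]) auto
  also have "IT.PF.emb {0..<Suc n} {0..<Suc n} {?r (Suc n)} = {?r (Suc n)}"
    using sp[of "Suc n"] by (auto simp: prod_emb_def space_PiM PiE_iff extensional_restrict)
  finally show ?thesis using C by simp
qed

lemma measurable_quenched:
  assumes [measurable_cong]: "sets \<nu> = sets unit_borel"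
  shows "quenched \<in> measurable (env_law \<nu>) (prob_algebra path_space)"
proof (rule measurable_prob_algebra_generated)
  let ?G = "insert {} {{X. \<forall>i\<le>n. X i = x i} | n x. True} :: (nat \<Rightarrow> int) set set"
  have cyl: "{X. \<forall>i\<le>n. X i = x i} \<in> sets path_space" for n and x :: "nat \<Rightarrow> int"
  proof -
    have "{X. \<forall>i\<le>n. X i = x i} = {X \<in> space path_space. \<forall>i\<le>n. X i = x i}"
      by (auto simp: path_space_def space_PiM)
    also have "\<dots> \<in> sets path_space" unfolding path_space_def by measurable
    finally show ?thesis .
  qed
  show "sets path_space = sigma_sets (space path_space) ?G"
  proof
    show "sigma_sets (space path_space) ?G \<subseteq> sets path_space"
      using cyl by (intro sets.sigma_sets_subset) auto
    interpret sigma_algebra "UNIV :: (nat \<Rightarrow> int) set" "sigma_sets UNIV ?G"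
      by (rule sigma_algebra_sigma_sets) auto
    have c: "{X. X t \<in> B} \<in> sigma_sets UNIV ?G" for t and B :: "int set"
    proof -
      have "{X. X t \<in> B} = (\<Union>l\<in>{l::int list. length l = Suc t \<and> l ! t \<in> B}. {X. \<forall>i\<le>t. X i = l ! i})"
        by (auto intro!: exI[of _ "map _ [0..<Suc t]"] simp del: upt_Suc)
      also have "\<dots> \<in> sigma_sets UNIV ?G"
        by (intro countable_UN' ) (auto intro!: sigma_sets.Basic)
      finally show ?thesis .
    qed
    show "sets path_space \<subseteq> sigma_sets (space path_space) ?G"
    proof -
      have "{{f \<in> UNIV \<rightarrow>\<^sub>E space (count_space UNIV). f i \<in> A} |(i::nat) (A::int set).
          i \<in> UNIV \<and> A \<in> sets (count_space UNIV)} \<subseteq> sigma_sets UNIV ?G"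
      proof
        fix S assume "S \<in> {{f \<in> UNIV \<rightarrow>\<^sub>E space (count_space UNIV). f i \<in> A} |(i::nat) (A::int set).
          i \<in> UNIV \<and> A \<in> sets (count_space UNIV)}"
        then obtain i A where "S = {f :: nat \<Rightarrow> int. f i \<in> A}" by (auto simp: PiE_UNIV_domain)
        then show "S \<in> sigma_sets UNIV ?G" using c by (simp only:)
      qed
      then show ?thesis
        unfolding path_space_def sets_PiM_single space_PiM
        by (simp add: PiE_UNIV_domain sigma_sets_mono)
    qed
  qed
  show "Int_stable ?G"
  proof -
    have *: "{X. \<forall>i\<le>n. X i = x i} \<inter> {X. \<forall>i\<le>m. X i = y i} \<in> ?G" if "n \<le> m" for n m and x y :: "nat \<Rightarrow> int"
    proof (cases "\<forall>i\<le>n. x i = y i")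
      case True
      then have "{X. \<forall>i\<le>n. X i = x i} \<inter> {X. \<forall>i\<le>m. X i = y i} = {X. \<forall>i\<le>m. X i = y i}" using that by auto
      then show ?thesis by blast
    next
      case False
      then have "{X. \<forall>i\<le>n. X i = x i} \<inter> {X. \<forall>i\<le>m. X i = y i} = {}" using that by fastforce
      then show ?thesis by blast
    qed
    have **: "{X. \<forall>i\<le>n. X i = x i} \<inter> {X. \<forall>i\<le>m. X i = y i} \<in> ?G" for n m and x y :: "nat \<Rightarrow> int"
      using *[of n m x y] *[of m n y x] by (cases "n \<le> m") (auto simp: Int_commute)
    show ?thesis
    proof (rule Int_stableI)
      fix A B assume "A \<in> ?G" "B \<in> ?G"
      then consider "A \<inter> B = {}"
        | n x m y where "A = {X. \<forall>i\<le>n. X i = x i}" "B = {X. \<forall>i\<le>m. X i = y i}"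
        by auto
      then show "A \<inter> B \<in> ?G"
      proof cases
        case 1
        then show ?thesis by simp
      next
        case (2 n x m y)
        then show ?thesis using **[of n x m y] by simp
      qed
    qed
  qed
  show "?G \<subseteq> Pow (space path_space)" by (auto simp: path_space_def space_PiM)
  show "prob_space (quenched a)" for a by (rule prob_space_quenched)
  show "sets (quenched a) = sets path_space" for a by (rule sets_quenched)
  fix A assume "A \<in> ?G"
  have q: "(\<lambda>\<omega>. ennreal (pmf (walk_step \<omega> y) z)) \<in> borel_measurable (env_law \<nu>)" for y z
  proof -
    have w [measurable]: "(\<lambda>\<omega>. \<omega> y) \<in> borel_measurable (env_law \<nu>)"
    proof -
      have "(\<lambda>\<omega>. \<omega> y) \<in> measurable (env_law \<nu>) unit_borel"
        unfolding env_law_def by measurable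
      moreover have "(\<lambda>a. a) \<in> measurable unit_borel borel"
        unfolding unit_borel_def by (rule measurable_restrict_space1) simp
      ultimately show ?thesis by (rule measurable_compose)
    qed
    have "pmf (walk_step \<omega> y) z = (if z = y + 1 then min 1 (max 0 (\<omega> y)) else if z = y - 1 then 1 - min 1 (max 0 (\<omega> y)) else 0)" for \<omega>
    proof -
      have "pmf (walk_step \<omega> y) z = pmf (bernoulli_pmf (\<omega> y)) True * of_bool (z = y + 1) + pmf (bernoulli_pmf (\<omega> y)) False * of_bool (z = y - 1)"
        unfolding walk_step_def map_pmf_def
        by (subst pmf_bind) (subst integral_measure_pmf_real[where A=UNIV], auto simp: UNIV_bool indicator_def)
      then show ?thesis by (auto simp: bernoulli_pmf.rep_eq)
    qed
    then show ?thesis by simp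
  qed
  show "(\<lambda>a. emeasure (quenched a) A) \<in> borel_measurable (env_law \<nu>)"
  proof (cases "A = {}")
    case False
    with \<open>A \<in> ?G\<close> obtain n x where A: "A = {X. \<forall>i\<le>n. X i = x i}" by auto
    show ?thesis unfolding A quenched_path using q by (cases "x 0 = 0") auto
  qed simp
qed

lemma emeasure_annealed:
  assumes "prob_space \<nu>" "sets \<nu> = sets unit_borel" "A \<in> sets path_space"
  shows "emeasure (annealed \<nu>) A = (\<integral>\<^sup>+\<omega>. emeasure (quenched \<omega>) A \<partial>env_law \<nu>)"
proof -
  interpret prob_space "env_law \<nu>" unfolding env_law_def by (intro prob_space_PiM assms)
  show ?thesis unfolding annealed_def
    by (rule emeasure_bind[OF _ measurable_prob_algebraD[OF measurable_quenched[OF assms(2)]] assms(3)])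
       (rule not_empty)
qed

end

theory Submission
  imports Defs
begin

text \<open>The left-step counts, read from \<open>n - 1\<close> down to \<open>0\<close>, form under the annealed law a path of the
  Markov chain with kernel \<open>Q\<close> started at \<open>0\<close>, whose invariant law is \<open>\<pi>\<close>. For two atoms the likelihood
  \<open>exp \<phi>\<^sub>p\<close> is affine in \<open>p\<close>. Hence the score \<open>x = \<partial>\<phi>\<^sub>p\<close> is bounded, locally uniformly in \<open>p\<close>, the second
  derivative is \<open>- x\<^sup>2\<close>, and the log-likelihood ratio at \<open>p + h\<close> is the concave function \<open>\<Sum> ln (1 + h x\<^sub>k)\<close>
  of \<open>h\<close>, where the scores \<open>x\<^sub>k\<close> along the path are bounded martingale differences. Concavity confines
  the maximizer to any neighbourhood of \<open>0\<close> once \<open>\<Sum> x\<^sub>k / n\<close> is small and \<open>\<Sum> x\<^sub>k\<^sup>2 / n\<close> is close to the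
  Fisher information, and expanding the score equation gives \<open>h \<approx> \<Sum> x\<^sub>k / \<Sum> x\<^sub>k\<^sup>2\<close>; a law of large
  numbers and a central limit theorem for the chain conclude.\<close>

section \<open>Bounded functionals of Markov chains\<close>

text \<open>The chain starts at the state 0 and not from \<pi>, and no rate of convergence to \<pi>
  is used. Two facts bridge this gap: every entry of \<open>Q\<close> is positive, so the iterated
  averages of a bounded function converge pointwise to their mean; and \<pi> charges every state, so
  a mean-square bound under \<pi> passes to the start 0 at the cost of the factor
  \<open>1 / \<pi>(0)\<close>. Since all functionals are bounded, a Cesaro argument then turns
  pointwise convergence into a law of large numbers in mean square. For the estimator, a single
  event carries both conclusions. Outside it, the log-likelihood ratio is negative at the two points
  at distance \<open>e\<close> from the true value, which localizes the maximizer; being interior,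
  the maximizer also solves the score equation. The remaining inequalities are deterministic, so
  they apply to any measurable selection that maximizes the criterion almost surely.\<close>

lemma cesaro_null:
  fixes c :: "nat \<Rightarrow> real"
  assumes "c \<longlonglongrightarrow> 0"
  shows "(\<lambda>n. (\<Sum>k<n. c k) / real n) \<longlonglongrightarrow> 0"
proof (rule LIMSEQ_I)
  fix r :: real assume r: "0 < r"
  obtain N where N: "\<And>k. k \<ge> N \<Longrightarrow> \<bar>c k\<bar> < r / 2"
    using LIMSEQ_D[OF assms, of "r / 2"] r by auto
  define C where "C = (\<Sum>k<N. \<bar>c k\<bar>)"
  obtain N' :: nat where N': "2 * C / r < real N'" using reals_Archimedean2 by blast
  show "\<exists>no. \<forall>n\<ge>no. norm ((\<Sum>k<n. c k) / real n - 0) < r"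
  proof (intro exI allI impI)
    fix n assume n: "n \<ge> max (Suc N) (Suc N')"
    have "\<bar>\<Sum>k<n. c k\<bar> \<le> (\<Sum>k<n. \<bar>c k\<bar>)" by (rule sum_abs)
    also have "\<dots> = C + (\<Sum>k=N..<n. \<bar>c k\<bar>)"
      unfolding C_def using n by (simp add: lessThan_atLeast0 sum.atLeastLessThan_concat)
    also have "(\<Sum>k=N..<n. \<bar>c k\<bar>) \<le> (\<Sum>k=N..<n. r / 2)"
      using N by (intro sum_mono) (auto intro: less_imp_le)
    also have "\<dots> \<le> real n * (r / 2)" using r by simp
    finally have "\<bar>\<Sum>k<n. c k\<bar> \<le> C + real n * (r / 2)" by simp
    moreover have "C < real n * (r / 2)"
    proof -
      have "real N' < real n" using n by simp
      then have "2 * C / r < real n" using N' by linarith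
      then show ?thesis using r by (simp add: field_simps)
    qed
    ultimately show "norm ((\<Sum>k<n. c k) / real n - 0) < r"
      using n by (simp add: field_simps)
  qed
qed

section \<open>Expectations of bounded functions under discrete laws\<close>

abbreviation expect :: "'a pmf \<Rightarrow> ('a \<Rightarrow> 'b) \<Rightarrow> 'b::{banach, second_countable_topology}" where
  "expect p \<equiv> integral\<^sup>L (measure_pmf p)"

lemma integrable_pmf_bounded:
  fixes f :: "'a \<Rightarrow> 'b::{banach, second_countable_topology}"
  assumes "\<And>x. x \<in> set_pmf p \<Longrightarrow> norm (f x) \<le> B"
  shows "integrable (measure_pmf p) f"
  using assms by (intro measure_pmf.integrable_const_bound[where B=B]) (auto simp: AE_measure_pmf_iff)

lemma expectation_le:
  fixes f :: "'a \<Rightarrow> real"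
  assumes "\<And>x. x \<in> set_pmf p \<Longrightarrow> norm (f x) \<le> C" "\<And>x. x \<in> set_pmf p \<Longrightarrow> f x \<le> B"
  shows "expect p f \<le> B"
  using assms by (intro measure_pmf.integral_le_const integrable_pmf_bounded) (auto simp: AE_measure_pmf_iff)

lemma norm_expectation_le:
  fixes f :: "'a \<Rightarrow> 'b::{banach, second_countable_topology}"
  assumes "\<And>x. x \<in> set_pmf p \<Longrightarrow> norm (f x) \<le> B"
  shows "norm (expect p f) \<le> B"
proof -
  have "norm (expect p f) \<le> expect p (\<lambda>x. norm (f x))"
    by (rule integral_norm_bound)
  also have "\<dots> \<le> B" using assms by (intro expectation_le[where C=B]) auto
  finally show ?thesis .
qed

lemma abs_expectation_le:
  fixes f :: "'a \<Rightarrow> real"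
  assumes "\<And>x. x \<in> set_pmf p \<Longrightarrow> \<bar>f x\<bar> \<le> B"
  shows "\<bar>expect p f\<bar> \<le> B"
  using norm_expectation_le[of p f B] assms by simp

lemma expectation_mono:
  fixes f g :: "'a \<Rightarrow> real"
  assumes "\<And>x. x \<in> set_pmf p \<Longrightarrow> \<bar>f x\<bar> \<le> B" "\<And>x. x \<in> set_pmf p \<Longrightarrow> \<bar>g x\<bar> \<le> C"
    "\<And>x. x \<in> set_pmf p \<Longrightarrow> f x \<le> g x"
  shows "expect p f \<le> expect p g"
  using assms by (intro integral_mono_AE integrable_pmf_bounded) (auto simp: AE_measure_pmf_iff)

lemma pmf_times_le_expectation:
  fixes f :: "'a \<Rightarrow> real"
  assumes "\<And>x. 0 \<le> f x" "\<And>x. f x \<le> B"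
  shows "pmf p x * f x \<le> expect p f"
proof -
  have "pmf p x * f x = expect p (\<lambda>y. f x * indicator {x} y)"
    by (simp add: measure_pmf_single mult.commute)
  also have "\<dots> \<le> expect p f"
    using assms by (intro expectation_mono[where B=B and C=B]) (auto simp: indicator_def order_trans[OF assms])
  finally show ?thesis .
qed

lemma expectation_bind_pmf_real:
  fixes f :: "'b \<Rightarrow> real"
  assumes "\<And>x y. x \<in> set_pmf M \<Longrightarrow> y \<in> set_pmf (N x) \<Longrightarrow> \<bar>f y\<bar> \<le> B"
  shows "expect (bind_pmf M N) f
    = expect M (\<lambda>x. expect (N x) f)"
proof -
  \<comment> \<open>The bound on \<open>f\<close> holds only on the support, whereas integration
    over a bind asks for one on the whole space. The truncation \<open>g\<close> has such a bound
    and agrees with \<open>f\<close> on the support.\<close>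
  define g where "g y = (if \<bar>f y\<bar> \<le> B then f y else 0)" for y
  have "expect (bind_pmf M N) f = expect (bind_pmf M N) g"
    using assms by (intro integral_cong_AE) (auto simp: AE_measure_pmf_iff g_def)
  also have "\<dots> = expect M (\<lambda>x. expect (N x) g)"
    unfolding measure_pmf_bind
    by (rule integral_bind[where K="count_space UNIV" and B="\<bar>B\<bar>" and B'=1])
       (auto simp: g_def measure_pmf_in_subprob_algebra intro: measure_pmf.finite_measure)
  also have "\<dots> = expect M (\<lambda>x. expect (N x) f)"
    using assms by (intro integral_cong_AE) (auto simp: AE_measure_pmf_iff g_def intro!: integral_cong_AE)
  finally show ?thesis .
qed

lemma expectation_bind_pmf_complex:
  fixes f :: "'b \<Rightarrow> complex"
  assumes "\<And>x y. x \<in> set_pmf M \<Longrightarrow> y \<in> set_pmf (N x) \<Longrightarrow> norm (f y) \<le> B"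
  shows "expect (bind_pmf M N) f
    = expect M (\<lambda>x. expect (N x) f)"
proof -
  have i1: "integrable (bind_pmf M N) f" using assms by (intro integrable_pmf_bounded[where B=B]) auto
  have i2: "integrable (N x) f" if "x \<in> set_pmf M" for x
    using assms that by (intro integrable_pmf_bounded[where B=B]) auto
  have i3: "integrable M (\<lambda>x. expect (N x) f)"
    using assms by (intro integrable_pmf_bounded[where B=B] norm_expectation_le) auto
  have *: "\<bar>Re (f y)\<bar> \<le> B" "\<bar>Im (f y)\<bar> \<le> B" if "x \<in> set_pmf M" "y \<in> set_pmf (N x)" for x y
    using assms[OF that] abs_Re_le_cmod abs_Im_le_cmod order_trans by blast+
  show ?thesis
  proof (rule complex_eqI)
    show "Re (expect (bind_pmf M N) f) = Re (expect M (\<lambda>x. expect (N x) f))"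
      unfolding integral_Re[OF i1, symmetric] integral_Re[OF i3, symmetric]
      by (subst expectation_bind_pmf_real[OF *(1)], assumption, assumption)
         (auto intro!: integral_cong_AE simp: AE_measure_pmf_iff i2)
    show "Im (expect (bind_pmf M N) f) = Im (expect M (\<lambda>x. expect (N x) f))"
      unfolding integral_Im[OF i1, symmetric] integral_Im[OF i3, symmetric]
      by (subst expectation_bind_pmf_real[OF *(2)], assumption, assumption)
         (auto intro!: integral_cong_AE simp: AE_measure_pmf_iff i2)
  qed
qed

section \<open>Path laws and additive functionals of the transitions\<close>

fun path_pmf :: "('a \<Rightarrow> 'a pmf) \<Rightarrow> nat \<Rightarrow> 'a \<Rightarrow> 'a list pmf" where
  "path_pmf K 0 x = return_pmf []"
| "path_pmf K (Suc n) x = bind_pmf (K x) (\<lambda>y. map_pmf ((#) y) (path_pmf K n y))"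

text \<open>The start is a separate argument because the lists of \<open>path_pmf\<close> hold only
  the later states; a list of length \<open>n\<close> thus yields \<open>n\<close>
  transitions.\<close>

fun path_sum :: "('a \<Rightarrow> 'a \<Rightarrow> real) \<Rightarrow> 'a \<Rightarrow> 'a list \<Rightarrow> real" where
  "path_sum g x [] = 0"
| "path_sum g x (y # ys) = g x y + path_sum g y ys"

lemma length_path_pmf: "l \<in> set_pmf (path_pmf K n x) \<Longrightarrow> length l = n"
  by (induction n arbitrary: l x) auto

lemma path_sum_bounded:
  assumes "\<And>x y. \<bar>g x y\<bar> \<le> M"
  shows "\<bar>path_sum g x l\<bar> \<le> real (length l) * M"
proof (induction l arbitrary: x)
  case (Cons y l)
  have "\<bar>path_sum g x (y # l)\<bar> \<le> \<bar>g x y\<bar> + \<bar>path_sum g y l\<bar>" by simp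
  with Cons[of y] assms[of x y] show ?case by (simp add: algebra_simps)
qed simp

lemma path_sum_diff_const: "path_sum (\<lambda>x y. g x y - c) x l = path_sum g x l - real (length l) * c"
  by (induction l arbitrary: x) (auto simp: algebra_simps)

context
  fixes K :: "'a \<Rightarrow> 'a pmf" and g :: "'a \<Rightarrow> 'a \<Rightarrow> real" and M :: real
  assumes g: "\<And>x y. \<bar>g x y\<bar> \<le> M"
begin

lemma abs_bound_nonneg: "0 \<le> M" using g[of undefined undefined] by linarith

lemma path_sum_le: "l \<in> set_pmf (path_pmf K n x) \<Longrightarrow> \<bar>path_sum g y l\<bar> \<le> real n * M"
  using path_sum_bounded[of g M y l] length_path_pmf[of l K n x] g by auto

lemma path_sum_sq_le: "l \<in> set_pmf (path_pmf K n x) \<Longrightarrow> \<bar>(path_sum g y l)\<^sup>2\<bar> \<le> (real n * M)\<^sup>2"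
  using path_sum_le[of l n x y] abs_le_square_iff[of "path_sum g y l" "real n * M"] abs_bound_nonneg
  by (simp add: abs_mult)

lemma expectation_path_sum_Suc:
  "expect (path_pmf K (Suc n) x) (path_sum g x)
   = expect (K x) (g x)
     + expect (K x) (\<lambda>y. expect (path_pmf K n y) (path_sum g y))"
proof -
  have i: "integrable (path_pmf K n y) (path_sum g y)" for y
    using path_sum_le by (intro integrable_pmf_bounded[where B="real n * M"]) auto
  have "expect (path_pmf K (Suc n) x) (path_sum g x)
    = expect (K x) (\<lambda>y. g x y + expect (path_pmf K n y) (path_sum g y))"
    unfolding path_pmf.simps
    by (subst expectation_bind_pmf_real[where B="M + real n * M"])
       (auto simp: i intro!: order_trans[OF abs_triangle_ineq] add_mono g path_sum_le)
  also have "\<dots> = expect (K x) (g x)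
     + expect (K x) (\<lambda>y. expect (path_pmf K n y) (path_sum g y))"
  proof (rule Bochner_Integration.integral_add)
    show "integrable (K x) (g x)" using g by (intro integrable_pmf_bounded[where B=M]) auto
    show "integrable (K x) (\<lambda>y. expect (path_pmf K n y) (path_sum g y))"
      using path_sum_le by (intro integrable_pmf_bounded[where B="real n * M"] norm_expectation_le) auto
  qed
  finally show ?thesis .
qed

text \<open>The square of the first increment plus the rest is expanded; in the cross term the rest
  enters only through its conditional mean.\<close>

lemma expectation_path_sum_sq_Suc:
  "expect (path_pmf K (Suc n) x) (\<lambda>l. (path_sum g x l)\<^sup>2)
   = expect (K x) (\<lambda>y. (g x y)\<^sup>2)
     + 2 * expect (K x) (\<lambda>y. g x y * expect (path_pmf K n y) (path_sum g y))
     + expect (K x) (\<lambda>y. expect (path_pmf K n y) (\<lambda>l. (path_sum g y l)\<^sup>2))"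
proof -
  note abs_bound_nonneg
  have i: "integrable (path_pmf K n y) (path_sum g y)" for y
    using path_sum_le by (intro integrable_pmf_bounded[where B="real n * M"]) auto
  have i2: "integrable (path_pmf K n y) (\<lambda>l. (path_sum g y l)\<^sup>2)" for y
    using path_sum_sq_le by (intro integrable_pmf_bounded[where B="(real n * M)\<^sup>2"]) auto
  have g2: "(g x y)\<^sup>2 \<le> M\<^sup>2" for y using g[of x y] by (simp add: abs_le_square_iff[symmetric] abs_bound_nonneg)
  have bd: "\<bar>g x y * expect (path_pmf K n y) (path_sum g y)\<bar> \<le> M * (real n * M)" for y
    unfolding abs_mult by (intro mult_mono g abs_expectation_le path_sum_le) (auto simp: abs_bound_nonneg)
  have "expect (path_pmf K (Suc n) x) (\<lambda>l. (path_sum g x l)\<^sup>2)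
    = expect (K x) (\<lambda>y. expect (path_pmf K n y) (\<lambda>l. (g x y + path_sum g y l)\<^sup>2))"
    unfolding path_pmf.simps
  proof (subst expectation_bind_pmf_real[where B="(M + real n * M)\<^sup>2"])
    fix y l assume "l \<in> set_pmf (map_pmf ((#) y) (path_pmf K n y))"
    then obtain l' where "l = y # l'" "l' \<in> set_pmf (path_pmf K n y)" by auto
    then have "\<bar>path_sum g x l\<bar> \<le> \<bar>g x y\<bar> + \<bar>path_sum g y l'\<bar>" "\<bar>path_sum g y l'\<bar> \<le> real n * M"
      using path_sum_le[of l' n y y] by simp_all
    then have "\<bar>path_sum g x l\<bar> \<le> M + real n * M" using g[of x y] by linarith
    then show "\<bar>(path_sum g x l)\<^sup>2\<bar> \<le> (M + real n * M)\<^sup>2"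
      using abs_bound_nonneg by (simp add: abs_le_square_iff[symmetric])
  qed simp_all
  also have "\<dots> = expect (K x) (\<lambda>y. (g x y)\<^sup>2
       + 2 * (g x y * expect (path_pmf K n y) (path_sum g y))
       + expect (path_pmf K n y) (\<lambda>l. (path_sum g y l)\<^sup>2))"
    by (simp add: power2_sum i i2 ac_simps)
  also have "\<dots> = expect (K x) (\<lambda>y. (g x y)\<^sup>2)
     + 2 * expect (K x) (\<lambda>y. g x y * expect (path_pmf K n y) (path_sum g y))
     + expect (K x) (\<lambda>y. expect (path_pmf K n y) (\<lambda>l. (path_sum g y l)\<^sup>2))"
  proof -
    have a: "integrable (K x) (\<lambda>y. (g x y)\<^sup>2)"
      using g2 by (intro integrable_pmf_bounded[where B="M\<^sup>2"]) auto
    have b: "integrable (K x) (\<lambda>y. g x y * expect (path_pmf K n y) (path_sum g y))"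
      using bd by (intro integrable_pmf_bounded[where B="M * (real n * M)"]) auto
    have c: "integrable (K x) (\<lambda>y. expect (path_pmf K n y) (\<lambda>l. (path_sum g y l)\<^sup>2))"
      using path_sum_sq_le by (intro integrable_pmf_bounded[where B="(real n * M)\<^sup>2"] norm_expectation_le) auto
    show ?thesis using a b c by simp
  qed
  finally show ?thesis .
qed

lemma expectation_path_sum_centered:
  assumes "\<And>x. expect (K x) (g x) = 0"
  shows "expect (path_pmf K n x) (path_sum g x) = 0"
  by (induction n arbitrary: x) (simp_all only: expectation_path_sum_Suc assms, simp_all)

text \<open>Increments with zero conditional mean are orthogonal: the cross term pairs each
  increment with the mean of the later sum, which is 0 from every state. What remains is a sum of
  \<open>n\<close> terms, each at most \<open>M\<^sup>2\<close>.\<close>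

lemma expectation_path_sum_sq_centered:
  assumes "\<And>x. expect (K x) (g x) = 0"
  shows "expect (path_pmf K n x) (\<lambda>l. (path_sum g x l)\<^sup>2) \<le> real n * M\<^sup>2"
proof (induction n arbitrary: x)
  case (Suc n)
  have g2: "(g x y)\<^sup>2 \<le> M\<^sup>2" for y using g[of x y] by (simp add: abs_le_square_iff[symmetric] abs_bound_nonneg)
  have 1: "expect (K x) (\<lambda>y. (g x y)\<^sup>2) \<le> M\<^sup>2"
    using g2 by (intro expectation_le[where C="M\<^sup>2"]) auto
  have 2: "expect (K x) (\<lambda>y. expect (path_pmf K n y) (\<lambda>l. (path_sum g y l)\<^sup>2)) \<le> real n * M\<^sup>2"
    by (intro expectation_le[where C="(real n * M)\<^sup>2"] Suc norm_expectation_le) (use path_sum_sq_le in auto)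
  show ?case unfolding expectation_path_sum_sq_Suc expectation_path_sum_centered[OF assms]
    using 1 2 by (simp add: algebra_simps)
qed simp

end

text \<open>Positivity of all entries of \<open>K\<close> gives irreducibility and aperiodicity at
  once: any two states communicate in one step. Positivity of \<open>\<mu>\<close> transfers
  statements that hold on average under \<open>\<mu>\<close> to each single starting state.\<close>

locale stationary_positive_kernel =
  fixes K :: "'a \<Rightarrow> 'a pmf" and \<mu> :: "'a pmf"
  assumes stationary: "bind_pmf \<mu> K = \<mu>"
    and K_pos: "\<And>x y. 0 < pmf (K x) y"
    and \<mu>_pos: "\<And>x. 0 < pmf \<mu> x"
begin

definition avg :: "('a \<Rightarrow> real) \<Rightarrow> 'a \<Rightarrow> real" where
  "avg f x = expect (K x) f"

lemma avg_bounded: "(\<And>x. \<bar>f x\<bar> \<le> B) \<Longrightarrow> \<bar>avg f x\<bar> \<le> B"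
  unfolding avg_def by (intro abs_expectation_le)

lemma avg_iter_bounded: "(\<And>x. \<bar>f x\<bar> \<le> B) \<Longrightarrow> \<bar>(avg ^^ n) f x\<bar> \<le> B"
  by (induction n arbitrary: x) (auto intro: avg_bounded)

lemma expectation_avg:
  assumes "\<And>x. \<bar>f x\<bar> \<le> B"
  shows "expect \<mu> (avg f) = expect \<mu> f"
  unfolding avg_def using expectation_bind_pmf_real[of \<mu> K f B] assms stationary by simp

text \<open>The variance decrements \<open>\<mu>(f\<^sub>n\<^sup>2) - \<mu>(f\<^sub>n\<^sub>+\<^sub>1\<^sup>2)\<close> of \<open>f\<^sub>n = K\<^sup>n f\<close> tend to \<open>0\<close>; each of them is
  an average of \<open>(f\<^sub>n y - f\<^sub>n\<^sub>+\<^sub>1 x)\<^sup>2\<close> with positive weights, so \<open>f\<^sub>n\<close> becomes constant.\<close>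

lemma avg_iter_tendsto:
  assumes B: "\<And>x. \<bar>f x\<bar> \<le> B"
  shows "(\<lambda>n. (avg ^^ n) f x) \<longlonglongrightarrow> expect \<mu> f"
proof -
  define F where "F n = (avg ^^ n) f" for n
  have F: "\<bar>F n x\<bar> \<le> B" for n x unfolding F_def by (rule avg_iter_bounded[OF B])
  have F_Suc: "F (Suc n) = avg (F n)" for n by (simp add: F_def)
  have F2: "\<bar>(F n x)\<^sup>2\<bar> \<le> B\<^sup>2" for n x using F[of n x] by (simp add: abs_le_square_iff[symmetric])
  define V where "V n = expect \<mu> (\<lambda>x. (F n x)\<^sup>2)" for n
  define D where "D n x = expect (K x) (\<lambda>y. (F n y - F (Suc n) x)\<^sup>2)" for n x
  have i1: "integrable (measure_pmf p) (F n)" for p n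
    using F by (intro integrable_pmf_bounded[where B=B]) auto
  have i2: "integrable (measure_pmf p) (\<lambda>x. (F n x)\<^sup>2)" for p n
    using F2 by (intro integrable_pmf_bounded[where B="B\<^sup>2"]) auto
  have D: "D n x = avg (\<lambda>y. (F n y)\<^sup>2) x - (F (Suc n) x)\<^sup>2" for n x
  proof -
    have "D n x = expect (K x) (\<lambda>y. (F n y)\<^sup>2 + (F (Suc n) x)\<^sup>2 - 2 * F (Suc n) x * F n y)"
      unfolding D_def power2_diff by (simp add: ac_simps)
    also have "\<dots> = avg (\<lambda>y. (F n y)\<^sup>2) x + (F (Suc n) x)\<^sup>2 - 2 * F (Suc n) x * avg (F n) x"
      unfolding avg_def by (simp add: i1 i2)
    also have "\<dots> = avg (\<lambda>y. (F n y)\<^sup>2) x - (F (Suc n) x)\<^sup>2"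
      unfolding F_Suc[of n] by (simp add: power2_eq_square)
    finally show ?thesis .
  qed
  have sq: "(F n y - F (Suc n) x)\<^sup>2 \<le> (2 * B)\<^sup>2" for n x y
  proof -
    have "\<bar>F n y - F (Suc n) x\<bar> \<le> \<bar>2 * B\<bar>" using F[of n y] F[of "Suc n" x] by linarith
    then show ?thesis by (simp add: abs_le_square_iff)
  qed
  have D_nonneg: "0 \<le> D n x" for n x unfolding D_def by simp
  have D_le: "D n x \<le> (2 * B)\<^sup>2" for n x
    unfolding D_def using sq by (intro expectation_le[where C="(2 * B)\<^sup>2"]) auto
  have VD: "expect \<mu> (D n) = V n - V (Suc n)" for n
  proof -
    have "expect \<mu> (D n) = expect \<mu> (\<lambda>x. avg (\<lambda>y. (F n y)\<^sup>2) x - (F (Suc n) x)\<^sup>2)"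
      by (simp add: D[abs_def])
    also have "\<dots> = expect \<mu> (avg (\<lambda>y. (F n y)\<^sup>2)) - V (Suc n)"
      unfolding V_def
      by (intro Bochner_Integration.integral_diff i2 integrable_pmf_bounded[where B="B\<^sup>2"])
         (use avg_bounded[OF F2] in auto)
    also have "expect \<mu> (avg (\<lambda>y. (F n y)\<^sup>2)) = V n"
      unfolding V_def by (rule expectation_avg[OF F2])
    finally show ?thesis .
  qed
  have "decseq V"
    unfolding decseq_Suc_iff
  proof
    fix n
    have "0 \<le> expect \<mu> (D n)" using D_nonneg by (rule Bochner_Integration.integral_nonneg)
    then show "V (Suc n) \<le> V n" unfolding VD by simp
  qed
  then obtain L where "V \<longlonglongrightarrow> L"
    using decseq_convergent[of V 0] unfolding V_def by auto
  then have V0: "(\<lambda>n. V n - V (Suc n)) \<longlonglongrightarrow> 0"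
    using tendsto_diff[of V L _ "\<lambda>n. V (Suc n)" L] LIMSEQ_Suc[of V L] by simp
  have step: "(\<lambda>n. F n y - F (Suc n) x) \<longlonglongrightarrow> 0" for x y
  proof -
    have le: "pmf \<mu> x * (pmf (K x) y * (F n y - F (Suc n) x)\<^sup>2) \<le> V n - V (Suc n)" for n
    proof -
      have "pmf (K x) y * (F n y - F (Suc n) x)\<^sup>2 \<le> D n x"
        unfolding D_def by (rule pmf_times_le_expectation[where B="(2 * B)\<^sup>2"]) (use sq in auto)
      then have "pmf \<mu> x * (pmf (K x) y * (F n y - F (Suc n) x)\<^sup>2) \<le> pmf \<mu> x * D n x"
        by (rule mult_left_mono) simp
      also have "\<dots> \<le> V n - V (Suc n)"
        unfolding VD[symmetric] by (rule pmf_times_le_expectation[OF D_nonneg D_le])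
      finally show ?thesis .
    qed
    have "(\<lambda>n. pmf \<mu> x * (pmf (K x) y * (F n y - F (Suc n) x)\<^sup>2)) \<longlonglongrightarrow> 0"
      by (rule tendsto_sandwich[OF _ _ tendsto_const V0]) (use le in auto)
    then have "(\<lambda>n. (F n y - F (Suc n) x)\<^sup>2) \<longlonglongrightarrow> 0"
      using K_pos[of x y] \<mu>_pos[of x] by (simp add: tendsto_mult_left_iff)
    then show ?thesis by simp
  qed
  \<comment> \<open>Both values at time \<open>n\<close> are compared with the same
    \<open>F (Suc n) x\<close>.\<close>
  have diff: "(\<lambda>n. F n x - F n y) \<longlonglongrightarrow> 0" for y
    using tendsto_diff[OF step[of x x] step[of y x]] by simp
  have EF: "expect \<mu> (F n) = expect \<mu> f" for n
  proof (induction n)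
    case (Suc n) then show ?case unfolding F_Suc by (subst expectation_avg[OF F])
  qed (simp add: F_def)
  \<comment> \<open>The convergence is only pointwise in \<open>y\<close>. Dominated convergence
    averages it over \<open>\<mu>\<close>, under which the mean of \<open>F n\<close> does not
    change with \<open>n\<close>.\<close>
  have "(\<lambda>n. expect \<mu> (\<lambda>y. F n x - F n y)) \<longlonglongrightarrow> expect \<mu> (\<lambda>y. 0)"
  proof (rule integral_dominated_convergence[where w="\<lambda>_. 2 * B"])
    show "AE y in \<mu>. norm (F n x - F n y) \<le> 2 * B" for n
    proof (rule AE_I2)
      fix y show "norm (F n x - F n y) \<le> 2 * B" using F[of n x] F[of n y] by simp
    qed
  qed (use diff in auto)
  then have "(\<lambda>n. F n x - expect \<mu> f) \<longlonglongrightarrow> 0"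
    by (simp add: i1 EF)
  then show ?thesis unfolding F_def by (simp add: LIM_zero_iff)
qed

lemma expectation_path_sum:
  assumes "\<And>x y. \<bar>g x y\<bar> \<le> M"
  shows "expect (path_pmf K n x) (path_sum g x)
    = (\<Sum>k<n. (avg ^^ k) (\<lambda>x. expect (K x) (g x)) x)"
proof (induction n arbitrary: x)
  case (Suc n)
  let ?h = "\<lambda>x. expect (K x) (g x)"
  have h: "\<bar>?h x\<bar> \<le> M" for x using assms by (intro abs_expectation_le)
  have "expect (K x) (\<lambda>y. \<Sum>k<n. (avg ^^ k) ?h y) = (\<Sum>k<n. avg ((avg ^^ k) ?h) x)"
    unfolding avg_def[of _ x]
    by (intro Bochner_Integration.integral_sum integrable_pmf_bounded[where B=M])
       (use avg_iter_bounded[of ?h M] h in auto)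
  then show ?case
    unfolding expectation_path_sum_Suc[OF assms] Suc by (simp add: sum.lessThan_Suc_shift del: sum.lessThan_Suc)
qed simp

text \<open>Each step adds to the second moment a cross term of at most \<open>2 * M\<close> times
  the mean size of the conditional mean of the later sum. Under \<open>\<mu>\<close> that size is at
  most the sum of the \<open>c k\<close>, and \<open>c k\<close> tends to 0 because the iterated
  averages do. The second moment is then of order \<open>n\<close> plus \<open>n\<close> times
  \<open>o(n)\<close>, that is \<open>o(n\<^sup>2)\<close>.\<close>

lemma lln_centered:
  assumes g: "\<And>x y. \<bar>g x y\<bar> \<le> M"
    and zero: "expect \<mu> (\<lambda>x. expect (K x) (g x)) = 0"
  shows "(\<lambda>n. expect (path_pmf K n x) (\<lambda>l. (path_sum g x l / real n)\<^sup>2)) \<longlonglongrightarrow> 0"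
proof -
  define h where "h x = expect (K x) (g x)" for x
  define m where "m n x = expect (path_pmf K n x) (path_sum g x)" for n x
  define A where "A n x = expect (path_pmf K n x) (\<lambda>l. (path_sum g x l)\<^sup>2)" for n x
  define c where "c k = expect \<mu> (\<lambda>x. \<bar>(avg ^^ k) h x\<bar>)" for k
  have M: "0 \<le> M" using g by (rule abs_bound_nonneg)
  have h: "\<bar>h x\<bar> \<le> M" for x unfolding h_def using g by (intro abs_expectation_le)
  have hk: "\<bar>(avg ^^ k) h x\<bar> \<le> M" for k x by (rule avg_iter_bounded[OF h])
  have c_nonneg: "0 \<le> c k" for k unfolding c_def by simp
  have "c \<longlonglongrightarrow> expect \<mu> (\<lambda>x. 0)"
    unfolding c_def
  proof (rule integral_dominated_convergence[where w="\<lambda>_. M"])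
    show "AE x in \<mu>. (\<lambda>k. \<bar>(avg ^^ k) h x\<bar>) \<longlonglongrightarrow> 0"
    proof (rule AE_I2)
      fix x
      have "(\<lambda>k. (avg ^^ k) h x) \<longlonglongrightarrow> 0"
        using avg_iter_tendsto[of h M x, OF h] zero by (simp add: h_def[abs_def])
      then show "(\<lambda>k. \<bar>(avg ^^ k) h x\<bar>) \<longlonglongrightarrow> 0" by (rule tendsto_rabs_zero)
    qed
  qed (use hk in auto)
  then have c0: "c \<longlonglongrightarrow> 0" by simp
  have Em: "expect \<mu> (\<lambda>x. \<bar>m n x\<bar>) \<le> (\<Sum>k<n. c k)" for n
  proof -
    have "expect \<mu> (\<lambda>x. \<bar>m n x\<bar>) \<le> expect \<mu> (\<lambda>x. \<Sum>k<n. \<bar>(avg ^^ k) h x\<bar>)"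
    proof (rule expectation_mono)
      fix x
      show "\<bar>m n x\<bar> \<le> (\<Sum>k<n. \<bar>(avg ^^ k) h x\<bar>)"
        unfolding m_def expectation_path_sum[OF g] h_def[symmetric] by (rule sum_abs)
      show "\<bar>\<bar>m n x\<bar>\<bar> \<le> real n * M"
        unfolding m_def using path_sum_le[OF g] by (auto intro!: abs_expectation_le)
      have "(\<Sum>k<n. \<bar>(avg ^^ k) h x\<bar>) \<le> (\<Sum>k<n. M)" by (intro sum_mono hk)
      then show "\<bar>\<Sum>k<n. \<bar>(avg ^^ k) h x\<bar>\<bar> \<le> real n * M" by simp
    qed
    also have "\<dots> = (\<Sum>k<n. c k)"
      unfolding c_def using hk
      by (intro Bochner_Integration.integral_sum integrable_pmf_bounded[where B=M]) auto
    finally show ?thesis .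
  qed
  have A_nonneg: "0 \<le> A n x" for n x unfolding A_def by simp
  have A_le: "\<bar>A n x\<bar> \<le> (real n * M)\<^sup>2" for n x
    unfolding A_def by (intro abs_expectation_le path_sum_sq_le[OF g])
  have m_le: "\<bar>m n x\<bar> \<le> real n * M" for n x
    unfolding m_def by (intro abs_expectation_le path_sum_le[OF g])
  have A_Suc: "A (Suc n) x \<le> M\<^sup>2 + 2 * M * avg (\<lambda>y. \<bar>m n y\<bar>) x + avg (A n) x" for n x
  proof -
    have "expect (K x) (\<lambda>y. (g x y)\<^sup>2) \<le> M\<^sup>2"
      using g[of x] M by (intro expectation_le[where C="M\<^sup>2"]) (auto simp: abs_le_square_iff[symmetric])
    moreover have "expect (K x) (\<lambda>y. g x y * m n y) \<le> expect (K x) (\<lambda>y. M * \<bar>m n y\<bar>)"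
    proof (rule expectation_mono)
      fix y
      show 1: "\<bar>g x y * m n y\<bar> \<le> M * (real n * M)"
        unfolding abs_mult by (intro mult_mono g m_le) (auto simp: M)
      show "\<bar>M * \<bar>m n y\<bar>\<bar> \<le> M * (real n * M)"
        unfolding abs_mult using M by (auto intro!: mult_mono m_le)
      have "g x y * m n y \<le> \<bar>g x y\<bar> * \<bar>m n y\<bar>" by (metis abs_ge_self abs_mult)
      also have "\<dots> \<le> M * \<bar>m n y\<bar>" by (intro mult_right_mono g) auto
      finally show "g x y * m n y \<le> M * \<bar>m n y\<bar>" .
    qed
    ultimately show ?thesis
      unfolding A_def[of "Suc n"] expectation_path_sum_sq_Suc[OF g] avg_def m_def[symmetric] A_def[symmetric]
      by simp
  qed
  define B where "B n = expect \<mu> (A n)" for n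
  have B_Suc: "B (Suc n) \<le> B n + M\<^sup>2 + 2 * M * (\<Sum>k<n. c k)" for n
  proof -
    have mm: "\<bar>\<bar>m n x\<bar>\<bar> \<le> real n * M" for x using m_le by simp
    have i1: "integrable \<mu> (avg (\<lambda>y. \<bar>m n y\<bar>))"
      using avg_bounded[OF mm] by (intro integrable_pmf_bounded[where B="real n * M"]) auto
    have i2: "integrable \<mu> (avg (A n))"
      using avg_bounded[OF A_le] by (intro integrable_pmf_bounded[where B="(real n * M)\<^sup>2"]) auto
    have "B (Suc n) \<le> expect \<mu> (\<lambda>x. M\<^sup>2 + 2 * M * avg (\<lambda>y. \<bar>m n y\<bar>) x + avg (A n) x)"
      unfolding B_def
    proof (rule integral_mono[OF _ _ A_Suc])
      show "integrable \<mu> (A (Suc n))"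
        using A_le[of "Suc n"] by (intro integrable_pmf_bounded[where B="(real (Suc n) * M)\<^sup>2"]) auto
      show "integrable \<mu> (\<lambda>x. M\<^sup>2 + 2 * M * avg (\<lambda>y. \<bar>m n y\<bar>) x + avg (A n) x)"
        using i1 i2 by simp
    qed
    also have "\<dots> = M\<^sup>2 + 2 * M * expect \<mu> (\<lambda>y. \<bar>m n y\<bar>) + B n"
      using i1 i2 expectation_avg[OF mm] expectation_avg[OF A_le] by (simp add: B_def)
    also have "\<dots> \<le> B n + M\<^sup>2 + 2 * M * (\<Sum>k<n. c k)"
      using mult_left_mono[OF Em[of n], of "2 * M"] M by simp
    finally show ?thesis .
  qed
  \<comment> \<open>The sums of the \<open>c k\<close> grow with \<open>n\<close>, so each of the
    \<open>n\<close> increments is bounded by means of the last sum.\<close>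
  have B_le: "B n \<le> real n * M\<^sup>2 + 2 * M * (real n * (\<Sum>k<n. c k))" for n
  proof (induction n)
    case 0 show ?case by (simp add: B_def A_def[abs_def])
  next
    case (Suc n)
    have "real n * (\<Sum>k<n. c k) + (\<Sum>k<n. c k) \<le> real (Suc n) * (\<Sum>k<Suc n. c k)"
      using c_nonneg[of n] by (simp add: algebra_simps)
    from mult_left_mono[OF this, of "2 * M"] M
    show ?case using B_Suc[of n] Suc by (simp add: algebra_simps)
  qed
  have lim: "(\<lambda>n. M\<^sup>2 / real n + 2 * M * ((\<Sum>k<n. c k) / real n)) \<longlonglongrightarrow> 0 + 2 * M * 0"
    by (intro tendsto_add tendsto_mult tendsto_const cesaro_null c0 lim_const_over_n)
  have B0: "(\<lambda>n. B n / (real n)\<^sup>2) \<longlonglongrightarrow> 0"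
  proof (rule tendsto_sandwich[OF _ _ tendsto_const])
    show "\<forall>\<^sub>F n in sequentially. B n / (real n)\<^sup>2 \<le> M\<^sup>2 / real n + 2 * M * ((\<Sum>k<n. c k) / real n)"
    proof (intro always_eventually allI)
      fix n
      have "B n / (real n)\<^sup>2 \<le> (real n * M\<^sup>2 + 2 * M * (real n * (\<Sum>k<n. c k))) / (real n)\<^sup>2"
        by (intro divide_right_mono B_le) simp
      also have "\<dots> = M\<^sup>2 / real n + 2 * M * ((\<Sum>k<n. c k) / real n)"
        by (cases "n = 0") (simp_all add: field_simps power2_eq_square)
      finally show "B n / (real n)\<^sup>2 \<le> M\<^sup>2 / real n + 2 * M * ((\<Sum>k<n. c k) / real n)" .
    qed
    show "\<forall>\<^sub>F n in sequentially. 0 \<le> B n / (real n)\<^sup>2" by (simp add: B_def A_nonneg)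
  qed (use lim in simp)
  \<comment> \<open>From the average over \<open>\<mu>\<close> to the fixed start \<open>x\<close>:
    a single atom contributes at most the whole average, which costs the constant factor
    \<open>1 / pmf \<mu> x\<close>.\<close>
  have "(\<lambda>n. A n x / (real n)\<^sup>2) \<longlonglongrightarrow> 0"
  proof (rule tendsto_sandwich[OF _ _ tendsto_const])
    show "\<forall>\<^sub>F n in sequentially. A n x / (real n)\<^sup>2 \<le> (B n / (real n)\<^sup>2) / pmf \<mu> x"
    proof (intro always_eventually allI)
      fix n
      have "pmf \<mu> x * A n x \<le> B n"
        unfolding B_def by (rule pmf_times_le_expectation[OF A_nonneg, where B="(real n * M)\<^sup>2"]) (use A_le abs_le_D1 in blast)
      then have "A n x \<le> B n / pmf \<mu> x" using \<mu>_pos[of x] by (simp add: field_simps)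
      then have "A n x / (real n)\<^sup>2 \<le> B n / pmf \<mu> x / (real n)\<^sup>2" by (intro divide_right_mono) auto
      then show "A n x / (real n)\<^sup>2 \<le> (B n / (real n)\<^sup>2) / pmf \<mu> x" by (simp add: mult.commute)
    qed
    show "(\<lambda>n. B n / (real n)\<^sup>2 / pmf \<mu> x) \<longlonglongrightarrow> 0"
      using tendsto_divide[OF B0 tendsto_const, of "pmf \<mu> x"] \<mu>_pos[of x] by simp
  qed (simp add: A_nonneg)
  then show ?thesis unfolding A_def by (simp add: power_divide)
qed

lemma lln:
  assumes g: "\<And>x y. \<bar>g x y\<bar> \<le> M"
    and c: "c = expect \<mu> (\<lambda>x. expect (K x) (g x))"
  shows "(\<lambda>n. expect (path_pmf K n x) (\<lambda>l. (path_sum g x l / real n - c)\<^sup>2)) \<longlonglongrightarrow> 0"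
proof -
  have i: "integrable (K x) (g x)" for x using g by (intro integrable_pmf_bounded[where B=M]) auto
  have i': "integrable \<mu> (\<lambda>x. expect (K x) (g x))"
    using g by (intro integrable_pmf_bounded[where B=M] norm_expectation_le) auto
  have z: "expect \<mu> (\<lambda>x. expect (K x) (\<lambda>y. g x y - c)) = 0"
    using i i' c by simp
  have b: "\<bar>g x y - c\<bar> \<le> M + \<bar>c\<bar>" for x y using g[of x y] by linarith
  have "(\<lambda>n. expect (path_pmf K n x) (\<lambda>l. (path_sum (\<lambda>x y. g x y - c) x l / real n)\<^sup>2)) \<longlonglongrightarrow> 0"
    by (rule lln_centered[OF b z])
  moreover have "\<forall>\<^sub>F n in sequentially.
      expect (path_pmf K n x) (\<lambda>l. (path_sum (\<lambda>x y. g x y - c) x l / real n)\<^sup>2)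
    = expect (path_pmf K n x) (\<lambda>l. (path_sum g x l / real n - c)\<^sup>2)"
    using eventually_gt_at_top[of 0]
  proof eventually_elim
    case (elim n)
    show ?case
      using elim by (intro integral_cong_AE) (auto simp: AE_measure_pmf_iff path_sum_diff_const length_path_pmf diff_divide_distrib)
  qed
  ultimately show ?thesis by (rule Lim_transform_eventually)
qed

end

section \<open>Central limit theorem for bounded martingale differences along the chain\<close>

lemma norm_exp_corrected_le:
  fixes a :: real
  assumes "\<bar>a\<bar> \<le> 1"
  shows "norm (exp (Complex (a\<^sup>2 / 2) a) - 1 - \<i> * a) \<le> 16 * \<bar>a\<bar> ^ 3"
proof -
  define w where "w = Complex (a\<^sup>2 / 2) a"
  have w: "w = \<i> * a + a\<^sup>2 / 2" unfolding w_def by (simp add: complex_eq_iff)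
  have a2: "a\<^sup>2 \<le> \<bar>a\<bar>" using assms mult_left_le_one_le[of "\<bar>a\<bar>" "\<bar>a\<bar>"] by (simp add: power2_eq_square abs_mult_self_eq)
  have nw: "norm w \<le> 3 / 2 * \<bar>a\<bar>"
  proof -
    have "norm w \<le> norm (\<i> * a) + norm (complex_of_real (a\<^sup>2 / 2))" unfolding w by (metis norm_triangle_ineq of_real_divide of_real_numeral of_real_power)
    also have "\<dots> \<le> 3 / 2 * \<bar>a\<bar>" using a2 by (simp add: norm_mult norm_divide norm_power)
    finally show ?thesis .
  qed
  have e: "exp \<bar>Re w\<bar> \<le> 2"
  proof -
    have "exp \<bar>Re w\<bar> \<le> exp (1 / 2)" using a2 assms by (simp add: w_def)
    also have "\<dots> \<le> 2" using exp_bound_half[of "1 / 2 :: real"] by simp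
    finally show ?thesis .
  qed
  have "norm (exp w - (\<Sum>k\<le>2. w ^ k / fact k)) \<le> exp \<bar>Re w\<bar> * norm w ^ Suc 2 / fact 2"
    by (rule Taylor_exp)
  also have "\<dots> \<le> 2 * (3 / 2 * \<bar>a\<bar>) ^ Suc 2 / fact 2"
    using e nw by (intro divide_right_mono mult_mono power_mono) auto
  also have "\<dots> = 27 / 8 * \<bar>a\<bar> ^ 3" by (simp add: power_mult_distrib power3_eq_cube)
  finally have 1: "norm (exp w - (1 + w + w\<^sup>2 / 2)) \<le> 27 / 8 * \<bar>a\<bar> ^ 3"
    by (simp add: numeral_2_eq_2)
  \<comment> \<open>The real part \<open>a\<^sup>2 / 2\<close> of \<open>w\<close> is there to
    cancel the \<open>- a\<^sup>2 / 2\<close> produced by half the square of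
    \<open>\<i> * a\<close>, so only terms of order three and higher are left. Together with the
    Taylor remainder the constants add up to 4; the bound 16 is generous.\<close>
  have "1 + w + w\<^sup>2 / 2 - 1 - \<i> * a = \<i> * (a ^ 3 / 2) + a ^ 4 / 8"
    unfolding w by (simp add: power2_eq_square power3_eq_cube power4_eq_xxxx algebra_simps add_divide_distrib diff_divide_distrib)
  also have "norm \<dots> \<le> \<bar>a\<bar> ^ 3 / 2 + \<bar>a\<bar> ^ 4 / 8"
    by (rule order_trans[OF norm_triangle_ineq]) (simp add: norm_mult norm_divide norm_power)
  also have "\<bar>a\<bar> ^ 4 \<le> \<bar>a\<bar> ^ 3" using assms by (intro power_decreasing) auto
  finally have 2: "norm (1 + w + w\<^sup>2 / 2 - 1 - \<i> * a) \<le> \<bar>a\<bar> ^ 3 / 2 + \<bar>a\<bar> ^ 3 / 8" by simp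
  have "norm (exp w - 1 - \<i> * a) = norm ((exp w - (1 + w + w\<^sup>2 / 2)) + (1 + w + w\<^sup>2 / 2 - 1 - \<i> * a))" by (simp add: algebra_simps)
  also have "\<dots> \<le> 27 / 8 * \<bar>a\<bar> ^ 3 + (\<bar>a\<bar> ^ 3 / 2 + \<bar>a\<bar> ^ 3 / 8)"
    using norm_triangle_mono[OF 1 2] .
  also have "\<dots> \<le> 16 * \<bar>a\<bar> ^ 3" by simp
  finally show ?thesis unfolding w_def .
qed

text \<open>The factors \<open>exp (i s x + s\<^sup>2 x\<^sup>2 / 2)\<close> have conditional mean \<open>1 + O(s\<^sup>3)\<close>, so the mean of their
  product over the path is \<open>1 + O(n s\<^sup>3)\<close>.\<close>

lemma path_sum_exp_expectation:
  fixes K :: "'a \<Rightarrow> 'a pmf"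
  assumes g: "\<And>x y. \<bar>g x y\<bar> \<le> M"
    and zero: "\<And>x. expect (K x) (g x) = 0"
    and s: "\<bar>s\<bar> * M \<le> 1"
  defines "E \<equiv> \<lambda>x l. exp (Complex (s\<^sup>2 / 2 * path_sum (\<lambda>x y. (g x y)\<^sup>2) x l) (s * path_sum g x l))"
  shows "norm (expect (path_pmf K n x) (E x) - 1)
    \<le> real n * exp (real n * (s\<^sup>2 * M\<^sup>2 / 2)) * (16 * \<bar>s * M\<bar> ^ 3)"
proof (induction n arbitrary: x)
  case 0 show ?case by (simp add: E_def zero_complex.code[symmetric])
next
  case (Suc n)
  have M: "0 \<le> M" using g by (rule abs_bound_nonneg)
  have g2: "\<bar>(g x y)\<^sup>2\<bar> \<le> M\<^sup>2" for x y using g[of x y] M by (simp add: abs_le_square_iff[symmetric])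
  define D where "D x y = exp (Complex ((s * g x y)\<^sup>2 / 2) (s * g x y))" for x y
  define C where "C = exp (s\<^sup>2 * M\<^sup>2 / 2)"
  define \<delta> where "\<delta> = 16 * \<bar>s * M\<bar> ^ 3"
  have C1: "1 \<le> C" unfolding C_def by simp
  have \<delta>0: "0 \<le> \<delta>" unfolding \<delta>_def by simp
  have E_Cons: "E x (y # l) = D x y * E y l" for x y l
    unfolding E_def D_def exp_add[symmetric]
    by (intro arg_cong[where f=exp]) (simp add: algebra_simps power_mult_distrib complex_eq_iff)
  have nD: "norm (D x y) \<le> C" for x y
    unfolding D_def C_def norm_exp_eq_Re using mult_left_mono[OF g2[of x y], of "s\<^sup>2"]
    by (simp add: power_mult_distrib)
  have nE: "norm (E x l) \<le> C ^ n" if "length l = n" for x l n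
    using that
  proof (induction l arbitrary: x n)
    case Nil then show ?case by (simp add: E_def zero_complex.code[symmetric])
  next
    case (Cons y l)
    then show ?case unfolding E_Cons norm_mult using C1 by (auto intro!: mult_mono nD)
  qed
  have iE: "integrable (path_pmf K n y) (E y)" for y
    using nE by (intro integrable_pmf_bounded[where B="C ^ n"]) (auto simp: length_path_pmf)
  define \<psi> where "\<psi> y = expect (path_pmf K n y) (E y)" for y
  have n\<psi>: "norm (\<psi> y) \<le> C ^ n" for y
    unfolding \<psi>_def using nE by (intro norm_expectation_le) (auto simp: length_path_pmf)
  have "expect (path_pmf K (Suc n) x) (E x) = expect (K x) (\<lambda>y. D x y * \<psi> y)"
    unfolding path_pmf.simps
  proof (subst expectation_bind_pmf_complex[where B="C ^ Suc n"])
    fix y l assume "l \<in> set_pmf (map_pmf ((#) y) (path_pmf K n y))"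
    then have "length l = Suc n" by (auto simp: length_path_pmf)
    then show "norm (E x l) \<le> C ^ Suc n" by (rule nE)
  qed (simp add: E_Cons \<psi>_def iE)
  \<comment> \<open>The splitting separates two errors: \<open>\<psi> y - 1\<close>, which the
    induction hypothesis controls for every \<open>y\<close>, and the distance of the mean of
    \<open>D x\<close> from 1, which is small because \<open>g x\<close> has conditional mean
    0.\<close>
  also have "\<dots> = expect (K x) (\<lambda>y. D x y * (\<psi> y - 1) + D x y)"
    by (simp add: algebra_simps)
  also have "\<dots> = expect (K x) (\<lambda>y. D x y * (\<psi> y - 1)) + expect (K x) (D x)"
  proof (rule Bochner_Integration.integral_add)
    show "integrable (K x) (\<lambda>y. D x y * (\<psi> y - 1))"
      using nD n\<psi> C1 by (intro integrable_pmf_bounded[where B="C * (C ^ n + 1)"])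
        (auto simp: norm_mult intro!: mult_mono order_trans[OF norm_triangle_ineq4])
    show "integrable (K x) (D x)" using nD by (intro integrable_pmf_bounded[where B=C])
  qed
  finally have "expect (path_pmf K (Suc n) x) (E x) - 1
    = expect (K x) (\<lambda>y. D x y * (\<psi> y - 1)) + (expect (K x) (D x) - 1)" by simp
  moreover have "norm (expect (K x) (\<lambda>y. D x y * (\<psi> y - 1))) \<le> C * (real n * C ^ n * \<delta>)"
  proof (rule norm_expectation_le)
    fix y
    have "norm (\<psi> y - 1) \<le> real n * C ^ n * \<delta>"
      using Suc[of y] unfolding \<psi>_def C_def \<delta>_def exp_of_nat_mult[symmetric] .
    then show "norm (D x y * (\<psi> y - 1)) \<le> C * (real n * C ^ n * \<delta>)"
      unfolding norm_mult using C1 by (intro mult_mono nD) auto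
  qed
  moreover have "norm (expect (K x) (D x) - 1) \<le> \<delta>"
  proof -
    have "expect (K x) (\<lambda>y. D x y - 1 - \<i> * complex_of_real (s * g x y))
      = expect (K x) (D x) - 1 - \<i> * (complex_of_real (s * expect (K x) (g x)))"
    proof -
      have "integrable (K x) (D x)" using nD by (intro integrable_pmf_bounded[where B=C])
      moreover have "integrable (K x) (g x)" using g by (intro integrable_pmf_bounded[where B=M]) auto
      ultimately show ?thesis by simp
    qed
    then have "expect (K x) (D x) - 1
      = expect (K x) (\<lambda>y. D x y - 1 - \<i> * complex_of_real (s * g x y))"
      by (simp add: zero)
    also have "norm \<dots> \<le> \<delta>"
    proof (rule norm_expectation_le)
      fix y
      have le: "\<bar>s * g x y\<bar> \<le> \<bar>s * M\<bar>"
        unfolding abs_mult using g[of x y] M by (intro mult_left_mono) auto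
      moreover have "\<bar>s * M\<bar> \<le> 1" using s M by (simp add: abs_mult)
      ultimately have "\<bar>s * g x y\<bar> \<le> 1" by linarith
      then have "norm (D x y - 1 - \<i> * complex_of_real (s * g x y)) \<le> 16 * \<bar>s * g x y\<bar> ^ 3"
        unfolding D_def by (rule norm_exp_corrected_le)
      also have "\<dots> \<le> \<delta>" unfolding \<delta>_def using le by (intro mult_left_mono power_mono) auto
      finally show "norm (D x y - 1 - \<i> * complex_of_real (s * g x y)) \<le> \<delta>" .
    qed
    finally show ?thesis .
  qed
  ultimately have "norm (expect (path_pmf K (Suc n) x) (E x) - 1) \<le> C * (real n * C ^ n * \<delta>) + \<delta>"
    using norm_triangle_mono by metis
  also have "\<dots> \<le> real n * C ^ Suc n * \<delta> + C ^ Suc n * \<delta>"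
    using \<delta>0 C1 mult_right_mono[of 1 "C ^ Suc n" \<delta>] one_le_power[of C "Suc n"] by (simp add: algebra_simps)
  also have "\<dots> = real (Suc n) * C ^ Suc n * \<delta>" by (simp add: algebra_simps)
  finally show ?case unfolding C_def \<delta>_def exp_of_nat_mult[symmetric] .
qed

context stationary_positive_kernel
begin

text \<open>Nonnegativity of the variance turns the mean-square statement into one on first absolute
  moments, the form taken both by the Markov inequality and by the comparison of characteristic
  functions.\<close>

lemma lln_abs:
  assumes g: "\<And>x y. \<bar>g x y\<bar> \<le> M"
    and c: "c = expect \<mu> (\<lambda>x. expect (K x) (g x))"
  shows "(\<lambda>n. expect (path_pmf K n x) (\<lambda>l. \<bar>path_sum g x l / real n - c\<bar>)) \<longlonglongrightarrow> 0"
proof (rule tendsto_sandwich[OF _ _ tendsto_const])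
  let ?E2 = "\<lambda>n. expect (path_pmf K n x) (\<lambda>l. (path_sum g x l / real n - c)\<^sup>2)"
  let ?E1 = "\<lambda>n. expect (path_pmf K n x) (\<lambda>l. \<bar>path_sum g x l / real n - c\<bar>)"
  show "(\<lambda>n. sqrt (?E2 n)) \<longlonglongrightarrow> 0"
    using tendsto_real_sqrt[OF lln[OF g c]] by simp
  show "\<forall>\<^sub>F n in sequentially. ?E1 n \<le> sqrt (?E2 n)"
  proof (intro always_eventually allI)
    fix n
    have b: "\<bar>path_sum g x l / real n - c\<bar> \<le> M + \<bar>c\<bar>" if "l \<in> set_pmf (path_pmf K n x)" for l
    proof -
      have "\<bar>path_sum g x l / real n\<bar> \<le> M"
      proof (cases "n = 0")
        case False then show ?thesis using path_sum_le[where g=g and M=M and l=l and K=K and n=n and x=x and y=x, OF g] that by (simp add: field_simps)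
      qed (use abs_bound_nonneg[OF g] in simp)
      then show ?thesis by linarith
    qed
    have i: "integrable (path_pmf K n x) (\<lambda>l. \<bar>path_sum g x l / real n - c\<bar>)"
      using b by (intro integrable_pmf_bounded[where B="M + \<bar>c\<bar>"]) auto
    have i2: "integrable (path_pmf K n x) (\<lambda>l. \<bar>path_sum g x l / real n - c\<bar>\<^sup>2)"
      using b by (intro integrable_pmf_bounded[where B="(M + \<bar>c\<bar>)\<^sup>2"]) (auto simp: abs_le_square_iff[symmetric] intro: order_trans abs_ge_self)
    have "0 \<le> measure_pmf.variance (path_pmf K n x) (\<lambda>l. \<bar>path_sum g x l / real n - c\<bar>)" by (rule measure_pmf.variance_positive)
    then have "(?E1 n)\<^sup>2 \<le> ?E2 n"
      using measure_pmf.variance_eq[OF i i2] by simp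
    then show "?E1 n \<le> sqrt (?E2 n)" by (rule real_le_rsqrt)
  qed
qed simp

text \<open>The conditional variances depend on the states, so the characteristic function has no
  exact product form. The compensated exponential \<open>E n\<close>, which is \<open>I n\<close>
  times \<open>exp (t\<^sup>2 * V / (2 * n))\<close>, has mean tending to 1; and since
  \<open>V / n\<close> tends to \<open>\<sigma>2\<close> in mean, the random compensator may be
  replaced by its limit.\<close>

lemma martingale_char_tendsto:
  assumes g: "\<And>x y. \<bar>g x y\<bar> \<le> M"
    and zero: "\<And>x. expect (K x) (g x) = 0"
    and \<sigma>2: "\<sigma>2 = expect \<mu> (\<lambda>x. expect (K x) (\<lambda>y. (g x y)\<^sup>2))"
  shows "(\<lambda>n. expect (path_pmf K n x) (\<lambda>l. iexp (t * (path_sum g x l / sqrt (real n)))))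
    \<longlonglongrightarrow> complex_of_real (exp (- (t\<^sup>2 * \<sigma>2 / 2)))"
proof -
  have M: "0 \<le> M" using g by (rule abs_bound_nonneg)
  have g2: "\<bar>(g x y)\<^sup>2\<bar> \<le> M\<^sup>2" for x y using g[of x y] M by (simp add: abs_le_square_iff[symmetric])
  define V where "V l = path_sum (\<lambda>x y. (g x y)\<^sup>2) x l" for l
  define S where "S l = path_sum g x l" for l
  define E where "E n l = exp (Complex ((t / sqrt (real n))\<^sup>2 / 2 * V l) (t / sqrt (real n) * S l))" for n l
  define I where "I n l = iexp (t * (S l / sqrt (real n)))" for n l
  define P where "P n = path_pmf K n x" for n
  define w where "w = exp (- (t\<^sup>2 * \<sigma>2 / 2))"
  define C where "C = exp (t\<^sup>2 * M\<^sup>2 / 2)"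
  have V_nonneg: "0 \<le> path_sum (\<lambda>x y. (g x y)\<^sup>2) z l" for z l
    by (induction l arbitrary: z) auto
  have V0: "0 \<le> V l" for l unfolding V_def by (rule V_nonneg)
  have VM: "V l \<le> real n * M\<^sup>2" if "l \<in> set_pmf (P n)" for n l
    using path_sum_le[where g="\<lambda>x y. (g x y)\<^sup>2" and M="M\<^sup>2" and l=l and K=K and n=n and x=x and y=x, OF g2] that unfolding V_def P_def by simp
  have \<sigma>20: "0 \<le> \<sigma>2" unfolding \<sigma>2 by simp
  have EV: "(\<lambda>n. expect (P n) (\<lambda>l. \<bar>V l / real n - \<sigma>2\<bar>)) \<longlonglongrightarrow> 0"
    unfolding V_def P_def by (rule lln_abs[OF g2 \<sigma>2])
  have EE: "(\<lambda>n. expect (P n) (E n)) \<longlonglongrightarrow> 1"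
  proof -
    \<comment> \<open>From such \<open>n\<close> on, \<open>s = t / sqrt n\<close> satisfies
      \<open>\<bar>s\<bar> * M \<le> 1\<close>, the range of the third-order estimate. The
      accumulated error is of order \<open>n * \<bar>s\<bar> ^ 3\<close>, that is
      \<open>1 / sqrt n\<close>.\<close>
    have "\<forall>\<^sub>F n in sequentially. (\<bar>t\<bar> * M)\<^sup>2 \<le> real n"
      by (rule eventually_compose_filterlim[OF eventually_ge_at_top filterlim_real_sequentially])
    then have ev: "\<forall>\<^sub>F n in sequentially. norm (expect (P n) (E n) - 1)
        \<le> C * (16 * \<bar>t * M\<bar> ^ 3) / sqrt (real n)"
      using eventually_gt_at_top[of 0]
    proof eventually_elim
      case (elim n)
      define s where "s = t / sqrt (real n)"
      have "\<bar>s\<bar> * M = \<bar>t\<bar> * M / sqrt (real n)" unfolding s_def by simp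
      also have "\<dots> \<le> 1" using elim M by (auto simp: real_le_rsqrt)
      finally have "norm (expect (P n) (E n) - 1)
        \<le> real n * exp (real n * (s\<^sup>2 * M\<^sup>2 / 2)) * (16 * \<bar>s * M\<bar> ^ 3)"
        unfolding E_def P_def V_def S_def s_def[symmetric] by (rule path_sum_exp_expectation[OF g zero])
      also have "real n * (s\<^sup>2 * M\<^sup>2 / 2) = t\<^sup>2 * M\<^sup>2 / 2"
        unfolding s_def using elim by (simp add: power_divide)
      also have "\<bar>s * M\<bar> ^ 3 = \<bar>t * M\<bar> ^ 3 / (real n * sqrt (real n))"
        unfolding s_def using elim by (simp add: abs_mult power_mult_distrib power_divide power3_eq_cube)
      finally show ?case using elim by (simp add: C_def field_simps)
    qed
    have "(\<lambda>n. C * (16 * \<bar>t * M\<bar> ^ 3) / sqrt (real n)) \<longlonglongrightarrow> 0"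
      by (rule real_tendsto_divide_at_top[OF tendsto_const filterlim_compose[OF sqrt_at_top filterlim_real_sequentially]])
    then have "(\<lambda>n. expect (P n) (E n) - 1) \<longlonglongrightarrow> 0"
      using ev by (rule Lim_null_comparison[rotated])
    then show ?thesis by (simp add: LIM_zero_iff)
  qed
  \<comment> \<open>Two pathwise facts enter: \<open>E n l\<close> is at most \<open>C\<close> in
    modulus because \<open>V l\<close> is at most \<open>n * M\<^sup>2\<close>, and
    \<open>exp (- u)\<close> is 1-Lipschitz for nonnegative \<open>u\<close>.\<close>
  have IE: "norm (I n l - w * E n l) \<le> C * (t\<^sup>2 / 2) * \<bar>V l / real n - \<sigma>2\<bar>"
    if n: "0 < n" and l: "l \<in> set_pmf (P n)" for n l
  proof -
    define u where "u = t\<^sup>2 / 2 * (V l / real n)"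
    define v where "v = t\<^sup>2 / 2 * \<sigma>2"
    have uv: "0 \<le> u" "0 \<le> v" unfolding u_def v_def using V0 \<sigma>20 by simp_all
    have "E n l = exp (complex_of_real u + \<i> * (t * (S l / sqrt (real n))))"
      unfolding E_def u_def using n by (intro arg_cong[where f=exp]) (simp add: complex_eq_iff power_divide)
    then have E: "E n l = exp u * I n l" unfolding I_def by (simp add: exp_add exp_of_real)
    have "norm (E n l) = exp u" unfolding E by (simp add: norm_mult I_def)
    also have "\<dots> \<le> C"
    proof -
      have "V l / real n \<le> M\<^sup>2" using VM[OF l] n by (simp add: field_simps)
      from mult_left_mono[OF this, of "t\<^sup>2 / 2"] show ?thesis unfolding C_def u_def by simp
    qed
    finally have nE: "norm (E n l) \<le> C" .
    have "I n l = exp (- u) * E n l" unfolding E by (simp add: exp_minus)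
    then have "I n l - w * E n l = complex_of_real (exp (- u) - exp (- v)) * E n l"
      by (simp add: w_def v_def algebra_simps)
    then have "norm (I n l - w * E n l) = \<bar>exp (- u) - exp (- v)\<bar> * norm (E n l)"
      by (simp add: norm_mult del: of_real_diff)
    also have "\<dots> \<le> \<bar>u - v\<bar> * C"
    proof (intro mult_mono nE)
      have *: "exp (- a) - exp (- b) \<le> b - a" if "0 \<le> a" "a \<le> b" for a b :: real
      proof -
        have "exp (- a) - exp (- b) = exp (- a) * (1 - exp (- (b - a)))" by (simp add: algebra_simps exp_add[symmetric])
        also have "\<dots> \<le> 1 * (b - a)"
        proof (rule mult_mono)
          show "1 - exp (- (b - a)) \<le> b - a" using exp_ge_add_one_self[of "- (b - a)"] by linarith
        qed (use that in auto)
        finally show ?thesis by simp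
      qed
      show "\<bar>exp (- u) - exp (- v)\<bar> \<le> \<bar>u - v\<bar>"
        using *[of u v] *[of v u] uv by (cases "u \<le> v") auto
    qed auto
    also have "\<dots> = C * (t\<^sup>2 / 2) * \<bar>V l / real n - \<sigma>2\<bar>"
    proof -
      have "u - v = t\<^sup>2 / 2 * (V l / real n - \<sigma>2)" unfolding u_def v_def by (rule right_diff_distrib[symmetric])
      then have "\<bar>u - v\<bar> = t\<^sup>2 / 2 * \<bar>V l / real n - \<sigma>2\<bar>" by (simp only: abs_mult) simp
      then show ?thesis by simp
    qed
    finally show ?thesis .
  qed
  have "(\<lambda>n. expect (P n) (I n) - w * expect (P n) (E n)) \<longlonglongrightarrow> 0"
  proof (rule Lim_null_comparison)
    show "(\<lambda>n. C * (t\<^sup>2 / 2) * expect (P n) (\<lambda>l. \<bar>V l / real n - \<sigma>2\<bar>)) \<longlonglongrightarrow> 0"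
      using tendsto_mult[OF tendsto_const EV, of "C * (t\<^sup>2 / 2)"] by simp
    show "\<forall>\<^sub>F n in sequentially. norm (expect (P n) (I n) - w * expect (P n) (E n))
        \<le> C * (t\<^sup>2 / 2) * expect (P n) (\<lambda>l. \<bar>V l / real n - \<sigma>2\<bar>)"
      using eventually_gt_at_top[of 0]
    proof eventually_elim
      case (elim n)
      have iI: "integrable (P n) (I n)" by (intro integrable_pmf_bounded[where B=1]) (simp add: I_def)
      have iE: "integrable (P n) (E n)"
      proof (intro integrable_pmf_bounded[where B=C])
        fix l assume "l \<in> set_pmf (P n)"
        then show "norm (E n l) \<le> C"
          using mult_left_mono[of "V l / real n" "M\<^sup>2" "t\<^sup>2 / 2"] VM[of l n] elim
          unfolding E_def C_def norm_exp_eq_Re by (simp add: field_simps power_divide)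
      qed
      have iV: "integrable (P n) (\<lambda>l. \<bar>V l / real n - \<sigma>2\<bar>)"
      proof (intro integrable_pmf_bounded[where B="M\<^sup>2 + \<sigma>2"])
        fix l assume "l \<in> set_pmf (P n)"
        then have "V l / real n \<le> M\<^sup>2" "0 \<le> V l / real n" using VM[of l n] V0[of l] elim by (auto simp: field_simps)
        then show "norm \<bar>V l / real n - \<sigma>2\<bar> \<le> M\<^sup>2 + \<sigma>2" using \<sigma>20 by (auto simp: abs_le_iff)
      qed
      have "expect (P n) (I n) - w * expect (P n) (E n)
        = expect (P n) (\<lambda>l. I n l - w * E n l)" using iI iE by simp
      also have "norm \<dots> \<le> expect (P n) (\<lambda>l. norm (I n l - w * E n l))" by (rule integral_norm_bound)
      also have "\<dots> \<le> expect (P n) (\<lambda>l. C * (t\<^sup>2 / 2) * \<bar>V l / real n - \<sigma>2\<bar>)"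
        using iI iE iV IE[OF elim] by (intro integral_mono_AE) (auto simp: AE_measure_pmf_iff)
      finally show ?case by simp
    qed
  qed
  from tendsto_add[OF this tendsto_mult[OF tendsto_const EE, of "complex_of_real w"]]
  have "(\<lambda>n. expect (P n) (I n)) \<longlonglongrightarrow> complex_of_real w" by simp
  then show ?thesis by (simp only: P_def I_def[abs_def] S_def w_def)
qed

end

section \<open>Maximizing the log-likelihood ratio\<close>

text \<open>With the Taylor coefficient 1/2 the bound would fail for positive \<open>y\<close>; the
  coefficient 1/4 leaves room for the cubic term. The difference of the two sides has derivative
  \<open>z * (1 - z) / (2 * (1 + z))\<close>, which has the sign of \<open>z\<close>, so its minimum
  is at 0.\<close>

lemma ln_one_plus_le_quadratic:
  fixes y :: real
  assumes "\<bar>y\<bar> \<le> 1 / 2"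
  shows "ln (1 + y) \<le> y - y\<^sup>2 / 4"
proof -
  define f where "f y = y - y\<^sup>2 / 4 - ln (1 + y)" for y :: real
  have d: "(f has_real_derivative (z * (1 - z) / (2 * (1 + z)))) (at z)" if "\<bar>z\<bar> \<le> 1 / 2" for z
    unfolding f_def using that
    by (auto intro!: derivative_eq_intros simp: field_simps power2_eq_square)
  have "f 0 \<le> f y"
  proof (cases "0 \<le> y")
    case True
    then show ?thesis
    proof (rule DERIV_nonneg_imp_nondecreasing)
      fix z assume "0 \<le> z" "z \<le> y"
      then show "\<exists>D. (f has_real_derivative D) (at z) \<and> 0 \<le> D"
        using assms by (intro exI[of _ "z * (1 - z) / (2 * (1 + z))"] conjI d) auto
    qed
  next
    case False
    then have "y \<le> 0" by simp
    then show ?thesis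
    proof (rule DERIV_nonpos_imp_nonincreasing)
      fix z assume "y \<le> z" "z \<le> 0"
      then show "\<exists>D. (f has_real_derivative D) (at z) \<and> D \<le> 0"
        using assms by (intro exI[of _ "z * (1 - z) / (2 * (1 + z))"] conjI d divide_nonpos_pos mult_nonpos_nonneg) auto
    qed
  qed
  then show ?thesis by (simp add: f_def)
qed

text \<open>The point at distance \<open>\<epsilon>\<close> from 0 in the direction of
  \<open>h\<close> is a convex combination of 0 and \<open>h\<close>, and \<open>ln 1 = 0\<close>.
  Concavity thus bounds the value at a remote \<open>h\<close> by a positive multiple of the value
  at that point.\<close>

lemma ln_one_plus_concave:
  fixes h x \<epsilon> :: real
  assumes "0 < \<epsilon>" "\<epsilon> \<le> \<bar>h\<bar>" "0 < 1 + h * x"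
  shows "ln (1 + h * x) \<le> \<bar>h\<bar> / \<epsilon> * ln (1 + sgn h * \<epsilon> * x)"
proof -
  define \<kappa> where "\<kappa> = \<epsilon> / \<bar>h\<bar>"
  have h: "h \<noteq> 0" using assms by auto
  have \<kappa>: "0 < \<kappa>" "\<kappa> \<le> 1" unfolding \<kappa>_def using assms h by auto
  have "concave_on {0<..} (ln :: real \<Rightarrow> real)" by (rule ln_concave)
  then have "(1 - \<kappa>) * ln 1 + \<kappa> * ln (1 + h * x) \<le> ln ((1 - \<kappa>) *\<^sub>R 1 + \<kappa> *\<^sub>R (1 + h * x))"
    using \<kappa> assms(3) by (intro concave_onD) auto
  also have "(1 - \<kappa>) *\<^sub>R 1 + \<kappa> *\<^sub>R (1 + h * x) = 1 + (\<kappa> * h) * x" by (simp add: algebra_simps)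
  also have "\<kappa> * h = sgn h * \<epsilon>" unfolding \<kappa>_def using h by (simp add: sgn_if)
  finally have "\<kappa> * ln (1 + h * x) \<le> ln (1 + sgn h * \<epsilon> * x)" by simp
  then have "ln (1 + h * x) \<le> ln (1 + sgn h * \<epsilon> * x) / \<kappa>" using \<kappa>(1) by (simp add: field_simps)
  then show ?thesis unfolding \<kappa>_def by (simp add: mult.commute)
qed

text \<open>At distance exactly \<open>\<epsilon>\<close> from 0 the quadratic bound applies and
  makes the sum at most \<open>\<epsilon>\<close> times the absolute score minus
  \<open>\<epsilon>\<^sup>2 / 4\<close> times the sum of squares; the hypothesis on the score makes
  this negative. Concavity carries the negative sign to every \<open>h\<close> further out on the
  same side.\<close>

lemma loglik_argmax_localized:
  fixes x :: "'i \<Rightarrow> real" and N :: "'i set"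
  assumes "finite N" "N \<noteq> {}"
    and M: "\<And>k. k \<in> N \<Longrightarrow> \<bar>x k\<bar> \<le> M" and \<epsilon>: "0 < \<epsilon>" "\<epsilon> * M \<le> 1 / 2"
    and pos: "\<And>k. k \<in> N \<Longrightarrow> 0 < 1 + h * x k"
    and max: "0 \<le> (\<Sum>k\<in>N. ln (1 + h * x k))"
    and score: "\<bar>\<Sum>k\<in>N. x k\<bar> < \<epsilon> / 4 * (\<Sum>k\<in>N. (x k)\<^sup>2)"
  shows "\<bar>h\<bar> < \<epsilon>"
proof (rule ccontr)
  assume "\<not> \<bar>h\<bar> < \<epsilon>"
  then have h: "\<epsilon> \<le> \<bar>h\<bar>" by simp
  then have h0: "0 < \<bar>h\<bar> / \<epsilon>" using \<epsilon> by simp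
  define e where "e = sgn h * \<epsilon>"
  have e: "\<bar>e\<bar> = \<epsilon>" "e\<^sup>2 = \<epsilon>\<^sup>2" using h \<epsilon> unfolding e_def by (auto simp: sgn_if)
  have "(\<Sum>k\<in>N. ln (1 + h * x k)) \<le> (\<Sum>k\<in>N. \<bar>h\<bar> / \<epsilon> * ln (1 + e * x k))"
    unfolding e_def using ln_one_plus_concave[OF \<epsilon>(1) h] pos by (intro sum_mono) auto
  also have "\<dots> = \<bar>h\<bar> / \<epsilon> * (\<Sum>k\<in>N. ln (1 + e * x k))" by (simp add: sum_distrib_left)
  also have "\<dots> \<le> \<bar>h\<bar> / \<epsilon> * (\<Sum>k\<in>N. e * x k - (e * x k)\<^sup>2 / 4)"
  proof (intro mult_left_mono sum_mono ln_one_plus_le_quadratic)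
    fix k assume "k \<in> N"
    then have "\<bar>e * x k\<bar> \<le> \<epsilon> * M" unfolding abs_mult e using M \<epsilon> by (intro mult_mono) auto
    then show "\<bar>e * x k\<bar> \<le> 1 / 2" using \<epsilon> by simp
  qed (use h0 in simp)
  also have "(\<Sum>k\<in>N. e * x k - (e * x k)\<^sup>2 / 4) = e * (\<Sum>k\<in>N. x k) - \<epsilon>\<^sup>2 / 4 * (\<Sum>k\<in>N. (x k)\<^sup>2)"
    by (simp add: sum_subtractf sum_distrib_left power_mult_distrib e sum_divide_distrib)
  also have "\<dots> < 0"
  proof -
    have "e * (\<Sum>k\<in>N. x k) \<le> \<epsilon> * \<bar>\<Sum>k\<in>N. x k\<bar>" using e(1) by (metis abs_ge_self abs_mult)
    also have "\<dots> < \<epsilon> * (\<epsilon> / 4 * (\<Sum>k\<in>N. (x k)\<^sup>2))" using score \<epsilon> by (intro mult_strict_left_mono)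
    finally show ?thesis by (simp add: power2_eq_square)
  qed
  then have "\<bar>h\<bar> / \<epsilon> * (e * (\<Sum>k\<in>N. x k) - \<epsilon>\<^sup>2 / 4 * (\<Sum>k\<in>N. (x k)\<^sup>2)) < 0"
    using h0 by (intro mult_pos_neg)
  finally show False using max by simp
qed

lemma score_root_expansion:
  fixes x :: "'i \<Rightarrow> real" and N :: "'i set"
  assumes "finite N"
    and M: "\<And>k. k \<in> N \<Longrightarrow> \<bar>x k\<bar> \<le> M" and h: "\<bar>h\<bar> * M \<le> 1 / 2"
    and root: "(\<Sum>k\<in>N. x k / (1 + h * x k)) = 0"
  shows "\<bar>h * (\<Sum>k\<in>N. (x k)\<^sup>2) - (\<Sum>k\<in>N. x k)\<bar> \<le> 2 * real (card N) * M ^ 3 * h\<^sup>2"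
proof -
  have p: "1 / 2 \<le> 1 + h * x k" if "k \<in> N" for k
  proof -
    have "\<bar>h * x k\<bar> \<le> \<bar>h\<bar> * M" unfolding abs_mult using M[OF that] by (intro mult_left_mono) auto
    then show ?thesis using h by linarith
  qed
  \<comment> \<open>Adding the vanishing score turns each summand into an exact cubic remainder. The
    denominators are at least 1/2, whence the factor 2 in the bound.\<close>
  have "h * (\<Sum>k\<in>N. (x k)\<^sup>2) - (\<Sum>k\<in>N. x k) = (\<Sum>k\<in>N. h * (x k)\<^sup>2 - x k + x k / (1 + h * x k))"
    using root by (simp add: sum.distrib sum_subtractf sum_distrib_left)
  also have "\<dots> = (\<Sum>k\<in>N. h\<^sup>2 * (x k) ^ 3 / (1 + h * x k))"
  proof (rule sum.cong)
    fix k assume "k \<in> N"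
    then have "1 + h * x k \<noteq> 0" using p by fastforce
    then show "h * (x k)\<^sup>2 - x k + x k / (1 + h * x k) = h\<^sup>2 * (x k) ^ 3 / (1 + h * x k)"
      by (simp add: field_simps power2_eq_square power3_eq_cube)
  qed simp
  also have "\<bar>\<dots>\<bar> \<le> (\<Sum>k\<in>N. \<bar>h\<^sup>2 * (x k) ^ 3 / (1 + h * x k)\<bar>)" by (rule sum_abs)
  also have "\<dots> \<le> (\<Sum>k\<in>N. 2 * M ^ 3 * h\<^sup>2)"
  proof (rule sum_mono)
    fix k assume k: "k \<in> N"
    have "\<bar>h\<^sup>2 * (x k) ^ 3 / (1 + h * x k)\<bar> = h\<^sup>2 * \<bar>x k\<bar> ^ 3 / (1 + h * x k)"
      using p[OF k] by (simp add: abs_mult power_abs)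
    also have "\<dots> \<le> h\<^sup>2 * M ^ 3 / (1 / 2)"
    proof (intro frac_le mult_left_mono power_mono M k p)
      have "0 \<le> M" using M[OF k] by linarith
      then show "0 \<le> h\<^sup>2 * M ^ 3" by simp
    qed auto
    finally show "\<bar>h\<^sup>2 * (x k) ^ 3 / (1 + h * x k)\<bar> \<le> 2 * M ^ 3 * h\<^sup>2" by (simp add: ac_simps)
  qed
  also have "\<dots> = 2 * real (card N) * M ^ 3 * h\<^sup>2" by simp
  finally show ?thesis .
qed

text \<open>The error in \<open>h \<approx> S / (n * \<sigma>2)\<close> first appears with the
  factor \<open>\<bar>h\<bar> * \<epsilon>\<close>. The condition on \<open>\<epsilon>\<close> lets
  half of \<open>\<bar>h\<bar> * \<sigma>2\<close> absorb it, which gives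
  \<open>\<bar>h\<bar> \<le> 2 * \<bar>S\<bar> / (n * \<sigma>2)\<close>. Inserted back, this makes
  the error a multiple of \<open>\<epsilon>\<close> times the normalized score.\<close>

lemma argmax_linearization:
  fixes S V M \<sigma>2 h \<epsilon> n :: real
  assumes n: "0 < n" and \<sigma>2: "0 < \<sigma>2" and M: "0 \<le> M"
    and V: "\<bar>V / n - \<sigma>2\<bar> \<le> \<epsilon>" and h: "\<bar>h\<bar> \<le> \<epsilon>"
    and \<epsilon>: "\<epsilon> * (1 + 2 * M ^ 3) \<le> \<sigma>2 / 2"
    and root: "\<bar>h * V - S\<bar> \<le> 2 * n * M ^ 3 * h\<^sup>2"
  shows "\<bar>sqrt n * h - S / (sqrt n * \<sigma>2)\<bar> \<le> 2 * (1 + 2 * M ^ 3) / \<sigma>2\<^sup>2 * \<epsilon> * (\<bar>S\<bar> / sqrt n)"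
proof -
  define A where "A = 1 + 2 * M ^ 3"
  have e0: "0 \<le> \<epsilon>" using V by linarith
  have A0: "0 < A" unfolding A_def using M by (simp add: add_pos_nonneg)
  have "\<bar>h * V / n - S / n\<bar> = \<bar>h * V - S\<bar> / n" using n by (simp add: diff_divide_distrib[symmetric] abs_divide)
  also have "\<dots> \<le> 2 * M ^ 3 * h\<^sup>2" using root n by (simp add: field_simps)
  also have "\<dots> \<le> 2 * M ^ 3 * (\<bar>h\<bar> * \<epsilon>)"
  proof (intro mult_left_mono)
    have "\<bar>h\<bar> * \<bar>h\<bar> \<le> \<bar>h\<bar> * \<epsilon>" using h by (intro mult_left_mono) auto
    then show "h\<^sup>2 \<le> \<bar>h\<bar> * \<epsilon>" by (simp add: power2_eq_square)
  qed (use M in simp)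
  finally have 1: "\<bar>h * V / n - S / n\<bar> \<le> 2 * M ^ 3 * (\<bar>h\<bar> * \<epsilon>)" .
  have 2: "\<bar>h * V / n - h * \<sigma>2\<bar> \<le> \<bar>h\<bar> * \<epsilon>"
  proof -
    have "h * V / n - h * \<sigma>2 = h * (V / n - \<sigma>2)" by (simp add: algebra_simps)
    then show ?thesis using V by (simp add: abs_mult mult_left_mono)
  qed
  have 3: "\<bar>h * \<sigma>2 - S / n\<bar> \<le> A * (\<bar>h\<bar> * \<epsilon>)"
    using 1 2 unfolding A_def by (simp add: algebra_simps)
  have "\<bar>h\<bar> * \<sigma>2 \<le> \<bar>S\<bar> / n + A * (\<bar>h\<bar> * \<epsilon>)"
  proof -
    have "\<bar>h * \<sigma>2\<bar> \<le> \<bar>S / n\<bar> + \<bar>h * \<sigma>2 - S / n\<bar>" by linarith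
    then show ?thesis using 3 n \<sigma>2 by (simp add: abs_mult)
  qed
  also have "A * (\<bar>h\<bar> * \<epsilon>) \<le> \<bar>h\<bar> * (\<sigma>2 / 2)"
    using mult_left_mono[OF \<epsilon>, of "\<bar>h\<bar>"] unfolding A_def by (simp add: ac_simps)
  finally have "\<bar>h\<bar> * \<sigma>2 \<le> 2 * (\<bar>S\<bar> / n)" by simp
  then have 4: "\<bar>h\<bar> \<le> 2 * (\<bar>S\<bar> / n) / \<sigma>2" using \<sigma>2 by (simp only: pos_le_divide_eq)
  have "sqrt n * h - S / (sqrt n * \<sigma>2) = sqrt n / \<sigma>2 * (h * \<sigma>2 - S / n)"
    using n \<sigma>2 by (simp add: field_simps)
  also have "\<bar>\<dots>\<bar> = sqrt n / \<sigma>2 * \<bar>h * \<sigma>2 - S / n\<bar>" using n \<sigma>2 by (simp add: abs_mult)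
  also have "\<dots> \<le> sqrt n / \<sigma>2 * (A * ((2 * (\<bar>S\<bar> / n) / \<sigma>2) * \<epsilon>))"
    using n \<sigma>2 A0 e0 by (intro mult_left_mono order_trans[OF 3] mult_right_mono 4) auto
  also have "\<dots> = 2 * A / \<sigma>2\<^sup>2 * \<epsilon> * (\<bar>S\<bar> / sqrt n)"
    using n \<sigma>2 by (simp add: field_simps power2_eq_square)
  finally show ?thesis unfolding A_def .
qed

section \<open>The environment and the invariant law\<close>

lemma measurable_two_point_iff: "measurable (two_point a1 a2 p) N = measurable unit_borel N"
  by (intro measurable_cong_sets sets_two_point refl)

locale two_point_env =
  fixes a1 a2 p :: real
  assumes a: "0 < a1" "a1 < a2" "a2 < 1" and p: "0 < p" "p < 1"
begin

abbreviation "Nu \<equiv> two_point a1 a2 p"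
abbreviation "Env \<equiv> env_law Nu"

lemma prob_space_nu: "prob_space Nu"
  using a p by (intro prob_space_two_point) auto

lemma prob_space_Env: "prob_space Env"
  unfolding env_law_def by (intro prob_space_PiM prob_space_nu)

lemma space_Env: "\<omega> \<in> space Env \<Longrightarrow> 0 < \<omega> j \<and> \<omega> j < 1"
  by (auto simp: env_law_def space_PiM space_two_point PiE_iff)

lemma measurable_coord [measurable]: "(\<lambda>\<omega>. \<omega> j) \<in> borel_measurable Env"
proof -
  have "(\<lambda>\<omega>. \<omega> j) \<in> measurable Env Nu"
    unfolding env_law_def by measurable
  moreover have "(\<lambda>a. a) \<in> measurable Nu borel"
    unfolding measurable_two_point_iff unit_borel_def by (rule measurable_restrict_space1) simp
  ultimately show ?thesis by (rule measurable_compose)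
qed

lemma measurable_rho [measurable]: "(\<lambda>\<omega>. rho \<omega> j) \<in> borel_measurable Env"
  unfolding rho_def by measurable

lemma measurable_S_env [measurable]: "S_env \<in> borel_measurable Env"
  unfolding S_env_def[abs_def] by measurable

lemma measurable_shift: "(\<lambda>\<omega> j. \<omega> (j + k)) \<in> measurable Env Env"
  unfolding env_law_def by (rule measurable_PiM_single') (auto simp: space_PiM PiE_iff)

lemma nn_integral_Env_shift:
  fixes k :: int
  assumes [measurable]: "F \<in> borel_measurable Env"
  shows "(\<integral>\<^sup>+\<omega>. F (\<lambda>j. \<omega> (j + k)) \<partial>Env) = (\<integral>\<^sup>+\<omega>. F \<omega> \<partial>Env)"
proof -
  have "distr Env Env (\<lambda>\<omega> j. \<omega> (j + k)) = Env"
    unfolding env_law_def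
    using distr_PiM_reindex[of UNIV "\<lambda>_. Nu" "\<lambda>j. j + k" "UNIV :: int set"] prob_space_nu
    by (simp add: inj_on_def restrict_def)
  then have "(\<integral>\<^sup>+\<omega>. F \<omega> \<partial>Env) = (\<integral>\<^sup>+\<omega>. F \<omega> \<partial>distr Env Env (\<lambda>\<omega> j. \<omega> (j + k)))" by simp
  also have "\<dots> = (\<integral>\<^sup>+\<omega>. F (\<lambda>j. \<omega> (j + k)) \<partial>Env)"
    using assms by (intro nn_integral_distr measurable_shift) auto
  finally show ?thesis ..
qed

text \<open>\<open>Env\<close> is unchanged when the coordinate \<open>j\<close> is overwritten by
  an independent draw from \<open>Nu\<close>; the outer integral over that draw has only two
  terms.\<close>

lemma nn_integral_Env_split:
  assumes F: "F \<in> borel_measurable Env"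
  shows "(\<integral>\<^sup>+\<omega>. F \<omega> \<partial>Env)
    = ennreal p * (\<integral>\<^sup>+\<omega>. F (fun_upd \<omega> j a1) \<partial>Env) + ennreal (1 - p) * (\<integral>\<^sup>+\<omega>. F (fun_upd \<omega> j a2) \<partial>Env)"
proof -
  let ?\<nu> = "Nu"
  let ?u = "\<lambda>(x, \<omega>). fun_upd \<omega> j x"
  interpret E: prob_space Env by (rule prob_space_Env)
  have [measurable]: "?u \<in> measurable (?\<nu> \<Otimes>\<^sub>M Env) Env"
    unfolding env_law_def split_beta' by (rule measurable_fun_upd[where J=UNIV]) auto
  have d: "distr (?\<nu> \<Otimes>\<^sub>M Env) Env ?u = Env"
    unfolding env_law_def
    using distr_pair_PiM_eq_PiM[of UNIV "\<lambda>_. ?\<nu>" j] prob_space_nu by simp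
  have [measurable]: "F \<in> borel_measurable Env" by (rule F)
  have Fu: "(\<lambda>z. F (?u z)) \<in> borel_measurable (?\<nu> \<Otimes>\<^sub>M Env)" by measurable
  have "(\<integral>\<^sup>+\<omega>. F \<omega> \<partial>Env) = (\<integral>\<^sup>+\<omega>. F \<omega> \<partial>distr (?\<nu> \<Otimes>\<^sub>M Env) Env ?u)" by (simp add: d)
  also have "\<dots> = (\<integral>\<^sup>+z. F (?u z) \<partial>(?\<nu> \<Otimes>\<^sub>M Env))" by (rule nn_integral_distr) measurable
  also have "\<dots> = (\<integral>\<^sup>+x. \<integral>\<^sup>+\<omega>. F (fun_upd \<omega> j x) \<partial>Env \<partial>?\<nu>)"
    using E.nn_integral_fst[OF Fu] by simp
  also have "\<dots> = ennreal p * (\<integral>\<^sup>+\<omega>. F (fun_upd \<omega> j a1) \<partial>Env) + ennreal (1 - p) * (\<integral>\<^sup>+\<omega>. F (fun_upd \<omega> j a2) \<partial>Env)"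
  proof (rule nn_integral_two_point)
    show "(\<lambda>x. \<integral>\<^sup>+\<omega>. F (fun_upd \<omega> j x) \<partial>Env) \<in> borel_measurable unit_borel"
      using E.borel_measurable_nn_integral_fst[OF Fu] by (simp add: measurable_two_point_iff)
  qed (use a in auto)
  finally show ?thesis .
qed

lemma nn_integral_Env_prod:
  assumes "finite J" and f: "\<And>j. f j \<in> borel_measurable borel"
  shows "(\<integral>\<^sup>+\<omega>. (\<Prod>j\<in>J. f j (\<omega> j)) \<partial>Env) = (\<Prod>j\<in>J. ennreal p * f j a1 + ennreal (1 - p) * f j a2)"
  using assms(1)
proof (induction J)
  case empty
  show ?case using prob_space.emeasure_space_1[OF prob_space_Env] by simp
next
  case (insert i J)
  note f[measurable]
  have upd: "(\<Prod>j\<in>J. f j ((fun_upd \<omega> i x) j)) = (\<Prod>j\<in>J. f j (\<omega> j))" for \<omega> x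
    using insert by (intro prod.cong) auto
  have "(\<integral>\<^sup>+\<omega>. (\<Prod>j\<in>insert i J. f j (\<omega> j)) \<partial>Env)
    = ennreal p * (\<integral>\<^sup>+\<omega>. f i a1 * (\<Prod>j\<in>J. f j (\<omega> j)) \<partial>Env)
      + ennreal (1 - p) * (\<integral>\<^sup>+\<omega>. f i a2 * (\<Prod>j\<in>J. f j (\<omega> j)) \<partial>Env)"
    by (subst nn_integral_Env_split[where j=i], measurable) (simp only: prod.insert[OF insert(1,2)] fun_upd_same upd)
  also have "\<dots> = (ennreal p * f i a1 + ennreal (1 - p) * f i a2) * (\<integral>\<^sup>+\<omega>. (\<Prod>j\<in>J. f j (\<omega> j)) \<partial>Env)"
    by (subst (1 2) nn_integral_cmult) (measurable, simp add: distrib_right mult.assoc)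
  finally show ?case using insert by simp
qed

lemma Qker_eq:
  "Qker Nu u v
    = real ((u + v) choose v) * (p * (a1 ^ (u + 1) * (1 - a1) ^ v) + (1 - p) * (a2 ^ (u + 1) * (1 - a2) ^ v))"
  unfolding Qker_def using a p by (subst phi_two_point) (auto simp: add_pos_pos)

text \<open>The number of failures before success number \<open>u + 1\<close>, in trials whose
  success probability is itself drawn from the two atoms. In the walk, these are the left steps from
  a site that is left to the right \<open>u + 1\<close> times.\<close>

definition Q_pmf :: "nat \<Rightarrow> nat pmf" where
  "Q_pmf u = bind_pmf (bernoulli_pmf p) (\<lambda>b. neg_binomial_pmf (Suc u) (if b then a1 else a2))"

lemma pmf_Q_pmf: "pmf (Q_pmf u) v = Qker Nu u v"
proof -
  have "pmf (Q_pmf u) v = p * pmf (neg_binomial_pmf (Suc u) a1) v + (1 - p) * pmf (neg_binomial_pmf (Suc u) a2) v"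
    unfolding Q_pmf_def pmf_bind using p by (simp add: integral_bernoulli_pmf)
  also have "\<dots> = Qker Nu u v"
    unfolding Qker_eq using a by (subst (1 2) pmf_neg_binomial) (auto simp: algebra_simps)
  finally show ?thesis .
qed

lemma Qker_pos: "0 < Qker Nu u v"
  unfolding Qker_def by (simp add: zero_less_binomial)

end

lemma suminf_ennreal_pmf: "(\<Sum>v. ennreal (pmf (q :: nat pmf) v)) = 1"
proof -
  have "(\<Sum>v. ennreal (pmf q v)) = (\<integral>\<^sup>+v. pmf q v \<partial>count_space UNIV)" by (simp add: nn_integral_count_space_nat)
  also have "\<dots> = 1" unfolding nn_integral_pmf using measure_pmf.emeasure_space_1[of q] by simp
  finally show ?thesis .
qed

text \<open>Normalization of the negative binomial law with \<open>v + 1\<close> successes of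
  probability \<open>1 - r\<close>, up to the symmetry of the binomial coefficient.\<close>

lemma suminf_neg_binomial:
  fixes r :: real
  assumes "0 \<le> r" "r < 1"
  shows "(\<Sum>u. ennreal (real ((u + v) choose v) * r ^ u)) = ennreal (1 / (1 - r) ^ Suc v)"
proof -
  have "(\<Sum>u. ennreal (pmf (neg_binomial_pmf (Suc v) (1 - r)) u)) = 1" by (rule suminf_ennreal_pmf)
  also have "(\<lambda>u. ennreal (pmf (neg_binomial_pmf (Suc v) (1 - r)) u))
    = (\<lambda>u. ennreal (real ((u + v) choose v) * r ^ u) * ennreal ((1 - r) ^ Suc v))"
  proof
    fix u
    have "(u + v) choose u = (u + v) choose v" using binomial_symmetric[of u "u + v"] by simp
    then show "ennreal (pmf (neg_binomial_pmf (Suc v) (1 - r)) u)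
      = ennreal (real ((u + v) choose v) * r ^ u) * ennreal ((1 - r) ^ Suc v)"
      using assms by (subst pmf_neg_binomial) (auto simp: ennreal_mult[symmetric] ac_simps)
  qed
  finally have "(\<Sum>u. ennreal (real ((u + v) choose v) * r ^ u)) * ennreal ((1 - r) ^ Suc v) = 1"
    by (simp add: ennreal_suminf_multc)
  then have "(\<Sum>u. ennreal (real ((u + v) choose v) * r ^ u)) = 1 / ennreal ((1 - r) ^ Suc v)"
    using assms by (metis divide_eq_1_ennreal ennreal_mult_divide_eq ennreal_neq_top ennreal_eq_0_iff not_le zero_less_power diff_gt_0_iff_gt)
  also have "\<dots> = ennreal (1 / (1 - r) ^ Suc v)"
    using assms by (metis diff_gt_0_iff_gt divide_ennreal ennreal_1 zero_le_one zero_less_power)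
  finally show ?thesis .
qed

locale transient_two_point_env = two_point_env +
  assumes transient: "p * ln ((1 - a1) / a1) + (1 - p) * ln ((1 - a2) / a2) < 0"
begin

text \<open>The mean of \<open>\<rho> powr s\<close> equals 1 at \<open>s = 0\<close> and has there
  the derivative \<open>E(ln \<rho>) < 0\<close>, so it drops below 1 at some small
  \<open>s\<close>. The bound \<open>s \<le> 1\<close> serves the later comparison of a number below
  1 with its power.\<close>

lemma fractional_moment:
  obtains s where "0 < s" "s \<le> 1"
    "p * ((1 - a1) / a1) powr s + (1 - p) * ((1 - a2) / a2) powr s < 1"
proof -
  let ?r = "\<lambda>a. (1 - a) / a :: real"
  let ?f = "\<lambda>s. p * ?r a1 powr s + (1 - p) * ?r a2 powr s"
  have r: "0 < ?r a1" "0 < ?r a2" using a by auto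
  have "(?f has_real_derivative (p * ln (?r a1) + (1 - p) * ln (?r a2))) (at 0)"
    using r by (auto intro!: derivative_eq_intros)
  from DERIV_neg_dec_right[OF this transient]
  obtain d where d: "0 < d" "\<And>h. 0 < h \<Longrightarrow> h < d \<Longrightarrow> ?f (0 + h) < ?f 0" by auto
  have "?f (0 + min (d / 2) 1) < ?f 0" using d by (intro d(2)) auto
  then have "?f (min (d / 2) 1) < 1" using a by simp
  with d(1) show ?thesis by (intro that[of "min (d / 2) 1"]) auto
qed

lemma rho_pos: "\<omega> \<in> space Env \<Longrightarrow> 0 < rho \<omega> j"
  using space_Env[of \<omega> j] by (simp add: rho_def)

text \<open>A fractional moment below \<open>1\<close> makes the sum of the powers converge in mean; products
  below \<open>1\<close> are dominated by their \<open>s\<close>-th powers.\<close>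

lemma AE_summable_rho_prod:
  fixes \<iota> :: "nat \<Rightarrow> int"
  assumes "inj \<iota>"
  shows "AE \<omega> in Env. summable (\<lambda>k. \<Prod>j=1..k. rho \<omega> (\<iota> j))"
proof -
  obtain s where s: "0 < s" "s \<le> 1"
    "p * ((1 - a1) / a1) powr s + (1 - p) * ((1 - a2) / a2) powr s < 1" by (rule fractional_moment)
  define r where "r = p * ((1 - a1) / a1) powr s + (1 - p) * ((1 - a2) / a2) powr s"
  have r: "0 \<le> r" "r < 1" using s p unfolding r_def by auto
  let ?P = "\<lambda>k \<omega>. \<Prod>j=1..k. rho \<omega> (\<iota> j)"
  have mean: "(\<integral>\<^sup>+\<omega>. ennreal (?P k \<omega> powr s) \<partial>Env) = ennreal (r ^ k)" for k
  proof -
    have "(\<integral>\<^sup>+\<omega>. ennreal (?P k \<omega> powr s) \<partial>Env)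
      = (\<integral>\<^sup>+\<omega>. (\<Prod>i\<in>\<iota> ` {1..k}. ennreal (((1 - \<omega> i) / \<omega> i) powr s)) \<partial>Env)"
    proof (intro nn_integral_cong)
      fix \<omega> assume "\<omega> \<in> space Env"
      then have pos: "0 < rho \<omega> j" for j by (rule rho_pos)
      have "?P k \<omega> powr s = (\<Prod>j=1..k. rho \<omega> (\<iota> j) powr s)"
        by (rule prod_powr_distrib)
      also have "\<dots> = (\<Prod>i\<in>\<iota> ` {1..k}. rho \<omega> i powr s)"
        using assms by (subst prod.reindex) (auto intro: inj_on_subset)
      finally show "ennreal (?P k \<omega> powr s) = (\<Prod>i\<in>\<iota> ` {1..k}. ennreal (((1 - \<omega> i) / \<omega> i) powr s))"
        by (simp add: prod_ennreal rho_def)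
    qed
    also have "\<dots> = (\<Prod>i\<in>\<iota> ` {1..k}. ennreal p * ennreal (((1 - a1) / a1) powr s) + ennreal (1 - p) * ennreal (((1 - a2) / a2) powr s))"
      by (rule nn_integral_Env_prod) simp_all
    also have "ennreal p * ennreal (((1 - a1) / a1) powr s) + ennreal (1 - p) * ennreal (((1 - a2) / a2) powr s) = ennreal r"
      unfolding r_def using p by (simp add: ennreal_mult[symmetric] ennreal_plus[symmetric] del: ennreal_plus)
    also have "(\<Prod>i\<in>\<iota> ` {1..k}. ennreal r) = ennreal (r ^ k)"
      using assms r by (simp add: card_image inj_on_subset ennreal_power)
    finally show ?thesis .
  qed
  have "(\<integral>\<^sup>+\<omega>. (\<Sum>k. ennreal (?P k \<omega> powr s)) \<partial>Env) = (\<Sum>k. ennreal (r ^ k))"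
    by (subst nn_integral_suminf) (simp_all add: mean[unfolded One_nat_def])
  also have "\<dots> < \<infinity>"
    using r by (subst suminf_ennreal2) (auto simp: summable_geometric)
  finally have "AE \<omega> in Env. (\<Sum>k. ennreal (?P k \<omega> powr s)) \<noteq> \<infinity>"
    by (intro nn_integral_noteq_infinite) auto
  then show ?thesis
    using AE_space
  proof eventually_elim
    case (elim \<omega>)
    have pos: "0 < ?P k \<omega>" for k using rho_pos[OF elim(2)] by (intro prod_pos) auto
    have sum: "summable (\<lambda>k. ?P k \<omega> powr s)"
      using elim by (intro summable_suminf_not_top) auto
    then have "(\<lambda>k. ?P k \<omega> powr s) \<longlonglongrightarrow> 0" by (rule summable_LIMSEQ_zero)
    then have "\<forall>\<^sub>F k in sequentially. ?P k \<omega> powr s < 1"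
      by (rule order_tendstoD) simp
    then have "\<forall>\<^sub>F k in sequentially. norm (?P k \<omega>) \<le> ?P k \<omega> powr s"
    proof eventually_elim
      case (elim k)
      have "?P k \<omega> < 1"
      proof (rule ccontr)
        assume "\<not> ?P k \<omega> < 1"
        then have "1 \<le> ?P k \<omega> powr s" using s by (intro ge_one_powr_ge_zero) auto
        with elim show False by simp
      qed
      then have "?P k \<omega> powr 1 \<le> ?P k \<omega> powr s"
        using pos[of k] s by (intro powr_mono') auto
      then show ?case using pos[of k] by simp
    qed
    then show ?case by (rule summable_comparison_test_ev[OF _ sum])
  qed
qed

definition rho_series :: "(int \<Rightarrow> real) \<Rightarrow> real" where
  "rho_series \<omega> = (\<Sum>k. \<Prod>j=1..k. rho \<omega> (int j))"

lemma AE_S_env: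
  "AE \<omega> in Env. summable (\<lambda>k. \<Prod>j=1..k. rho \<omega> (int j)) \<and> rho_series \<omega> * S_env \<omega> = 1 \<and> 0 < S_env \<omega> \<and> S_env \<omega> < 1"
  using AE_summable_rho_prod[of int, OF inj_of_nat] AE_space
proof eventually_elim
  case (elim \<omega>)
  let ?P = "\<lambda>k. \<Prod>j=1..k. rho \<omega> (int j)"
  have sum: "summable ?P" using elim by simp
  have pos: "0 < ?P k" for k using rho_pos[OF elim(2)] by (intro prod_pos) auto
  \<comment> \<open>The first two terms, 1 and a positive product, already push the series above 1;
    the strict bound \<open>S_env \<omega> < 1\<close> comes from here.\<close>
  have "(\<Sum>k<2. ?P k) < rho_series \<omega>"
    unfolding rho_series_def by (intro sum_less_suminf[OF sum] pos)
  moreover have "1 < (\<Sum>k<2. ?P k)" using pos[of 1] by (simp add: numeral_2_eq_2)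
  ultimately have R: "1 < rho_series \<omega>" by simp
  have "S_env \<omega> = enn2real (inverse (ennreal (rho_series \<omega>)))"
    unfolding S_env_def rho_series_def using pos less_imp_le
    by (subst suminf_ennreal2[OF _ sum]) blast+
  also have "\<dots> = 1 / rho_series \<omega>" using R by (simp add: inverse_ennreal inverse_eq_divide)
  finally have S: "S_env \<omega> = 1 / rho_series \<omega>" .
  show ?case unfolding S using R sum by simp
qed

text \<open>The strict bounds on \<open>S_env\<close> make the integrand positive almost surely, so
  the invariant law charges every state.\<close>

lemma pi_wt_nn: "ennreal (pi_wt Nu u) = (\<integral>\<^sup>+\<omega>. ennreal (S_env \<omega> * (1 - S_env \<omega>) ^ u) \<partial>Env)"
  and pi_wt_pos: "0 < pi_wt Nu u"
proof -
  interpret E: prob_space Env by (rule prob_space_Env)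
  let ?f = "\<lambda>\<omega>. S_env \<omega> * (1 - S_env \<omega>) ^ u"
  have f: "AE \<omega> in Env. 0 < ?f \<omega> \<and> ?f \<omega> \<le> 1"
    using AE_S_env
  proof eventually_elim
    case (elim \<omega>)
    then have "S_env \<omega> * (1 - S_env \<omega>) ^ u \<le> 1 * 1" by (intro mult_mono power_le_one) auto
    with elim show ?case by simp
  qed
  have i: "integrable Env ?f"
    using f by (intro E.integrable_const_bound[where B=1]) auto
  show "ennreal (pi_wt Nu u) = (\<integral>\<^sup>+\<omega>. ennreal (?f \<omega>) \<partial>Env)"
    unfolding pi_wt_def using f by (intro nn_integral_eq_integral[symmetric] i) auto
  have "0 \<le> pi_wt Nu u"
    unfolding pi_wt_def using f by (intro integral_nonneg_AE) auto
  moreover have "pi_wt Nu u \<noteq> 0"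
  proof
    assume "pi_wt Nu u = 0"
    moreover have "AE \<omega> in Env. 0 \<le> ?f \<omega>" using f by eventually_elim simp
    ultimately have "AE \<omega> in Env. ?f \<omega> = 0"
      unfolding pi_wt_def using integral_nonneg_eq_0_iff_AE[OF i] by blast
    with f have "AE \<omega> in Env. False" by eventually_elim simp
    then show False by (simp add: E.AE_False)
  qed
  ultimately show "0 < pi_wt Nu u" by simp
qed

lemma suminf_pi_wt: "(\<Sum>u. ennreal (pi_wt Nu u)) = 1"
proof -
  interpret E: prob_space Env by (rule prob_space_Env)
  have "(\<Sum>u. ennreal (pi_wt Nu u)) = (\<integral>\<^sup>+\<omega>. (\<Sum>u. ennreal (S_env \<omega> * (1 - S_env \<omega>) ^ u)) \<partial>Env)"
    unfolding pi_wt_nn by (subst nn_integral_suminf) simp_all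
  also have "\<dots> = (\<integral>\<^sup>+\<omega>. 1 \<partial>Env)"
  proof (rule nn_integral_cong_AE, use AE_S_env in eventually_elim)
    case (elim \<omega>)
    have "(\<lambda>u. (1 - S_env \<omega>) ^ u) sums (1 / (1 - (1 - S_env \<omega>)))"
      using elim by (intro geometric_sums) auto
    from sums_mult[OF this, of "S_env \<omega>"] have "(\<lambda>u. S_env \<omega> * (1 - S_env \<omega>) ^ u) sums 1"
      using elim by simp
    then show ?case using elim by (subst suminf_ennreal_eq) auto
  qed
  also have "\<dots> = 1" using E.emeasure_space_1 by simp
  finally show ?thesis .
qed

definition pi_pmf :: "nat pmf" where "pi_pmf = embed_pmf (pi_wt Nu)"

lemma pmf_pi_pmf: "pmf pi_pmf u = pi_wt Nu u"
  unfolding pi_pmf_def using pi_wt_pos less_imp_le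
  by (intro pmf_embed_pmf) (auto simp: nn_integral_count_space_nat suminf_pi_wt)

text \<open>The series \<open>R = 1/S\<close> satisfies \<open>R(\<tau>\<omega>) = 1 + \<rho>\<^sub>0 R(\<omega>)\<close> for the shift \<open>\<tau>\<close> by one, and
  summing the negative binomial series in \<open>u\<close> turns \<open>S\<close> into \<open>S' = S \<omega>\<^sub>0 / (1 - \<omega>\<^sub>0 (1 - S))\<close>, which is \<open>S\<close> of the shifted environment.\<close>

lemma pi_wt_stationary:
  "(\<Sum>u. ennreal (pi_wt Nu u) * ennreal (Qker Nu u v))
    = ennreal (pi_wt Nu v)"
proof -
  define T where "T x s = s * x / (1 - x * (1 - s))" for x s :: real
  define h where "h s = ennreal (s * (1 - s) ^ v)" for s :: real
  define C where "C u = real ((u + v) choose v)" for u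
  have [measurable]: "(\<lambda>\<omega>. h (T x (S_env \<omega>))) \<in> borel_measurable Env" for x
    unfolding h_def T_def by measurable
  have series: "(\<Sum>u. ennreal (pi_wt Nu u) * ennreal (C u * (x ^ (u + 1) * (1 - x) ^ v)))
    = (\<integral>\<^sup>+\<omega>. h (T x (S_env \<omega>)) \<partial>Env)" if x: "0 < x" "x < 1" for x
  proof -
    have "(\<Sum>u. ennreal (pi_wt Nu u) * ennreal (C u * (x ^ (u + 1) * (1 - x) ^ v)))
      = (\<integral>\<^sup>+\<omega>. (\<Sum>u. ennreal (S_env \<omega> * (1 - S_env \<omega>) ^ u) * ennreal (C u * (x ^ (u + 1) * (1 - x) ^ v))) \<partial>Env)"
      unfolding pi_wt_nn by (subst nn_integral_suminf) (simp_all add: nn_integral_multc)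
    also have "\<dots> = (\<integral>\<^sup>+\<omega>. h (T x (S_env \<omega>)) \<partial>Env)"
    proof (rule nn_integral_cong_AE, use AE_S_env in eventually_elim)
      case (elim \<omega>)
      let ?S = "S_env \<omega>"
      define r where "r = x * (1 - ?S)"
      have r: "0 \<le> r" "r < 1" using x elim mult_strict_mono[of x 1 "1 - ?S" 1] unfolding r_def by auto
      have "(\<Sum>u. ennreal (?S * (1 - ?S) ^ u) * ennreal (C u * (x ^ (u + 1) * (1 - x) ^ v)))
        = (\<Sum>u. ennreal (?S * x * (1 - x) ^ v) * ennreal (C u * r ^ u))"
        using x elim unfolding r_def C_def
        by (intro suminf_cong) (simp add: ennreal_mult[symmetric] power_mult_distrib ac_simps)
      also have "\<dots> = ennreal (?S * x * (1 - x) ^ v) * ennreal (1 / (1 - r) ^ Suc v)"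
        using suminf_neg_binomial[OF r, of v] by (simp add: C_def)
      also have "\<dots> = h (T x ?S)"
      proof -
        have "1 - T x ?S = (1 - x) / (1 - r)"
          unfolding T_def r_def[symmetric] using r by (simp add: field_simps r_def)
        then have "T x ?S * (1 - T x ?S) ^ v = ?S * x * (1 - x) ^ v * (1 / (1 - r) ^ Suc v)"
          by (simp add: T_def r_def[symmetric] power_divide)
        then show ?thesis using x elim r by (simp add: h_def ennreal_mult[symmetric])
      qed
      finally show ?case .
    qed
    finally show ?thesis .
  qed
  \<comment> \<open>\<open>S_env\<close> reads only the sites from 1 on, so the value at the site 0
    is independent of it.\<close>
  have upd: "S_env (fun_upd \<omega> 0 x) = S_env \<omega>" for \<omega> x
  proof -
    have "(\<Prod>j=1..k. rho (fun_upd \<omega> 0 x) (int j)) = (\<Prod>j=1..k. rho \<omega> (int j))" for k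
      by (intro prod.cong) (auto simp: rho_def)
    then show ?thesis unfolding S_env_def by simp
  qed
  have [measurable]: "(\<lambda>\<omega>. h (T (\<omega> 0) (S_env \<omega>))) \<in> borel_measurable Env" "(\<lambda>\<omega>. h (S_env \<omega>)) \<in> borel_measurable Env"
    unfolding h_def T_def by measurable
  have "(\<Sum>u. ennreal (pi_wt Nu u) * ennreal (Qker Nu u v))
    = (\<Sum>u. ennreal p * (ennreal (pi_wt Nu u) * ennreal (C u * (a1 ^ (u + 1) * (1 - a1) ^ v)))
        + ennreal (1 - p) * (ennreal (pi_wt Nu u) * ennreal (C u * (a2 ^ (u + 1) * (1 - a2) ^ v))))"
  proof (intro suminf_cong)
    fix u
    have "ennreal w * ennreal (c * (p * x + (1 - p) * y))
        = ennreal p * (ennreal w * ennreal (c * x)) + ennreal (1 - p) * (ennreal w * ennreal (c * y))"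
      if "0 \<le> w" "0 \<le> c" "0 \<le> x" "0 \<le> y" for w c x y :: real
    proof -
      have "ennreal p * (ennreal w * ennreal (c * x)) + ennreal (1 - p) * (ennreal w * ennreal (c * y))
        = ennreal (p * (w * (c * x)) + (1 - p) * (w * (c * y)))"
        using that p by (simp add: ennreal_mult[symmetric] ennreal_plus[symmetric] del: ennreal_plus)
      also have "p * (w * (c * x)) + (1 - p) * (w * (c * y)) = w * (c * (p * x + (1 - p) * y))"
        by (simp add: algebra_simps)
      finally show ?thesis using that p by (simp add: ennreal_mult[symmetric])
    qed
    then show "ennreal (pi_wt Nu u) * ennreal (Qker Nu u v)
      = ennreal p * (ennreal (pi_wt Nu u) * ennreal (C u * (a1 ^ (u + 1) * (1 - a1) ^ v)))
        + ennreal (1 - p) * (ennreal (pi_wt Nu u) * ennreal (C u * (a2 ^ (u + 1) * (1 - a2) ^ v)))"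
      unfolding Qker_eq C_def using a less_imp_le[OF pi_wt_pos] by simp
  qed
  also have "\<dots> = ennreal p * (\<integral>\<^sup>+\<omega>. h (T a1 (S_env \<omega>)) \<partial>Env) + ennreal (1 - p) * (\<integral>\<^sup>+\<omega>. h (T a2 (S_env \<omega>)) \<partial>Env)"
    using a series[of a1] series[of a2] by (simp add: suminf_add[symmetric])
  also have "\<dots> = (\<integral>\<^sup>+\<omega>. h (T (\<omega> 0) (S_env \<omega>)) \<partial>Env)"
    by (subst (3) nn_integral_Env_split[where j=0]) (simp_all add: upd)
  \<comment> \<open>In the shifted environment the site 1 carries the old value at 0. Each new
    product of \<open>k + 1\<close> factors is therefore \<open>rho \<omega> 0\<close> times the old
    one of \<open>k\<close> factors, and the empty product supplies the extra 1.\<close>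
  also have "\<dots> = (\<integral>\<^sup>+\<omega>. h (S_env (\<lambda>j. \<omega> (j + (- 1)))) \<partial>Env)"
  proof (rule nn_integral_cong_AE, use AE_S_env AE_space in eventually_elim)
    case (elim \<omega>)
    let ?P = "\<lambda>k. \<Prod>j=1..k. rho \<omega> (int j)"
    let ?P' = "\<lambda>k. \<Prod>j=1..k. rho (\<lambda>j. \<omega> (j + (- 1))) (int j)"
    have P': "?P' (Suc k) = rho \<omega> 0 * ?P k" for k
    proof -
      have "?P' (Suc k) = (\<Prod>j=0..<Suc k. rho \<omega> (int j))"
        by (simp add: prod.shift_bounds_cl_Suc_ivl rho_def atLeastLessThanSuc_atLeastAtMost del: prod.cl_ivl_Suc)
      also have "\<dots> = rho \<omega> 0 * ?P k"
        by (subst prod.atLeast_Suc_lessThan) (simp_all add: atLeastLessThanSuc_atLeastAtMost del: prod.op_ivl_Suc)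
      finally show ?thesis .
    qed
    have pos: "0 < rho \<omega> j" for j using rho_pos[OF elim(2)] .
    have P0: "0 \<le> ?P k" for k using pos by (intro prod_nonneg) (auto intro: less_imp_le)
    have "(\<lambda>k. ?P' (Suc k)) sums (rho \<omega> 0 * rho_series \<omega>)"
      unfolding P' rho_series_def using elim by (intro sums_mult summable_sums) auto
    then have s: "?P' sums (1 + rho \<omega> 0 * rho_series \<omega>)" by (subst (asm) sums_Suc_iff) (simp add: add.commute)
    have P0': "0 \<le> ?P' k" for k by (cases k) (use P' pos[of 0] P0 in \<open>simp_all del: prod.cl_ivl_Suc\<close>)
    have S: "0 < S_env \<omega>" "S_env \<omega> < 1" and "rho_series \<omega> * S_env \<omega> = 1" using elim by auto
    then have R: "rho_series \<omega> = 1 / S_env \<omega>" by (simp add: field_simps)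
    have Rpos: "0 < 1 + rho \<omega> 0 * rho_series \<omega>" using R S pos[of 0] by (simp add: add_pos_pos)
    have "S_env (\<lambda>j. \<omega> (j + (- 1))) = 1 / (1 + rho \<omega> 0 * rho_series \<omega>)"
      unfolding S_env_def using suminf_ennreal_eq[OF P0' s] Rpos
      by (simp add: inverse_ennreal inverse_eq_divide)
    also have "\<dots> = T (\<omega> 0) (S_env \<omega>)"
      using space_Env[OF elim(2), of 0] S unfolding T_def R rho_def
      by (simp add: field_simps)
    finally show ?case by simp
  qed
  also have "\<dots> = (\<integral>\<^sup>+\<omega>. h (S_env \<omega>) \<partial>Env)" by (rule nn_integral_Env_shift) measurable
  also have "\<dots> = ennreal (pi_wt Nu v)" unfolding pi_wt_nn h_def ..
  finally show ?thesis .
qed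

end

section \<open>The law of the left steps\<close>

lemma pmf_path_pmf:
  "pmf (path_pmf K m x) l = (if length l = m then \<Prod>i<m. pmf (K ((x # l) ! i)) (l ! i) else 0)"
proof (induction m arbitrary: x l)
  case 0
  show ?case by (cases l) (auto simp: indicator_def)
next
  case (Suc m)
  have cons: "pmf (map_pmf ((#) y) (path_pmf K m y)) l =
      (case l of [] \<Rightarrow> 0 | z # l' \<Rightarrow> if z = y then pmf (path_pmf K m y) l' else 0)" for y
  proof (cases l)
    case Nil
    then show ?thesis by (auto simp: pmf_eq_0_set_pmf)
  next
    case (Cons z l')
    show ?thesis
    proof (cases "z = y")
      case True
      then show ?thesis using Cons by (simp add: pmf_map_inj')
    next
      case False
      then show ?thesis using Cons by (auto simp: pmf_eq_0_set_pmf)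
    qed
  qed
  show ?case
  proof (cases l)
    case Nil
    then show ?thesis unfolding path_pmf.simps pmf_bind cons by simp
  next
    case (Cons z l')
    have "pmf (path_pmf K (Suc m) x) l = expect (K x) (\<lambda>y. pmf (path_pmf K m z) l' * indicator {z} y)"
      unfolding path_pmf.simps pmf_bind cons by (intro Bochner_Integration.integral_cong) (auto simp: indicator_def Cons)
    also have "\<dots> = pmf (path_pmf K m z) l' * pmf (K x) z" by (simp add: measure_pmf_single)
    finally show ?thesis
      using Cons by (simp add: Suc.IH prod.lessThan_Suc_shift del: prod.lessThan_Suc)
  qed
qed

lemma space_path_space [simp]: "space path_space = UNIV"
  by (simp add: path_space_def space_PiM)

lemma measurable_path_coord [measurable]: "(\<lambda>X. X t) \<in> measurable path_space (count_space UNIV)"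
  unfolding path_space_def by measurable

lemma path_space_cylinder: "{X. map X [1..<Suc m] \<in> A} \<in> sets path_space" for A :: "int list set"
proof -
  have "{X \<in> space path_space. \<forall>i<m. X (Suc i) = l ! i} \<in> sets path_space" for l :: "int list"
    by measurable
  then have "(\<Union>l\<in>A. {X \<in> space path_space. (\<forall>i<m. X (Suc i) = l ! i)} \<inter> (if length l = m then UNIV else {})) \<in> sets path_space"
    by (intro sets.countable_UN') auto
  also have "(\<Union>l\<in>A. {X \<in> space path_space. (\<forall>i<m. X (Suc i) = l ! i)} \<inter> (if length l = m then UNIV else {}))
    = {X. map X [1..<Suc m] \<in> A}"
  proof -
    have "map X [1..<Suc m] = l \<longleftrightarrow> length l = m \<and> (\<forall>i<m. X (Suc i) = l ! i)" for X and l :: "int list"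
      by (auto simp: list_eq_iff_nth_eq simp del: upt_Suc)
    note eq = this
    have "{X. map X [1..<Suc m] \<in> A} = (\<Union>l\<in>A. {X. map X [1..<Suc m] = l})" by blast
    also have "\<dots> = (\<Union>l\<in>A. {X. length l = m \<and> (\<forall>i<m. X (Suc i) = l ! i)})" unfolding eq ..
    also have "\<dots> = (\<Union>l\<in>A. {X \<in> space path_space. (\<forall>i<m. X (Suc i) = l ! i)} \<inter> (if length l = m then UNIV else {}))"
      by (intro SUP_cong refl) auto
    finally show ?thesis ..
  qed
  finally show ?thesis .
qed

lemma path_space_start_cylinder: "{X. X 0 = 0 \<and> map X [1..<Suc m] \<in> A} \<in> sets path_space" for A :: "int list set"
proof -
  have "{X \<in> space path_space. X 0 = 0} \<in> sets path_space" by measurable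
  from sets.Int[OF this path_space_cylinder[of m A]] show ?thesis by (simp add: Int_def del: upt_Suc)
qed

text \<open>Moves events on the first \<open>m\<close> steps from the infinite path space to
  \<open>path_pmf\<close>, where first-step recursions are available. The lists begin with the
  position at time 1, hence the separate condition \<open>X 0 = 0\<close>.\<close>

lemma emeasure_quenched_path:
  "emeasure (quenched \<omega>) {X. X 0 = 0 \<and> map X [1..<Suc m] \<in> A} = emeasure (path_pmf (walk_step \<omega>) m 0) A"
proof -
  let ?B = "{l \<in> A. length l = m}"
  let ?C = "\<lambda>l. {X. X 0 = 0 \<and> map X [1..<Suc m] = l}"
  have C: "?C l = {X. \<forall>i\<le>m. X i = (0 # l) ! i}" if "length l = m" for l
  proof -
    have "(X 0 = 0 \<and> map X [1..<Suc m] = l) \<longleftrightarrow> (\<forall>i\<le>m. X i = (0 # l) ! i)" for X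
      using that by (auto simp: list_eq_iff_nth_eq All_less_Suc2 less_Suc_eq_le[symmetric] simp del: upt_Suc)
    then show ?thesis by blast
  qed
  have meas: "?C l \<in> sets (quenched \<omega>)" for l
    using path_space_start_cylinder[of m "{l}"] by (simp add: sets_quenched del: upt_Suc)
  have "{X. X 0 = 0 \<and> map X [1..<Suc m] \<in> A} = (\<Union>l\<in>?B. ?C l)" by (auto simp del: upt_Suc)
  also have "emeasure (quenched \<omega>) \<dots> = (\<integral>\<^sup>+l. emeasure (quenched \<omega>) (?C l) \<partial>count_space ?B)"
    using meas by (intro emeasure_UN_countable) (auto simp: disjoint_family_on_def)
  also have "\<dots> = (\<integral>\<^sup>+l. pmf (path_pmf (walk_step \<omega>) m 0) l \<partial>count_space ?B)"
  proof (rule nn_integral_cong)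
    fix l assume "l \<in> space (count_space ?B)"
    then have l: "length l = m" by simp
    show "emeasure (quenched \<omega>) (?C l) = ennreal (pmf (path_pmf (walk_step \<omega>) m 0) l)"
      unfolding C[OF l] quenched_path pmf_path_pmf using l
      by (simp add: prod_ennreal)
  qed
  also have "\<dots> = emeasure (path_pmf (walk_step \<omega>) m 0) ?B" by (rule nn_integral_pmf)
  also have "\<dots> = emeasure (path_pmf (walk_step \<omega>) m 0) A"
    by (intro emeasure_eq_AE) (auto simp: AE_measure_pmf_iff length_path_pmf)
  finally show ?thesis .
qed

lemma AE_quenched_start: "AE X in quenched \<omega>. X 0 = 0"
proof -
  interpret prob_space "quenched \<omega>" by (rule prob_space_quenched)
  have "emeasure (quenched \<omega>) {X. X 0 = 0} = 1"
    using quenched_path[of \<omega> 0 "\<lambda>_. 0"] by simp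
  then show ?thesis using sets_quenched[of \<omega>] sets_eq_imp_space_eq[OF sets_quenched]
    by (intro AE_prob_1[of "{X. X 0 = 0}", simplified]) (simp add: measure_def)
qed

lemma expectation_walk_step:
  fixes f :: "int \<Rightarrow> real"
  assumes "0 \<le> \<omega> x" "\<omega> x \<le> 1"
  shows "expect (walk_step \<omega> x) f = \<omega> x * f (x + 1) + (1 - \<omega> x) * f (x - 1)"
  unfolding walk_step_def using assms by (simp add: integral_bernoulli_pmf)

lemma measure_path_pmf_Suc:
  "measure (path_pmf K (Suc m) x) A = expect (K x) (\<lambda>y. measure (path_pmf K m y) {l. y # l \<in> A})"
proof -
  have "measure (path_pmf K (Suc m) x) A = expect (path_pmf K (Suc m) x) (indicator A)" by simp
  also have "\<dots> = expect (K x) (\<lambda>y. expect (map_pmf ((#) y) (path_pmf K m y)) (indicator A))"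
    unfolding path_pmf.simps by (rule expectation_bind_pmf_real[where B=1]) simp
  also have "\<dots> = expect (K x) (\<lambda>y. measure (path_pmf K m y) {l. y # l \<in> A})"
    by (simp add: vimage_def del: integral_map_pmf)
  finally show ?thesis .
qed

text \<open>\<open>hits_with n z x l\<close>: the path \<open>x # l\<close> reaches \<open>n\<close>, and before that makes exactly \<open>z j\<close> left
  steps from each \<open>0 \<le> j < n\<close>.\<close>

fun hits_with :: "int \<Rightarrow> (int \<Rightarrow> nat) \<Rightarrow> int \<Rightarrow> int list \<Rightarrow> bool" where
  "hits_with n z x [] \<longleftrightarrow> x = n \<and> z = (\<lambda>_. 0)"
| "hits_with n z x (y # l) \<longleftrightarrow>
     (if x = n then z = (\<lambda>_. 0)
      else if y = x - 1 \<and> 0 \<le> x \<and> x < n then 0 < z x \<and> hits_with n (z(x := z x - 1)) y l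
      else hits_with n z y l)"

text \<open>What follows the hit is ignored. The events for paths of length \<open>m\<close>
  therefore increase with \<open>m\<close>, and bounds for each of them pass to their union.\<close>

lemma hits_with_extend: "hits_with n z x l \<Longrightarrow> hits_with n z x (l @ [y])"
  by (induction l arbitrary: x z) auto

text \<open>\<open>lprob \<omega> n z x\<close> is the probability that the walk started at \<open>x\<close> hits \<open>n\<close> with left-step counts
  \<open>z\<close>. A site \<open>y\<close> is left to the right \<open>z (y + 1) + 1\<close> times if \<open>x \<le> y\<close> and \<open>z (y + 1)\<close> times if \<open>y < x\<close>; the last
  step from \<open>y\<close> goes right, and the binomial coefficient counts the orders of the other ones. The
  truncated subtraction gives the right value also for \<open>z (y + 1) = 0\<close>, namely \<open>0\<close> unless \<open>z y = 0\<close>.\<close>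

definition lfac :: "(int \<Rightarrow> real) \<Rightarrow> (int \<Rightarrow> nat) \<Rightarrow> int \<Rightarrow> int \<Rightarrow> real" where
  "lfac \<omega> z x y = (if x \<le> y then real ((z (y + 1) + z y) choose z y) * \<omega> y ^ (z (y + 1) + 1)
      else real ((z (y + 1) + z y - 1) choose z y) * \<omega> y ^ z (y + 1)) * (1 - \<omega> y) ^ z y"

definition lprob :: "(int \<Rightarrow> real) \<Rightarrow> int \<Rightarrow> (int \<Rightarrow> nat) \<Rightarrow> int \<Rightarrow> real" where
  "lprob \<omega> n z x = (\<Prod>y\<in>{0..<n}. lfac \<omega> z x y)"

text \<open>From a start at or left of 0 every site of the product is still to be crossed, and the
  steps left of 0 are not counted.\<close>

lemma lprob_neg: "x \<le> 0 \<Longrightarrow> lprob \<omega> n z x = lprob \<omega> n z 0"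
  unfolding lprob_def lfac_def by (intro prod.cong) auto

text \<open>Only the factors at \<open>x\<close> and \<open>x - 1\<close> are affected. The one at
  \<open>x - 1\<close> keeps its value: a left step lowers \<open>z x\<close> by one, but
  \<open>x - 1\<close> then awaits one more right exit. The factors at \<open>x\<close> fit together
  by Pascal's rule.\<close>

lemma lprob_step:
  assumes "0 \<le> x" "x < n"
  shows "lprob \<omega> n z x = \<omega> x * lprob \<omega> n z (x + 1)
    + (1 - \<omega> x) * (if 0 < z x then lprob \<omega> n (z(x := z x - 1)) (x - 1) else 0)"
proof -
  let ?I = "{0..<n} \<inter> {x, x - 1}" and ?J = "{0..<n} - {x, x - 1}"
  let ?z = "z(x := z x - 1)"
  define R where "R = (\<Prod>y\<in>?J. lfac \<omega> z x y)"
  have split: "lprob \<omega> n z' x' = (\<Prod>y\<in>?I. lfac \<omega> z' x' y) * (\<Prod>y\<in>?J. lfac \<omega> z' x' y)" for z' x'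
    unfolding lprob_def by (subst prod.Int_Diff[where B="{x, x - 1}"]) auto
  have R1: "(\<Prod>y\<in>?J. lfac \<omega> z (x + 1) y) = R"
    unfolding R_def lfac_def by (intro prod.cong) auto
  have R2: "(\<Prod>y\<in>?J. lfac \<omega> ?z (x - 1) y) = R"
    unfolding R_def lfac_def by (intro prod.cong) auto
  have local: "(\<Prod>y\<in>?I. lfac \<omega> z x y) = \<omega> x * (\<Prod>y\<in>?I. lfac \<omega> z (x + 1) y)
    + (1 - \<omega> x) * (if 0 < z x then \<Prod>y\<in>?I. lfac \<omega> ?z (x - 1) y else 0)"
  proof (cases "x = 0")
    case True
    then have I: "?I = {0}" using assms by auto
    show ?thesis
    proof (cases "z x")
      case 0
      then show ?thesis unfolding I using True by (simp add: lfac_def)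
    next
      case (Suc b)
      then show ?thesis unfolding I using True by (simp add: lfac_def algebra_simps)
    qed
  next
    case False
    then have I: "?I = {x, x - 1}" using assms by auto
    show ?thesis
    proof (cases "z x")
      case 0
      then show ?thesis unfolding I by (simp add: lfac_def)
    next
      case (Suc b)
      then show ?thesis unfolding I by (simp add: lfac_def algebra_simps)
    qed
  qed
  show ?thesis unfolding split[of z x] split[of z "x + 1"] split[of ?z] R1 R2 R_def[symmetric] local
    by (simp add: algebra_simps)
qed

lemma lfac_nonneg: "0 < \<omega> y \<Longrightarrow> \<omega> y < 1 \<Longrightarrow> 0 \<le> lfac \<omega> z x y"
  unfolding lfac_def by (auto intro!: mult_nonneg_nonneg)

text \<open>\<open>lprob\<close> solves the one-step equations, of which the hitting probabilities are the minimal
  nonnegative solution.\<close>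

lemma measure_hits_with_le:
  assumes \<omega>: "\<And>j. 0 < \<omega> j \<and> \<omega> j < 1" and "x \<le> n"
  shows "measure (path_pmf (walk_step \<omega>) m x) {l. hits_with n z x l} \<le> lprob \<omega> n z x"
  using assms(2)
proof (induction m arbitrary: x z)
  case 0
  have nn: "0 \<le> lprob \<omega> n z x" unfolding lprob_def using \<omega> by (intro prod_nonneg) (auto intro: lfac_nonneg)
  have "lprob \<omega> n (\<lambda>_. 0) n = 1" unfolding lprob_def lfac_def by (intro prod.neutral) auto
  then show ?case using nn by (auto simp: indicator_def)
next
  case (Suc m)
  have nn: "0 \<le> lprob \<omega> n z x" for x z unfolding lprob_def using \<omega> by (intro prod_nonneg) (auto intro: lfac_nonneg)
  show ?case
  proof (cases "x = n")
    case True
    have l1: "lprob \<omega> n (\<lambda>_. 0) n = 1" unfolding lprob_def lfac_def by (intro prod.neutral) auto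
    have "measure (path_pmf (walk_step \<omega>) (Suc m) x) {l. hits_with n z x l} \<le> lprob \<omega> n z x"
    proof (cases "z = (\<lambda>_. 0)")
      case z0: True
      show ?thesis using True z0 l1 measure_pmf.prob_le_1 by simp
    next
      case z1: False
      have "{l. hits_with n z x l} = {}" using True z1 by (auto elim: hits_with.elims)
      then show ?thesis using nn by (simp del: path_pmf.simps)
    qed
    then show ?thesis .
  next
    case False
    with Suc.prems have xn: "x < n" by simp
    have w: "0 \<le> \<omega> x" "\<omega> x \<le> 1" using \<omega>[of x] by auto
    let ?P = "\<lambda>y z. measure (path_pmf (walk_step \<omega>) m y) {l. hits_with n z y l}"
    have step: "measure (path_pmf (walk_step \<omega>) (Suc m) x) {l. hits_with n z x l}
      = \<omega> x * measure (path_pmf (walk_step \<omega>) m (x + 1)) {l. hits_with n z x ((x + 1) # l)}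
      + (1 - \<omega> x) * measure (path_pmf (walk_step \<omega>) m (x - 1)) {l. hits_with n z x ((x - 1) # l)}"
      unfolding measure_path_pmf_Suc expectation_walk_step[of \<omega> x, OF w] by simp
    show ?thesis
    proof (cases "0 \<le> x")
      case True
      have "measure (path_pmf (walk_step \<omega>) (Suc m) x) {l. hits_with n z x l}
        = \<omega> x * ?P (x + 1) z + (1 - \<omega> x) * (if 0 < z x then ?P (x - 1) (z(x := z x - 1)) else 0)"
        unfolding step using True xn by simp
      also have "\<dots> \<le> \<omega> x * lprob \<omega> n z (x + 1)
        + (1 - \<omega> x) * (if 0 < z x then lprob \<omega> n (z(x := z x - 1)) (x - 1) else 0)"
        using w xn by (intro add_mono mult_left_mono Suc.IH) (auto intro!: Suc.IH)
      also have "\<dots> = lprob \<omega> n z x" using lprob_step[OF True xn] by simp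
      finally show ?thesis .
    next
      case False
      have "measure (path_pmf (walk_step \<omega>) (Suc m) x) {l. hits_with n z x l}
        = \<omega> x * ?P (x + 1) z + (1 - \<omega> x) * ?P (x - 1) z"
        unfolding step using False xn by simp
      also have "\<dots> \<le> \<omega> x * lprob \<omega> n z (x + 1) + (1 - \<omega> x) * lprob \<omega> n z (x - 1)"
        using w xn by (intro add_mono mult_left_mono Suc.IH) auto
      also have "\<dots> = lprob \<omega> n z x"
        using False lprob_neg[of "x + 1" \<omega> n z] lprob_neg[of "x - 1" \<omega> n z] lprob_neg[of x \<omega> n z]
        by (simp add: algebra_simps)
      finally show ?thesis .
    qed
  qed
qed

section \<open>Almost sure hitting of levels to the right\<close>

definition miss :: "(int \<Rightarrow> real) \<Rightarrow> int \<Rightarrow> nat \<Rightarrow> int \<Rightarrow> real" where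
  "miss \<omega> n m x = measure (path_pmf (walk_step \<omega>) m x) {l. n \<notin> set (x # l)}"

text \<open>The probability of never hitting \<open>n\<close> is harmonic left of \<open>n\<close>, so its increments satisfy
  \<open>d x = \<rho>\<^sub>x d (x - 1)\<close>; being bounded, they vanish when the products of the \<open>\<rho>\<close> tend to \<open>0\<close>.\<close>

lemma miss_tendsto_0:
  assumes \<omega>: "\<And>j. 0 < \<omega> j \<and> \<omega> j < 1"
    and lim: "(\<lambda>k. \<Prod>j=1..k. rho \<omega> (n - int j)) \<longlonglongrightarrow> 0" and "x \<le> n"
  shows "(\<lambda>m. miss \<omega> n m x) \<longlonglongrightarrow> 0"
proof -
  have w: "0 \<le> \<omega> x" "\<omega> x \<le> 1" for x using \<omega>[of x] by auto
  have step: "miss \<omega> n (Suc m) x = \<omega> x * miss \<omega> n m (x + 1) + (1 - \<omega> x) * miss \<omega> n m (x - 1)" if "x \<noteq> n" for m x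
    unfolding miss_def measure_path_pmf_Suc expectation_walk_step[of \<omega> x, OF w] using that by auto
  have at_n: "miss \<omega> n m n = 0" for m unfolding miss_def by simp
  have bnd: "0 \<le> miss \<omega> n m x" "miss \<omega> n m x \<le> 1" for m x unfolding miss_def by auto
  have dec: "miss \<omega> n (Suc m) x \<le> miss \<omega> n m x" for m x
  proof (induction m arbitrary: x)
    case 0
    show ?case
    proof (cases "x = n")
      case False
      then have "miss \<omega> n 0 x = 1" unfolding miss_def by simp
      then show ?thesis using bnd by simp
    qed (simp add: at_n)
  next
    case (Suc m)
    show ?case
    proof (cases "x = n")
      case False
      show ?thesis unfolding step[OF False, of "Suc m"] step[OF False, of m]
        using w[of x] by (intro add_mono mult_left_mono Suc) auto
    qed (simp add: at_n)
  qed
  define e where "e x = lim (\<lambda>m. miss \<omega> n m x)" for x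
  have conv: "(\<lambda>m. miss \<omega> n m x) \<longlonglongrightarrow> e x" for x
  proof -
    have "decseq (\<lambda>m. miss \<omega> n m x)" using dec by (simp add: decseq_Suc_iff)
    then have "convergent (\<lambda>m. miss \<omega> n m x)"
      using bnd by (metis decseq_convergent convergentI)
    then show ?thesis unfolding e_def by (simp add: convergent_LIMSEQ_iff)
  qed
  have e_bnd: "0 \<le> e x" "e x \<le> 1" for x
    using LIMSEQ_le_const[OF conv[of x]] LIMSEQ_le_const2[OF conv[of x]] bnd by blast+
  have e_n: "e n = 0" using LIMSEQ_unique[OF conv[of n]] by (simp add: at_n)
  have harm: "e x = \<omega> x * e (x + 1) + (1 - \<omega> x) * e (x - 1)" if "x \<noteq> n" for x
  proof (rule LIMSEQ_unique)
    show "(\<lambda>m. miss \<omega> n (Suc m) x) \<longlonglongrightarrow> e x" using conv by (rule LIMSEQ_Suc)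
    show "(\<lambda>m. miss \<omega> n (Suc m) x) \<longlonglongrightarrow> \<omega> x * e (x + 1) + (1 - \<omega> x) * e (x - 1)"
      unfolding step[OF that] by (intro tendsto_intros conv)
  qed
  define d where "d x = e x - e (x + 1)" for x
  have d: "d x = rho \<omega> x * d (x - 1)" if "x \<noteq> n" for x
  proof -
    have "\<omega> x * d x = (1 - \<omega> x) * d (x - 1)"
      using harm[OF that] unfolding d_def by (simp add: algebra_simps)
    then show ?thesis using \<omega>[of x] unfolding rho_def by (simp add: field_simps)
  qed
  have d_iter: "d (n - 1) = (\<Prod>j=1..k. rho \<omega> (n - int j)) * d (n - 1 - int k)" for k
  proof (induction k)
    case (Suc k)
    then show ?case using d[of "n - 1 - int k"] by (simp add: algebra_simps)
  qed simp
  have rho0: "0 < rho \<omega> j" for j using \<omega>[of j] by (simp add: rho_def)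
  have "\<bar>d (n - 1)\<bar> \<le> (\<Prod>j=1..k. rho \<omega> (n - int j))" for k
  proof -
    have "\<bar>d (n - 1 - int k)\<bar> \<le> 1" unfolding d_def using e_bnd[of "n - 1 - int k"] e_bnd[of "n - 1 - int k + 1"] by linarith
    moreover have "0 \<le> (\<Prod>j=1..k. rho \<omega> (n - int j))" using rho0 by (intro prod_nonneg) (auto intro: less_imp_le)
    ultimately show ?thesis using d_iter[of k] by (simp add: abs_mult mult_left_le)
  qed
  then have d0: "d (n - 1) = 0" using LIMSEQ_le_const[OF lim] by fastforce
  have dk: "d (n - 1 - int k) = 0" for k
  proof -
    have "0 < (\<Prod>j=1..k. rho \<omega> (n - int j))" using rho0 by (intro prod_pos) auto
    then show ?thesis using d_iter[of k] unfolding d0 by (metis less_irrefl mult_eq_0_iff)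
  qed
  have "e (n - int k) = 0" for k
  proof (induction k)
    case (Suc k)
    then show ?case using dk[of k] unfolding d_def by (simp add: algebra_simps)
  qed (simp add: e_n)
  from this[of "nat (n - x)"] have "e x = 0" using \<open>x \<le> n\<close> by simp
  then show ?thesis using conv[of x] by simp
qed

section \<open>Left steps read off finite pieces of the path\<close>

fun lcount :: "int \<Rightarrow> int \<Rightarrow> int list \<Rightarrow> nat" where
  "lcount j x [] = 0"
| "lcount j x (y # l) = of_bool (x = j \<and> y = j - 1) + lcount j y l"

text \<open>A recorded left step lowers one count in \<open>hits_with\<close>, just as passing to
  the tail of the list lowers \<open>lcount\<close>. As \<open>n\<close> is met only at the end of
  the list, the counts are used up exactly there.\<close>

lemma hits_with_lcount:
  assumes "n \<notin> set (butlast (x # l))" "last (x # l) = n"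
  shows "hits_with n (\<lambda>j. if 0 \<le> j \<and> j < n then lcount j x l else 0) x l"
  using assms
proof (induction l arbitrary: x)
  case (Cons y l)
  let ?z = "\<lambda>x l j. if 0 \<le> j \<and> j < n then lcount j x l else 0"
  have x: "x \<noteq> n" using Cons.prems by auto
  have IH: "hits_with n (?z y l) y l" using Cons.prems by (intro Cons.IH) auto
  show ?case
  proof (cases "y = x - 1 \<and> 0 \<le> x \<and> x < n")
    case True
    then have "(?z x (y # l))(x := ?z x (y # l) x - 1) = ?z y l" by (auto simp: fun_eq_iff)
    then show ?thesis using True IH x by simp
  next
    case False
    then have "?z x (y # l) = ?z y l" by (auto simp: fun_eq_iff)
    then show ?thesis using False IH x by (simp only: hits_with.simps if_False)
  qed
qed auto

lemma lcount_map: "lcount j (X 0) (map X [1..<Suc m]) = (\<Sum>t<m. of_bool (X t = j \<and> X (t + 1) = j - 1))"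
proof (induction m arbitrary: X)
  case (Suc m)
  have "map X [1..<Suc (Suc m)] = X 1 # map (\<lambda>t. X (Suc t)) [1..<Suc m]"
    by (simp add: upt_conv_Cons map_Suc_upt[symmetric] comp_def del: upt_Suc)
  then show ?case using Suc[of "\<lambda>t. X (Suc t)"]
    by (simp add: sum.lessThan_Suc_shift del: sum.lessThan_Suc upt_Suc)
qed simp

lemma less_hit_time_iff: "enat t < hit_time X n \<longleftrightarrow> (\<forall>s\<le>t. X s \<noteq> int n)"
proof
  assume "enat t < hit_time X n"
  then show "\<forall>s\<le>t. X s \<noteq> int n"
    unfolding hit_time_def by (metis (mono_tags) INF_lower enat_ord_simps(1) leD mem_Collect_eq order_trans)
next
  assume "\<forall>s\<le>t. X s \<noteq> int n"
  then have "enat (Suc t) \<le> hit_time X n"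
    unfolding hit_time_def by (intro INF_greatest) (auto simp: not_less_eq_eq)
  then show "enat t < hit_time X n" by (rule less_le_trans[rotated]) simp
qed

lemma hit_time_finite_iff: "hit_time X n < \<infinity> \<longleftrightarrow> (\<exists>t. X t = int n)"
proof
  assume "hit_time X n < \<infinity>"
  then obtain t where "hit_time X n = enat t" by (metis less_infinityE)
  then show "\<exists>t. X t = int n" using less_hit_time_iff[of t X n] by auto
next
  assume "\<exists>t. X t = int n"
  then obtain t where "X t = int n" by blast
  then have "hit_time X n \<le> enat t" unfolding hit_time_def by (intro INF_lower) auto
  then show "hit_time X n < \<infinity>" by (metis enat_ord_code(4) le_less_trans)
qed

lemma left_steps_first_hit:
  assumes "X m = int n" "\<And>s. s < m \<Longrightarrow> X s \<noteq> int n"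
  shows "left_steps X n x = (\<Sum>t<m. of_bool (X t = int x \<and> X (t + 1) = int x - 1))"
proof -
  have "(\<forall>s\<le>t. X s \<noteq> int n) \<longleftrightarrow> t < m" for t
    using assms(1) assms(2) by (cases "t < m") (auto intro!: exI[of _ m])
  then have "{t. enat t < hit_time X n} = {..<m}" unfolding less_hit_time_iff by auto
  then show ?thesis unfolding left_steps_def by simp
qed

text \<open>The set of times is then infinite, and a sum over an infinite set is 0 by
  convention.\<close>

lemma left_steps_never_hit:
  assumes "\<And>t. X t \<noteq> int n"
  shows "left_steps X n x = 0"
proof -
  have "{t. enat t < hit_time X n} = UNIV" unfolding less_hit_time_iff using assms by auto
  then show ?thesis unfolding left_steps_def by simp
qed

text \<open>The paths are split by their first hitting time \<open>m\<close> of \<open>n\<close>,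
  which makes the count a finite sum; the paths that never hit form an extra case of value
  0.\<close>

lemma measurable_left_steps [measurable]: "(\<lambda>X. left_steps X n x) \<in> measurable path_space (count_space UNIV)"
proof -
  let ?H = "\<lambda>m. {X \<in> space path_space. X m = int n \<and> (\<forall>s<m. X s \<noteq> int n)}"
  let ?f = "\<lambda>m X. \<Sum>t<m. of_bool (X t = int x \<and> X (t + 1) = int x - 1) :: nat"
  have "{X \<in> space path_space. left_steps X n x = k} \<in> sets path_space" for k
  proof -
    have H: "?H m \<in> sets path_space" for m by measurable
    have N: "{X \<in> space path_space. \<forall>t. X t \<noteq> int n} \<in> sets path_space" by measurable
    have f: "{X \<in> space path_space. ?f m X = k} \<in> sets path_space" for m
    proof -
      have eq: "?f m X = lcount (int x) (X 0) (map X [1..<Suc m])" for X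
        by (rule lcount_map[symmetric])
      have "{X \<in> space path_space. ?f m X = k}
        = (\<Union>c. {X \<in> space path_space. X 0 = c} \<inter> {X. map X [1..<Suc m] \<in> {l. lcount (int x) c l = k}})"
        unfolding eq by (auto simp del: upt_Suc)
      also have "\<dots> \<in> sets path_space"
      proof (rule sets.countable_UN'')
        fix c :: int
        have "{X \<in> space path_space. X 0 = c} \<in> sets path_space" by measurable
        then show "{X \<in> space path_space. X 0 = c} \<inter> {X. map X [1..<Suc m] \<in> {l. lcount (int x) c l = k}} \<in> sets path_space"
          by (rule sets.Int[OF _ path_space_cylinder])
      qed simp
      finally show ?thesis .
    qed
    have "{X \<in> space path_space. left_steps X n x = k} = (\<Union>m. ?H m \<inter> {X \<in> space path_space. ?f m X = k})
      \<union> (if k = 0 then {X \<in> space path_space. \<forall>t. X t \<noteq> int n} else {})" (is "?L = ?R")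
    proof (intro set_eqI)
      fix X :: "nat \<Rightarrow> int"
      show "X \<in> ?L \<longleftrightarrow> X \<in> ?R"
      proof (cases "\<exists>t. X t = int n")
        case True
        define m where "m = (LEAST t. X t = int n)"
        have m: "X m = int n" unfolding m_def using True by (rule LeastI_ex)
        have m': "X s \<noteq> int n" if "s < m" for s using that unfolding m_def by (rule not_less_Least)
        have u: "X \<in> ?H m' \<longleftrightarrow> m' = m" for m'
        proof
          assume "X \<in> ?H m'"
          then have "\<not> m' < m" "\<not> m < m'" using m m' by auto
          then show "m' = m" by simp
        qed (use m m' in simp)
        have "X \<in> (if k = 0 then {X \<in> space path_space. \<forall>t. X t \<noteq> int n} else {}) \<longleftrightarrow> False"
          using True by simp
        moreover have "X \<in> (\<Union>m. ?H m \<inter> {X \<in> space path_space. ?f m X = k}) \<longleftrightarrow> ?f m X = k"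
          unfolding UN_iff Int_iff u by simp
        ultimately have "X \<in> ?R \<longleftrightarrow> ?f m X = k" by (simp only: Un_iff simp_thms)
        then show ?thesis using left_steps_first_hit[of X m n x, OF m m'] by simp
      next
        case False
        then show ?thesis using left_steps_never_hit[of X n x] by auto
      qed
    qed
    also have "\<dots> \<in> sets path_space" using H f N by (intro sets.Un sets.countable_UN sets.Int) auto
    finally show ?thesis .
  qed
  then show ?thesis by (subst measurable_count_space_eq2_countable) (auto simp: vimage_def)
qed

text \<open>Domination on points gives domination on every set, hence also on its complement; with
  total mass 1 on both sides neither inequality can be strict.\<close>

lemma measure_eq_pmf_if_singletons_le:
  fixes q :: "'a::countable pmf"
  assumes "prob_space D" "sets D = UNIV" and le: "\<And>l. emeasure D {l} \<le> ennreal (pmf q l)"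
  shows "D = measure_pmf q"
proof (rule measure_eqI)
  interpret D: prob_space D by fact
  have sp: "space D = UNIV" using assms(2) by (metis UNIV_I sets.sets_into_space top.extremum_uniqueI)
  have le_set: "emeasure D A \<le> emeasure (measure_pmf q) A" for A
  proof -
    have "emeasure D A = (\<integral>\<^sup>+l. emeasure D {l} \<partial>count_space A)"
      using assms(2) by (intro emeasure_countable_singleton) auto
    also have "\<dots> \<le> (\<integral>\<^sup>+l. pmf q l \<partial>count_space A)" by (intro nn_integral_mono le)
    also have "\<dots> = emeasure (measure_pmf q) A" by (rule nn_integral_pmf)
    finally show ?thesis .
  qed
  then have le': "measure D A \<le> measure (measure_pmf q) A" for A
    by (simp add: D.emeasure_eq_measure measure_pmf.emeasure_eq_measure)
  show "emeasure D A = emeasure (measure_pmf q) A" for A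
  proof -
    have "measure D (- A) = 1 - measure D A" "measure (measure_pmf q) (- A) = 1 - measure (measure_pmf q) A"
      using D.prob_compl[of A] measure_pmf.prob_compl[of A q] assms(2) sp by (simp_all add: Compl_eq_Diff_UNIV)
    then have "measure D A = measure (measure_pmf q) A" using le'[of A] le'[of "- A"] by simp
    then show ?thesis by (simp add: D.emeasure_eq_measure measure_pmf.emeasure_eq_measure)
  qed
qed (simp add: assms)

lemma quenched_hits:
  assumes \<omega>: "\<And>j. 0 < \<omega> j \<and> \<omega> j < 1"
    and lim: "(\<lambda>k. \<Prod>j=1..k. rho \<omega> (int n - int j)) \<longlonglongrightarrow> 0"
  shows "AE X in quenched \<omega>. \<exists>t. X t = int n"
proof -
  interpret Q: prob_space "quenched \<omega>" by (rule prob_space_quenched)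
  have [measurable_cong]: "sets (quenched \<omega>) = sets path_space" by (rule sets_quenched)
  have sp: "space (quenched \<omega>) = UNIV" using sets_eq_imp_space_eq[OF sets_quenched[of \<omega>]] by simp
  let ?N = "{X. X 0 = 0 \<and> (\<forall>t. X t \<noteq> int n)}"
  have N: "?N \<in> sets (quenched \<omega>)"
  proof -
    have "{X \<in> space path_space. X 0 = 0 \<and> (\<forall>t. X t \<noteq> int n)} \<in> sets path_space" by measurable
    then show ?thesis by (simp add: sets_quenched)
  qed
  have "emeasure (quenched \<omega>) ?N \<le> ennreal (miss \<omega> (int n) m 0)" for m
  proof -
    have "{X. X 0 = 0 \<and> map X [1..<Suc m] \<in> {l. int n \<notin> set (0 # l)}} \<in> sets (quenched \<omega>)"
    unfolding sets_quenched by (rule path_space_start_cylinder)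
    moreover have "?N \<subseteq> {X. X 0 = 0 \<and> map X [1..<Suc m] \<in> {l. int n \<notin> set (0 # l)}}"
    proof
      fix X :: "nat \<Rightarrow> int" assume "X \<in> ?N"
      then have X: "X 0 = 0" "\<And>t. X t \<noteq> int n" by auto
      then have "int n \<noteq> 0" by metis
      with X show "X \<in> {X. X 0 = 0 \<and> map X [1..<Suc m] \<in> {l. int n \<notin> set (0 # l)}}" by (auto simp del: upt_Suc) (metis X(2))
    qed
    ultimately have "emeasure (quenched \<omega>) ?N
      \<le> emeasure (quenched \<omega>) {X. X 0 = 0 \<and> map X [1..<Suc m] \<in> {l. int n \<notin> set (0 # l)}}"
      by (rule emeasure_mono[rotated])
    also have "\<dots> = ennreal (miss \<omega> (int n) m 0)"
      unfolding emeasure_quenched_path miss_def by (simp add: measure_pmf.emeasure_eq_measure)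
    finally show ?thesis .
  qed
  moreover have "(\<lambda>m. ennreal (miss \<omega> (int n) m 0)) \<longlonglongrightarrow> ennreal 0"
    by (intro tendsto_ennrealI miss_tendsto_0[OF \<omega> lim]) simp
  ultimately have "emeasure (quenched \<omega>) ?N \<le> 0"
    using LIMSEQ_le_const[of "\<lambda>m. ennreal (miss \<omega> (int n) m 0)" 0] by auto
  then have "AE X in quenched \<omega>. \<not> (X 0 = 0 \<and> (\<forall>t. X t \<noteq> int n))"
    using N by (intro AE_I[of _ _ ?N]) (auto simp: sp)
  with AE_quenched_start[of \<omega>] show ?thesis by eventually_elim auto
qed

lemma hits_with_left_steps:
  assumes "X 0 = 0" "X t = int n" "\<And>j. z j = (if 0 \<le> j \<and> j < int n then left_steps X n (nat j) else 0)"
  shows "\<exists>m. hits_with (int n) z 0 (map X [1..<Suc m])"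
proof -
  define m where "m = (LEAST t. X t = int n)"
  have m: "X m = int n" unfolding m_def using assms(2) by (rule LeastI)
  have m': "X s \<noteq> int n" if "s < m" for s using that unfolding m_def by (rule not_less_Least)
  let ?l = "map X [1..<Suc m]"
  have l: "X 0 # ?l = map X [0..<Suc m]" by (simp add: upt_conv_Cons del: upt_Suc)
  have b: "butlast (X 0 # ?l) = map X [0..<m]" "last (X 0 # ?l) = X m" unfolding l by simp_all
  have "int n \<notin> set (butlast (X 0 # ?l))" unfolding b using m' by fastforce
  moreover have "last (X 0 # ?l) = int n" unfolding b by (rule m)
  ultimately
  have h: "hits_with (int n) (\<lambda>j. if 0 \<le> j \<and> j < int n then lcount j (X 0) ?l else 0) (X 0) ?l"
    by (rule hits_with_lcount)
  have "z j = (if 0 \<le> j \<and> j < int n then lcount j (X 0) ?l else 0)" for j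
    unfolding assms(3) lcount_map using left_steps_first_hit[of X m n "nat j", OF m m'] by simp
  then have "z = (\<lambda>j. if 0 \<le> j \<and> j < int n then lcount j (X 0) ?l else 0)" by (rule ext)
  with h assms(1) show ?thesis by metis
qed

text \<open>Almost every path in \<open>E\<close> satisfies \<open>hits_with\<close> after finitely
  many steps. These events increase with the length, and each has probability at most
  \<open>lprob\<close>.\<close>

lemma quenched_left_steps_le:
  assumes \<omega>: "\<And>j. 0 < \<omega> j \<and> \<omega> j < 1" and z: "\<And>j. j < 0 \<or> int n \<le> j \<Longrightarrow> z j = 0"
    and E: "E \<in> sets path_space" "\<And>X. X \<in> E \<Longrightarrow> \<exists>t. X t = int n"
    "\<And>X j. X \<in> E \<Longrightarrow> j < n \<Longrightarrow> left_steps X n j = z (int j)"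
  shows "emeasure (quenched \<omega>) E \<le> ennreal (lprob \<omega> (int n) z 0)"
proof -
  let ?A = "\<lambda>m. {X. X 0 = 0 \<and> map X [1..<Suc m] \<in> {l. hits_with (int n) z 0 l}}"
  have A: "?A m \<in> sets (quenched \<omega>)" for m
    unfolding sets_quenched by (rule path_space_start_cylinder)
  have "emeasure (quenched \<omega>) E \<le> emeasure (quenched \<omega>) (\<Union>m. ?A m)"
  proof (rule emeasure_mono_AE)
    show "AE X in quenched \<omega>. X \<in> E \<longrightarrow> X \<in> (\<Union>m. ?A m)"
      using AE_quenched_start[of \<omega>]
    proof eventually_elim
      case (elim X)
      show ?case
      proof
        assume X: "X \<in> E"
        then obtain t where t: "X t = int n" using E by blast
        have "z j = (if 0 \<le> j \<and> j < int n then left_steps X n (nat j) else 0)" for j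
          using z[of j] E(3)[OF X, of "nat j"] by (auto simp: not_le not_less nat_less_iff)
        from hits_with_left_steps[OF elim t this] elim show "X \<in> (\<Union>m. ?A m)" by auto
      qed
    qed
  qed (use A in auto)
  also have "\<dots> = (SUP m. emeasure (quenched \<omega>) (?A m))"
  proof (rule SUP_emeasure_incseq[symmetric])
    show "incseq ?A"
    proof (rule incseq_SucI, rule subsetI)
      fix m X assume "X \<in> ?A m"
      then show "X \<in> ?A (Suc m)"
        using hits_with_extend[of "int n" z 0 "map X [1..<Suc m]" "X (Suc m)"] by simp
    qed
  qed (use A in auto)
  also have "\<dots> \<le> ennreal (lprob \<omega> (int n) z 0)"
    unfolding emeasure_quenched_path measure_pmf.emeasure_eq_measure
    by (intro SUP_least ennreal_leI measure_hits_with_le \<omega>) simp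
  finally show ?thesis .
qed

text \<open>Reading the sites downwards turns the counts into a path of the branching process; its value at
  time \<open>0\<close>, the count \<open>0\<close> at the site \<open>n\<close>, is left out.\<close>

definition lvec :: "nat \<Rightarrow> (nat \<Rightarrow> int) \<Rightarrow> nat list" where
  "lvec n X = map (left_steps X n) (rev [0..<n])"

lemma lvec_eq_iff: "lvec n X = l \<longleftrightarrow> length l = n \<and> (\<forall>i<n. left_steps X n (n - Suc i) = l ! i)"
  unfolding lvec_def by (auto simp: list_eq_iff_nth_eq rev_nth)

lemma length_lvec [simp]: "length (lvec n X) = n"
  by (simp add: lvec_def)

lemma measurable_lvec [measurable]: "lvec n \<in> measurable path_space (count_space UNIV)"
proof -
  have "lvec n -` {l} \<inter> space path_space \<in> sets path_space" for l
  proof -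
    have "{X \<in> space path_space. \<forall>i<n. left_steps X n (n - Suc i) = l ! i} \<in> sets path_space" by measurable
    moreover have "lvec n -` {l} \<inter> space path_space
      = (if length l = n then {X \<in> space path_space. \<forall>i<n. left_steps X n (n - Suc i) = l ! i} else {})"
      by (auto simp: lvec_eq_iff)
    ultimately show ?thesis by simp
  qed
  then show ?thesis by (subst measurable_count_space_eq2_countable) auto
qed

section \<open>Annealed law of the left-step counts\<close>

context transient_two_point_env
begin

abbreviation "Ann \<equiv> annealed Nu"

lemma prob_space_Ann: "prob_space Ann" and sets_Ann: "sets Ann = sets path_space"
proof -
  interpret E: prob_space Env by (rule prob_space_Env)
  have q: "quenched \<in> measurable Env (subprob_algebra path_space)"
    by (rule measurable_prob_algebraD[OF measurable_quenched[OF sets_two_point]])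
  show s: "sets Ann = sets path_space"
    unfolding annealed_def by (rule sets_bind[OF sets_kernel[OF q] E.not_empty])
  have "emeasure Ann UNIV = (\<integral>\<^sup>+\<omega>. emeasure (quenched \<omega>) UNIV \<partial>Env)"
    by (rule emeasure_annealed[OF prob_space_nu sets_two_point]) (use sets.top[of path_space] in simp)
  also have "\<dots> = (\<integral>\<^sup>+\<omega>. 1 \<partial>Env)"
  proof (rule nn_integral_cong)
    fix \<omega> :: "int \<Rightarrow> real"
    show "emeasure (quenched \<omega>) UNIV = 1"
      using prob_space.emeasure_space_1[OF prob_space_quenched[of \<omega>]] sets_eq_imp_space_eq[OF sets_quenched[of \<omega>]] by simp
  qed
  also have "\<dots> = 1" using E.emeasure_space_1 by simp
  finally show "prob_space Ann"
    using sets_eq_imp_space_eq[OF s] by (intro prob_spaceI) simp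
qed

lemma space_Ann [simp]: "space Ann = UNIV"
  using sets_eq_imp_space_eq[OF sets_Ann] by simp

lemma AE_Ann_hits: "AE X in Ann. \<exists>t. X t = int n"
proof -
  interpret E: prob_space Env by (rule prob_space_Env)
  let ?N = "{X. \<forall>t. X t \<noteq> int n}"
  have "{X \<in> space path_space. \<forall>t. X t \<noteq> int n} \<in> sets path_space" by measurable
  then have N: "?N \<in> sets path_space" by simp
  \<comment> \<open>Reading the environment leftwards from \<open>n\<close> is another injective
    enumeration of sites, so the products on that side tend to 0 as well.\<close>
  have "AE \<omega> in Env. summable (\<lambda>k. \<Prod>j=1..k. rho \<omega> (int n - int j))"
    by (rule AE_summable_rho_prod) (auto simp: inj_on_def)
  then have "AE \<omega> in Env. emeasure (quenched \<omega>) ?N = 0"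
    using AE_space
  proof eventually_elim
    case (elim \<omega>)
    have "AE X in quenched \<omega>. \<exists>t. X t = int n"
      using elim space_Env by (intro quenched_hits summable_LIMSEQ_zero) auto
    then show ?case using N
      by (subst (asm) AE_iff_measurable[of ?N])
         (auto simp: sets_quenched sets_eq_imp_space_eq[OF sets_quenched])
  qed
  then have "(\<integral>\<^sup>+\<omega>. emeasure (quenched \<omega>) ?N \<partial>Env) = (\<integral>\<^sup>+\<omega>. 0 \<partial>Env)" by (rule nn_integral_cong_AE)
  then have "emeasure Ann ?N = 0"
    by (subst emeasure_annealed[OF prob_space_nu sets_two_point N]) simp
  then show ?thesis using N by (intro AE_I[of _ _ ?N]) (auto simp: sets_Ann)
qed

text \<open>From the start 0 each site contributes a factor in its own coordinate of
  \<open>\<omega>\<close>, and independence averages these factors separately into entries of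
  \<open>Q\<close>. The reflection \<open>i = n - 1 - y\<close> turns sites into times of the chain:
  the count at \<open>y + 1\<close> precedes the one at \<open>y\<close>, and the count 0 at the
  site \<open>n\<close> is the initial state.\<close>

lemma lprob_expectation:
  assumes "length l = n"
  defines "z \<equiv> \<lambda>j. if 0 \<le> j \<and> j < int n then l ! nat (int n - 1 - j) else 0"
  shows "(\<integral>\<^sup>+\<omega>. ennreal (lprob \<omega> (int n) z 0) \<partial>Env) = ennreal (pmf (path_pmf Q_pmf n 0) l)"
proof -
  let ?Q = "Qker Nu"
  define f where "f y a = ennreal (real ((z (y + 1) + z y) choose z y) * a ^ (z (y + 1) + 1) * (1 - a) ^ z y)" for y :: int and a :: real
  have "(\<integral>\<^sup>+\<omega>. ennreal (lprob \<omega> (int n) z 0) \<partial>Env) = (\<integral>\<^sup>+\<omega>. (\<Prod>y\<in>{0..<int n}. f y (\<omega> y)) \<partial>Env)"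
  proof (rule nn_integral_cong)
    fix \<omega> assume \<omega>: "\<omega> \<in> space Env"
    have "lprob \<omega> (int n) z 0 = (\<Prod>y\<in>{0..<int n}. real ((z (y + 1) + z y) choose z y) * \<omega> y ^ (z (y + 1) + 1) * (1 - \<omega> y) ^ z y)"
      unfolding lprob_def lfac_def by (intro prod.cong) auto
    then show "ennreal (lprob \<omega> (int n) z 0) = (\<Prod>y\<in>{0..<int n}. f y (\<omega> y))"
      unfolding f_def using space_Env[OF \<omega>]
      by (subst prod_ennreal) (auto intro!: mult_nonneg_nonneg zero_le_power less_imp_le)
  qed
  also have "\<dots> = (\<Prod>y\<in>{0..<int n}. ennreal p * f y a1 + ennreal (1 - p) * f y a2)"
    by (rule nn_integral_Env_prod) (simp_all add: f_def[abs_def])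
  also have "\<dots> = (\<Prod>y\<in>{0..<int n}. ennreal (?Q (z (y + 1)) (z y)))"
  proof (rule prod.cong)
    fix y
    define c where "c = real ((z (y + 1) + z y) choose z y)"
    define t where "t a = a ^ (z (y + 1) + 1) * (1 - a) ^ z y" for a :: real
    have t: "0 \<le> t a1" "0 \<le> t a2" unfolding t_def using a by simp_all
    have f: "f y a = ennreal (c * t a)" for a unfolding f_def c_def t_def by (simp add: mult.assoc)
    have "ennreal p * f y a1 + ennreal (1 - p) * f y a2 = ennreal (p * (c * t a1) + (1 - p) * (c * t a2))"
      unfolding f using p t by (simp add: c_def ennreal_mult[symmetric] ennreal_plus[symmetric] del: ennreal_plus)
    also have "p * (c * t a1) + (1 - p) * (c * t a2) = ?Q (z (y + 1)) (z y)"
      unfolding Qker_eq c_def[symmetric] t_def[symmetric] by (simp add: algebra_simps)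
    finally show "ennreal p * f y a1 + ennreal (1 - p) * f y a2 = ennreal (?Q (z (y + 1)) (z y))" .
  qed simp
  also have "\<dots> = (\<Prod>i<n. ennreal (?Q ((0 # l) ! i) (l ! i)))"
  proof (rule prod.reindex_bij_witness[of _ "\<lambda>i. int n - 1 - int i" "\<lambda>y. nat (int n - 1 - y)"])
    fix y assume y: "y \<in> {0..<int n}"
    define i where "i = nat (int n - 1 - y)"
    have yi: "y = int n - 1 - int i" "i < n" using y unfolding i_def by auto
    have "z y = l ! i" unfolding z_def using yi by simp
    moreover have "z (y + 1) = (0 # l) ! i"
    proof (cases i)
      case 0 then show ?thesis unfolding z_def using yi by simp
    next
      case (Suc k)
      then have "nat (int n - 1 - (y + 1)) = k" "y + 1 < int n" "0 \<le> y + 1" using yi by auto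
      then show ?thesis unfolding z_def using Suc by simp
    qed
    ultimately show "ennreal (?Q ((0 # l) ! nat (int n - 1 - y)) (l ! nat (int n - 1 - y))) = ennreal (?Q (z (y + 1)) (z y))"
      unfolding i_def[symmetric] by simp
  qed auto
  also have "\<dots> = ennreal (pmf (path_pmf Q_pmf n 0) l)"
    unfolding pmf_path_pmf pmf_Q_pmf using assms(1) less_imp_le[OF Qker_pos] by (simp add: prod_ennreal)
  finally show ?thesis .
qed

text \<open>Only an upper bound on the masses is available, but the walk hits \<open>n\<close> almost surely, so both sides
  have total mass \<open>1\<close>.\<close>

lemma distr_lvec: "distr Ann (count_space UNIV) (lvec n) = measure_pmf (path_pmf Q_pmf n 0)"
proof (rule measure_eq_pmf_if_singletons_le)
  interpret A: prob_space Ann by (rule prob_space_Ann)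
  have [measurable_cong]: "sets Ann = sets path_space" by (rule sets_Ann)
  have m: "lvec n \<in> measurable Ann (count_space UNIV)" by measurable
  show "prob_space (distr Ann (count_space UNIV) (lvec n))" using m by (rule A.prob_space_distr)
  show "emeasure (distr Ann (count_space UNIV) (lvec n)) {l} \<le> ennreal (pmf (path_pmf Q_pmf n 0) l)" for l
  proof (cases "length l = n")
    case False
    then have "lvec n -` {l} = {}" by (auto simp: lvec_eq_iff)
    then show ?thesis using m by (subst emeasure_distr) auto
  next
    case True
    define z where "z = (\<lambda>j. if 0 \<le> j \<and> j < int n then l ! nat (int n - 1 - j) else 0)"
    let ?E = "{X \<in> space path_space. lvec n X = l \<and> (\<exists>t. X t = int n)}"
    have E: "?E \<in> sets path_space" by measurable
    have "emeasure (distr Ann (count_space UNIV) (lvec n)) {l} = emeasure Ann (lvec n -` {l} \<inter> space Ann)"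
      using m by (rule emeasure_distr) simp
    also have "\<dots> = emeasure Ann ?E"
    proof (rule emeasure_eq_AE)
      show "AE X in Ann. (X \<in> lvec n -` {l} \<inter> space Ann) = (X \<in> ?E)"
        using AE_Ann_hits[of n] by eventually_elim simp
      show "lvec n -` {l} \<inter> space Ann \<in> sets Ann" using m by (rule measurable_sets) simp
    qed (use E sets_Ann in simp)
    also have "\<dots> = (\<integral>\<^sup>+\<omega>. emeasure (quenched \<omega>) ?E \<partial>Env)"
      by (rule emeasure_annealed[OF prob_space_nu sets_two_point E])
    also have "\<dots> \<le> (\<integral>\<^sup>+\<omega>. ennreal (lprob \<omega> (int n) z 0) \<partial>Env)"
    proof (rule nn_integral_mono)
      fix \<omega> assume \<omega>: "\<omega> \<in> space Env"
      show "emeasure (quenched \<omega>) ?E \<le> ennreal (lprob \<omega> (int n) z 0)"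
      proof (rule quenched_left_steps_le[OF _ _ E])
        fix X j assume X: "X \<in> ?E" "j < n"
        have i: "n - Suc j < n" "n - Suc (n - Suc j) = j" using X(2) by auto
        have "left_steps X n (n - Suc i) = l ! i" if "i < n" for i using X(1) that by (simp add: lvec_eq_iff)
        from this[OF i(1)] have "left_steps X n j = l ! (n - Suc j)" unfolding i(2) .
        moreover have "nat (int n - 1 - int j) = n - Suc j" by simp
        ultimately show "left_steps X n j = z (int j)" unfolding z_def using X by simp
      qed (use space_Env[OF \<omega>] in \<open>auto simp: z_def\<close>)
    qed
    also have "\<dots> = ennreal (pmf (path_pmf Q_pmf n 0) l)" unfolding z_def by (rule lprob_expectation[OF True])
    finally show ?thesis .
  qed
qed simp

lemma pi_pmf_stationary: "bind_pmf pi_pmf Q_pmf = pi_pmf"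
proof (rule pmf_eqI)
  fix v
  have "ennreal (pmf (bind_pmf pi_pmf Q_pmf) v) = (\<integral>\<^sup>+u. ennreal (pmf pi_pmf u) * ennreal (pmf (Q_pmf u) v) \<partial>count_space UNIV)"
    unfolding ennreal_pmf_bind nn_integral_measure_pmf ..
  also have "\<dots> = ennreal (pmf pi_pmf v)"
    unfolding nn_integral_count_space_nat pmf_pi_pmf pmf_Q_pmf by (rule pi_wt_stationary)
  finally show "pmf (bind_pmf pi_pmf Q_pmf) v = pmf pi_pmf v" by simp
qed

sublocale chain: stationary_positive_kernel Q_pmf pi_pmf
  by standard (simp_all add: pi_pmf_stationary pmf_pi_pmf pmf_Q_pmf pi_wt_pos Qker_pos)

end

section \<open>Likelihood and score\<close>

lemma pmf_sums_1: "pmf (q :: nat pmf) sums 1"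
proof -
  have "summable (pmf q)"
    using suminf_ennreal_pmf[of q] by (intro summable_suminf_not_top) auto
  moreover have "(\<Sum>v. pmf q v) = 1"
    using suminf_ennreal2[OF _ calculation] suminf_ennreal_pmf[of q] by simp
  ultimately show ?thesis by (metis summable_sums)
qed

definition mix_lik :: "real \<Rightarrow> real \<Rightarrow> real \<Rightarrow> nat \<Rightarrow> nat \<Rightarrow> real" where
  "mix_lik a1 a2 t u v = t * (a1 ^ (u + 1) * (1 - a1) ^ v) + (1 - t) * (a2 ^ (u + 1) * (1 - a2) ^ v)"

definition mix_score :: "real \<Rightarrow> real \<Rightarrow> real \<Rightarrow> nat \<Rightarrow> nat \<Rightarrow> real" where
  "mix_score a1 a2 t u v =
     (a1 ^ (u + 1) * (1 - a1) ^ v - a2 ^ (u + 1) * (1 - a2) ^ v) / mix_lik a1 a2 t u v"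

context
  fixes a1 a2 :: real
  assumes a: "0 < a1" "a1 < a2" "a2 < 1"
begin

lemma mix_lik_pos: "0 < t \<Longrightarrow> t < 1 \<Longrightarrow> 0 < mix_lik a1 a2 t u v"
  unfolding mix_lik_def using a by (intro add_pos_pos mult_pos_pos) auto

text \<open>Each weighted atom is at most the whole mixture: \<open>t * x \<le> D\<close> and
  \<open>(1 - t) * y \<le> D\<close>. The resulting bound does not depend on \<open>u\<close> and
  \<open>v\<close>; all moment conditions on the score come from it.\<close>

lemma mix_score_bounded:
  assumes "0 < t" "t < 1"
  shows "\<bar>mix_score a1 a2 t u v\<bar> \<le> 1 / t + 1 / (1 - t)"
proof -
  define x y where "x = a1 ^ (u + 1) * (1 - a1) ^ v" and "y = a2 ^ (u + 1) * (1 - a2) ^ v"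
  have xy: "0 < x" "0 < y" unfolding x_def y_def using a by simp_all
  have d: "0 < t * x + (1 - t) * y" using assms xy by (intro add_pos_pos mult_pos_pos) auto
  define D where "D = t * x + (1 - t) * y"
  have D: "0 < D" "t * x \<le> D" "(1 - t) * y \<le> D" unfolding D_def using d assms xy by auto
  then have 1: "x / (t * x + (1 - t) * y) \<le> 1 / t" "y / (t * x + (1 - t) * y) \<le> 1 / (1 - t)"
    unfolding D_def[symmetric] using assms by (simp_all add: pos_divide_le_eq pos_le_divide_eq mult.commute)
  have 2: "0 \<le> x / (t * x + (1 - t) * y)" "0 \<le> y / (t * x + (1 - t) * y)" using xy d by simp_all
  have "mix_score a1 a2 t u v = x / (t * x + (1 - t) * y) - y / (t * x + (1 - t) * y)"
    unfolding mix_score_def mix_lik_def x_def y_def by (rule diff_divide_distrib)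
  with 1 2 show ?thesis by linarith
qed

lemma phi_mix_lik: "0 < t \<Longrightarrow> t < 1 \<Longrightarrow> phi (two_point a1 a2 t) u v = ln (mix_lik a1 a2 t u v)"
  unfolding mix_lik_def using a by (intro phi_two_point) auto

lemma mix_lik_deriv: "((\<lambda>t. mix_lik a1 a2 t u v) has_real_derivative (a1 ^ (u + 1) * (1 - a1) ^ v - a2 ^ (u + 1) * (1 - a2) ^ v)) (at t)"
  unfolding mix_lik_def by (auto intro!: derivative_eq_intros)

lemma phi_deriv:
  assumes "0 < t" "t < 1"
  shows "((\<lambda>t. phi (two_point a1 a2 t) u v) has_real_derivative mix_score a1 a2 t u v) (at t)"
proof (rule has_field_derivative_transform_within_open[where S="{0<..<1}"])
  show "((\<lambda>t. ln (mix_lik a1 a2 t u v)) has_real_derivative mix_score a1 a2 t u v) (at t)"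
    unfolding mix_score_def using mix_lik_pos[OF assms, of u v] by (auto intro!: derivative_eq_intros mix_lik_deriv)
qed (use assms phi_mix_lik in auto)

lemma dphi_eq: "0 < t \<Longrightarrow> t < 1 \<Longrightarrow> dphi (two_point a1 a2) t u v = mix_score a1 a2 t u v"
  unfolding dphi_def by (intro DERIV_imp_deriv phi_deriv)

lemma dphi_deriv:
  assumes "0 < t" "t < 1"
  shows "((\<lambda>t. dphi (two_point a1 a2) t u v) has_real_derivative - (mix_score a1 a2 t u v)\<^sup>2) (at t)"
proof (rule has_field_derivative_transform_within_open[where S="{0<..<1}"])
  have "((\<lambda>t. mix_score a1 a2 t u v) has_real_derivative ((a1 ^ (u + 1) * (1 - a1) ^ v - a2 ^ (u + 1) * (1 - a2) ^ v) * - (a1 ^ (u + 1) * (1 - a1) ^ v - a2 ^ (u + 1) * (1 - a2) ^ v) / (mix_lik a1 a2 t u v * mix_lik a1 a2 t u v))) (at t)"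
    unfolding mix_score_def using mix_lik_pos[OF assms, of u v]
    by (auto intro!: derivative_eq_intros mix_lik_deriv simp: algebra_simps)
  also have "(a1 ^ (u + 1) * (1 - a1) ^ v - a2 ^ (u + 1) * (1 - a2) ^ v) * - (a1 ^ (u + 1) * (1 - a1) ^ v - a2 ^ (u + 1) * (1 - a2) ^ v) / (mix_lik a1 a2 t u v * mix_lik a1 a2 t u v) = - (mix_score a1 a2 t u v)\<^sup>2"
  proof -
    have "x * - x / (l * l) = - (x / l)\<^sup>2" for x l :: real by (simp add: power2_eq_square)
    then show ?thesis unfolding mix_score_def .
  qed
  finally show "((\<lambda>t. mix_score a1 a2 t u v) has_real_derivative - (mix_score a1 a2 t u v)\<^sup>2) (at t)" .
qed (use assms dphi_eq in auto)

lemma ddphi_eq: "0 < t \<Longrightarrow> t < 1 \<Longrightarrow> ddphi (two_point a1 a2) t u v = - (mix_score a1 a2 t u v)\<^sup>2"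
  unfolding ddphi_def by (intro DERIV_imp_deriv dphi_deriv)

lemma C2_phi:
  assumes "T \<subseteq> {0<..<1}"
  shows "C2_on T (\<lambda>t. phi (two_point a1 a2 t) u v)"
  unfolding C2_on_def
proof (intro exI[of _ "{0<..<1}"] conjI ballI assms)
  have dd: "deriv (\<lambda>t. phi (two_point a1 a2 t) u v) = (\<lambda>t. dphi (two_point a1 a2) t u v)"
    unfolding dphi_def[abs_def] ..
  fix t :: real assume t: "t \<in> {0<..<1}"
  show "(\<lambda>t. phi (two_point a1 a2 t) u v) differentiable at t"
    using t phi_deriv real_differentiable_def by (meson greaterThanLessThan_iff)
  show "deriv (\<lambda>t. phi (two_point a1 a2 t) u v) differentiable at t"
    unfolding dd using t dphi_deriv real_differentiable_def by (meson greaterThanLessThan_iff)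
next
  have "continuous_on {0<..<1} (\<lambda>t. - (mix_score a1 a2 t u v)\<^sup>2)"
  proof -
    have "\<forall>t\<in>{0<..<1}. t * (a1 ^ (u + 1) * (1 - a1) ^ v) + (1 - t) * (a2 ^ (u + 1) * (1 - a2) ^ v) \<noteq> 0"
      using mix_lik_pos[of _ u v] unfolding mix_lik_def by (metis greaterThanLessThan_iff less_irrefl)
    then show ?thesis unfolding mix_score_def mix_lik_def by (intro continuous_intros)
  qed
  moreover have "deriv (deriv (\<lambda>t. phi (two_point a1 a2 t) u v)) t = - (mix_score a1 a2 t u v)\<^sup>2" if "t \<in> {0<..<1}" for t
    using ddphi_eq[of t u v] that unfolding ddphi_def dphi_def[abs_def] by simp
  ultimately show "continuous_on {0<..<1} (deriv (deriv (\<lambda>t. phi (two_point a1 a2 t) u v)))"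
    by (subst continuous_on_cong[OF refl]) auto
qed simp

text \<open>Mixtures of the same two atoms with weights between \<open>c\<close> and
  \<open>1 - c\<close> are comparable: \<open>c\<close> times the first is at most \<open>c\<close>
  times the sum of the atoms, which is at most the second.\<close>

lemma phi_diff_bound:
  assumes "0 < c" and "\<And>t. t \<in> T \<Longrightarrow> c \<le> t \<and> t \<le> 1 - c" and st: "s \<in> T" "t \<in> T"
  shows "\<bar>phi (two_point a1 a2 s) u v - phi (two_point a1 a2 t) u v\<bar> \<le> ln (1 / c)"
proof -
  have *: "phi (two_point a1 a2 s) u v - phi (two_point a1 a2 t) u v \<le> ln (1 / c)" if st: "s \<in> T" "t \<in> T" for s t
  proof -
    have s: "0 < s" "s < 1" "c \<le> s" "c \<le> 1 - s" and t: "0 < t" "t < 1" "c \<le> t" "c \<le> 1 - t"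
      using assms(1) assms(2)[of s] assms(2)[of t] st by linarith+
    have ab: "0 \<le> a1 ^ (u + 1) * (1 - a1) ^ v" "0 \<le> a2 ^ (u + 1) * (1 - a2) ^ v" using a by simp_all
    have "c * mix_lik a1 a2 s u v \<le> c * (a1 ^ (u + 1) * (1 - a1) ^ v + a2 ^ (u + 1) * (1 - a2) ^ v)"
      unfolding mix_lik_def using s ab assms(1) by (intro mult_left_mono add_mono) (auto intro: mult_left_le_one_le)
    also have "\<dots> \<le> mix_lik a1 a2 t u v"
      unfolding mix_lik_def distrib_left using t ab by (intro add_mono mult_right_mono) auto
    finally have "mix_lik a1 a2 s u v / mix_lik a1 a2 t u v \<le> 1 / c"
      using mix_lik_pos[OF t(1,2), of u v] assms(1) by (simp add: field_simps)
    moreover have "0 < mix_lik a1 a2 s u v / mix_lik a1 a2 t u v" using mix_lik_pos s t by simp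
    ultimately have "ln (mix_lik a1 a2 s u v / mix_lik a1 a2 t u v) \<le> ln (1 / c)"
      using assms(1) by (subst ln_le_cancel_iff) auto
    then show ?thesis using mix_lik_pos[OF s(1,2), of u v] mix_lik_pos[OF t(1,2), of u v] s t by (simp add: phi_mix_lik ln_div)
  qed
  from *[OF st] *[OF st(2,1)] show ?thesis by linarith
qed

text \<open>The parameter is recovered as the mass of the point \<open>a1\<close>.\<close>

lemma two_point_inject:
  assumes "0 < s" "s < 1" "0 < t" "t < 1"
  shows "two_point a1 a2 s = two_point a1 a2 t \<longleftrightarrow> s = t"
proof
  assume eq: "two_point a1 a2 s = two_point a1 a2 t"
  have A: "{a1} \<in> sets unit_borel"
    using a unfolding unit_borel_def by (subst sets_restrict_space_iff) auto
  have "emeasure (two_point a1 a2 r) {a1} = ennreal r" for r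
    using a A by (subst emeasure_two_point) (auto simp: unit_borel_def space_restrict_space)
  then have "ennreal s = ennreal t" using eq by metis
  then show "s = t" using assms by simp
qed simp

text \<open>Both sides of the interchange are computed separately. The rows of \<open>Q\<close> sum
  to 1 throughout \<open>(0, 1)\<close>, so the derivative of the sum is 0; the derivatives of the
  terms are differences of two negative binomial masses and sum to \<open>1 - 1\<close>.\<close>

lemma Qker_derivative_sums:
  assumes \<theta>: "0 < \<theta>" "\<theta> < 1"
  shows "(\<forall>\<^sub>F t in nhds \<theta>. summable (Qker (two_point a1 a2 t) u)) \<and>
        (\<forall>v. (\<lambda>t. Qker (two_point a1 a2 t) u v) differentiable at \<theta>) \<and>
        (\<lambda>t. \<Sum>v. Qker (two_point a1 a2 t) u v) differentiable at \<theta> \<and>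
        (\<lambda>v. deriv (\<lambda>t. Qker (two_point a1 a2 t) u v) \<theta>) sums deriv (\<lambda>t. \<Sum>v. Qker (two_point a1 a2 t) u v) \<theta>"
proof -
  have sums1: "Qker (two_point a1 a2 t) u sums 1" if "t \<in> {0<..<1}" for t
  proof -
    interpret two_point_env a1 a2 t using a that by unfold_locales auto
    have "Qker (two_point a1 a2 t) u = pmf (Q_pmf u)" by (simp add: fun_eq_iff pmf_Q_pmf)
    then show ?thesis by (simp add: pmf_sums_1)
  qed
  have Q: "Qker (two_point a1 a2 t) u v = real ((u + v) choose v) * mix_lik a1 a2 t u v" if "t \<in> {0<..<1}" for t v
  proof -
    interpret two_point_env a1 a2 t using a that by unfold_locales auto
    show ?thesis unfolding Qker_eq mix_lik_def ..
  qed
  have ev: "\<forall>\<^sub>F t in nhds \<theta>. t \<in> {0<..<1}" using \<theta> by (intro eventually_nhds_in_open) auto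
  have dQ: "((\<lambda>t. Qker (two_point a1 a2 t) u v) has_real_derivative real ((u + v) choose v) * (a1 ^ (u + 1) * (1 - a1) ^ v - a2 ^ (u + 1) * (1 - a2) ^ v)) (at \<theta>)" for v
    by (rule has_field_derivative_transform_within_open[where S="{0<..<1}" and f="\<lambda>t. real ((u + v) choose v) * mix_lik a1 a2 t u v", OF DERIV_cmult[OF mix_lik_deriv]])
       (use \<theta> Q in auto)
  have dS: "((\<lambda>t. \<Sum>v. Qker (two_point a1 a2 t) u v) has_real_derivative 0) (at \<theta>)"
    by (rule has_field_derivative_transform_within_open[where S="{0<..<1}" and f="\<lambda>_. 1"])
       (use \<theta> sums1[THEN sums_unique] in auto)
  have nb: "(\<lambda>v. real ((u + v) choose v) * (x ^ (u + 1) * (1 - x) ^ v)) sums 1" if "0 < x" "x < 1" for x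
  proof -
    have "pmf (neg_binomial_pmf (Suc u) x) = (\<lambda>v. real ((u + v) choose v) * (x ^ (u + 1) * (1 - x) ^ v))"
      using that by (auto simp: fun_eq_iff pmf_neg_binomial add.commute)
    then show ?thesis using pmf_sums_1[of "neg_binomial_pmf (Suc u) x"] by simp
  qed
  have "(\<lambda>v. real ((u + v) choose v) * (a1 ^ (u + 1) * (1 - a1) ^ v) - real ((u + v) choose v) * (a2 ^ (u + 1) * (1 - a2) ^ v)) sums (1 - 1)"
    using a by (intro sums_diff nb) auto
  then have "(\<lambda>v. deriv (\<lambda>t. Qker (two_point a1 a2 t) u v) \<theta>) sums deriv (\<lambda>t. \<Sum>v. Qker (two_point a1 a2 t) u v) \<theta>"
    unfolding DERIV_imp_deriv[OF dQ] DERIV_imp_deriv[OF dS] by (simp add: right_diff_distrib)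
  moreover have "\<forall>\<^sub>F t in nhds \<theta>. summable (Qker (two_point a1 a2 t) u)"
    using ev by eventually_elim (use sums1 sums_summable in blast)
  moreover have "(\<lambda>t. Qker (two_point a1 a2 t) u v) differentiable at \<theta>" for v
    using dQ real_differentiable_def by blast
  moreover have "(\<lambda>t. \<Sum>v. Qker (two_point a1 a2 t) u v) differentiable at \<theta>"
    using dS real_differentiable_def by blast
  ultimately show ?thesis by blast
qed

lemma expectation_ln_rho:
  assumes p: "0 < p" "p < 1" and i: "integrable (env_law (two_point a1 a2 p)) (\<lambda>\<omega>. \<bar>ln (rho \<omega> 0)\<bar>)"
  shows "(\<integral>\<omega>. ln (rho \<omega> 0) \<partial>env_law (two_point a1 a2 p)) = p * ln ((1 - a1) / a1) + (1 - p) * ln ((1 - a2) / a2)"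
proof -
  interpret two_point_env a1 a2 p using a p by unfold_locales
  have m: "(\<lambda>\<omega>. ln (rho \<omega> 0)) \<in> borel_measurable Env" by measurable
  have i': "integrable Env (\<lambda>\<omega>. ln (rho \<omega> 0))"
    using i by (subst (asm) integrable_abs_iff[OF m])
  \<comment> \<open>The factor \<open>s\<close> will be 1 and -1, for the positive and the negative
    part of the integral; \<open>ennreal\<close> cuts negative values off at 0.\<close>
  have nn: "enn2real (\<integral>\<^sup>+\<omega>. ennreal (s * ln (rho \<omega> 0)) \<partial>Env)
      = p * max 0 (s * ln ((1 - a1) / a1)) + (1 - p) * max 0 (s * ln ((1 - a2) / a2))" for s
  proof -
    define x1 x2 where "x1 = max 0 (s * ln ((1 - a1) / a1))" and "x2 = max 0 (s * ln ((1 - a2) / a2))"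
    have x: "0 \<le> x1" "0 \<le> x2" unfolding x1_def x2_def by simp_all
    have "(\<integral>\<^sup>+\<omega>. ennreal (s * ln (rho \<omega> 0)) \<partial>Env)
      = ennreal p * ennreal (s * ln ((1 - a1) / a1)) + ennreal (1 - p) * ennreal (s * ln ((1 - a2) / a2))"
      using nn_integral_Env_prod[of "{0}" "\<lambda>_ x. ennreal (s * ln ((1 - x) / x))"] by (simp add: rho_def)
    also have "\<dots> = ennreal p * ennreal x1 + ennreal (1 - p) * ennreal x2"
      unfolding x1_def x2_def by (simp add: max_def ennreal_neg)
    also have "\<dots> = ennreal (p * x1 + (1 - p) * x2)"
      using p x by (simp add: ennreal_mult[symmetric] ennreal_plus[symmetric] del: ennreal_plus)
    finally have "enn2real (\<integral>\<^sup>+\<omega>. ennreal (s * ln (rho \<omega> 0)) \<partial>Env) = enn2real (ennreal (p * x1 + (1 - p) * x2))"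
      by (rule arg_cong)
    also have "\<dots> = p * x1 + (1 - p) * x2" using p x by (intro enn2real_ennreal add_nonneg_nonneg mult_nonneg_nonneg) auto
    finally show ?thesis unfolding x1_def x2_def .
  qed
  have "(\<integral>\<omega>. ln (rho \<omega> 0) \<partial>Env)
    = enn2real (\<integral>\<^sup>+\<omega>. ennreal (ln (rho \<omega> 0)) \<partial>Env) - enn2real (\<integral>\<^sup>+\<omega>. ennreal (- ln (rho \<omega> 0)) \<partial>Env)"
    by (rule real_lebesgue_integral_def[OF i'])
  also have "\<dots> = (p * max 0 (ln ((1 - a1) / a1)) + (1 - p) * max 0 (ln ((1 - a2) / a2)))
      - (p * max 0 (- ln ((1 - a1) / a1)) + (1 - p) * max 0 (- ln ((1 - a2) / a2)))"
    using nn[of 1] nn[of "- 1"] by simp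
  also have "\<dots> = p * (max 0 (ln ((1 - a1) / a1)) - max 0 (- ln ((1 - a1) / a1)))
      + (1 - p) * (max 0 (ln ((1 - a2) / a2)) - max 0 (- ln ((1 - a2) / a2)))"
    by (simp add: algebra_simps)
  also have "\<dots> = p * ln ((1 - a1) / a1) + (1 - p) * ln ((1 - a2) / a2)"
    by (simp add: max_def)
  finally show ?thesis .
qed

end

section \<open>Asymptotics of the estimator\<close>

lemma real_distribution_normal:
  assumes "0 < s"
  shows "real_distribution (density lborel (normal_density 0 s))"
  using prob_space_normal_density[OF assms, of 0]
  by (simp add: real_distribution_def real_distribution_axioms_def)

lemma char_normal:
  assumes s: "0 < s"
  shows "char (density lborel (normal_density 0 s)) t = complex_of_real (exp (- (t\<^sup>2 * s\<^sup>2 / 2)))"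
proof -
  let ?N = "density lborel (normal_density 0 s)"
  interpret N: prob_space ?N by (rule prob_space_normal_density[OF s])
  have "distr ?N lborel (\<lambda>x. x) = ?N"
    by (rule distr_id2) simp
  then have "distributed ?N lborel (\<lambda>x. x) (normal_density 0 s)"
    unfolding distributed_def by simp
  then have "distributed ?N lborel (\<lambda>x. (x - 0) / s) std_normal_density"
    by (subst (asm) N.normal_standard_normal_convert[OF s])
  then have d: "distr ?N lborel (\<lambda>x. x / s) = std_normal_distribution"
    unfolding distributed_def by simp
  have "char ?N t = (CLINT x|?N. iexp (t * s * (x / s)))"
    unfolding char_def using s by (intro Bochner_Integration.integral_cong) auto
  also have "\<dots> = (CLINT x|distr ?N lborel (\<lambda>x. x / s). iexp (t * s * x))"
    by (subst integral_distr) auto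
  also have "\<dots> = char std_normal_distribution (t * s)"
    unfolding d char_def ..
  also have "\<dots> = complex_of_real (exp (- (t\<^sup>2 * s\<^sup>2 / 2)))"
    unfolding char_std_normal_distribution by (simp add: power_mult_distrib)
  finally show ?thesis .
qed

text \<open>Read from the top site down, consecutive counts are the pairs
  \<open>(L (x + 1), L x)\<close>. This converts the sum over sites in the criterion into a sum over
  transitions of the chain.\<close>

lemma path_sum_rev_upt: "path_sum g (L n) (map L (rev [0..<n])) = (\<Sum>x<n. g (L (Suc x)) (L x))"
  by (induction n) (simp_all add: add.commute)

context transient_two_point_env
begin

abbreviation "lik \<equiv> mix_lik a1 a2"
abbreviation "score \<equiv> mix_score a1 a2"

lemma lik_ratio: "lik t u v / lik p u v = 1 + (t - p) * score p u v"
proof -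
  have "lik t u v = lik p u v + (t - p) * (a1 ^ (u + 1) * (1 - a1) ^ v - a2 ^ (u + 1) * (1 - a2) ^ v)"
    unfolding mix_lik_def by (simp add: algebra_simps)
  then show ?thesis using mix_lik_pos[OF a p, of u v] unfolding mix_score_def by (simp add: field_simps)
qed

lemma phi_diff:
  assumes "0 < t" "t < 1"
  shows "phi (two_point a1 a2 t) u v - phi Nu u v = ln (1 + (t - p) * score p u v)"
    and "0 < 1 + (t - p) * score p u v"
  using assms p mix_lik_pos[OF a assms, of u v] mix_lik_pos[OF a p, of u v]
  by (simp_all add: phi_mix_lik[OF a] lik_ratio[symmetric] ln_div)

text \<open>This is \<open>Sigma_info\<close> at \<open>p\<close>, written as an iterated
  expectation, the form in which the limit theorems for the chain deliver it; the final proof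
  identifies the two.\<close>

definition fisher :: real where
  "fisher = expect pi_pmf (\<lambda>u. expect (Q_pmf u) (\<lambda>v. (score p u v)\<^sup>2))"

text \<open>The mixture cancels in the product of \<open>Q\<close> and the score and leaves the
  difference of two negative binomial masses, each of total 1. This makes the score sum a
  martingale.\<close>

lemma score_centered: "expect (Q_pmf u) (score p u) = 0"
proof -
  have sc: "pmf (Q_pmf u) v * score p u v = pmf (neg_binomial_pmf (Suc u) a1) v - pmf (neg_binomial_pmf (Suc u) a2) v" for v
  proof -
    have "pmf (Q_pmf u) v = real ((u + v) choose v) * lik p u v"
      unfolding pmf_Q_pmf Qker_eq mix_lik_def ..
    moreover have "pmf (neg_binomial_pmf (Suc u) x) v = real ((u + v) choose v) * (x ^ (u + 1) * (1 - x) ^ v)"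
      if "0 < x" "x < 1" for x using that by (subst pmf_neg_binomial) (auto simp: add.commute)
    moreover have alg: "c * l * ((x - y) / l) = c * x - c * y" if "0 < l" for c l x y :: real
      using that by (simp add: field_simps)
    ultimately show ?thesis
      using a unfolding mix_score_def by (simp only: alg[OF mix_lik_pos[OF a p]])
  qed
  have "(\<lambda>v. pmf (Q_pmf u) v * score p u v) sums (1 - 1)"
    unfolding sc by (intro sums_diff pmf_sums_1)
  moreover have "(\<lambda>v. pmf (Q_pmf u) v * score p u v) sums expect (Q_pmf u) (score p u)"
  proof -
    have "integrable (Q_pmf u) (score p u)"
      using mix_score_bounded[OF a p] by (intro integrable_pmf_bounded) auto
    then have "integrable (count_space UNIV) (\<lambda>v. pmf (Q_pmf u) v * score p u v)"
      unfolding measure_pmf_eq_density by (subst (asm) integrable_density) auto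
    from sums_integral_count_space_nat[OF this]
    show ?thesis unfolding measure_pmf_eq_density by (subst integral_density) auto
  qed
  ultimately have "1 - 1 = expect (Q_pmf u) (score p u)" by (rule sums_unique2)
  then show ?thesis by simp
qed

definition score_bound :: real where "score_bound = 1 / p + 1 / (1 - p)"

lemma score_le_score_bound: "\<bar>score p u v\<bar> \<le> score_bound"
  unfolding score_bound_def by (rule mix_score_bounded[OF a p])

lemma score_bound_pos: "0 < score_bound"
  unfolding score_bound_def using p by (intro add_pos_pos) auto

lemma score_sq_le: "\<bar>(score p u v)\<^sup>2\<bar> \<le> score_bound\<^sup>2"
  using score_le_score_bound[of u v] score_bound_pos by (simp add: abs_le_square_iff[symmetric])

text \<open>A single pair suffices: at \<open>(0, 0)\<close> the numerator of the score is
  \<open>a1 - a2\<close>, and this pair has positive weight.\<close>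

lemma fisher_pos: "0 < fisher"
proof -
  have "score p 0 0 \<noteq> 0" unfolding mix_score_def using a mix_lik_pos[OF a p, of 0 0] by simp
  then have s: "0 < (score p 0 0)\<^sup>2" by simp
  let ?h = "\<lambda>u. expect (Q_pmf u) (\<lambda>v. (score p u v)\<^sup>2)"
  have "pmf (Q_pmf 0) 0 * (score p 0 0)\<^sup>2 \<le> ?h 0"
    using score_sq_le by (intro pmf_times_le_expectation[where B="score_bound\<^sup>2"]) auto
  then have "0 < ?h 0" using s chain.K_pos[of 0 0] by (metis less_le_trans mult_pos_pos)
  moreover have "pmf pi_pmf 0 * ?h 0 \<le> fisher"
    unfolding fisher_def using score_sq_le
    by (intro pmf_times_le_expectation[where B="score_bound\<^sup>2"] expectation_le[where C="score_bound\<^sup>2"]) auto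
  ultimately show ?thesis using chain.\<mu>_pos[of 0] by (metis less_le_trans mult_pos_pos)
qed

definition score_sum :: "nat \<Rightarrow> (nat \<Rightarrow> int) \<Rightarrow> real" where "score_sum n X = path_sum (score p) 0 (lvec n X)"
definition info_sum :: "nat \<Rightarrow> (nat \<Rightarrow> int) \<Rightarrow> real" where "info_sum n X = path_sum (\<lambda>u v. (score p u v)\<^sup>2) 0 (lvec n X)"

text \<open>Before hitting \<open>n\<close> the walk is not at \<open>n\<close>, so no left step
  from there is counted. The pair of counts at the top site thus begins with 0, the initial state of
  the chain.\<close>

lemma AE_left_steps_top: "AE X in Ann. hit_time X n < \<infinity> \<and> left_steps X n n = 0"
  using AE_Ann_hits[of n]
proof eventually_elim
  case (elim X)
  have "(\<lambda>t. of_bool (X t = int n \<and> X (t + 1) = int n - 1) :: nat) t = 0" if "enat t < hit_time X n" for t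
    using that unfolding less_hit_time_iff by auto
  then have "left_steps X n n = 0" unfolding left_steps_def by (intro sum.neutral) auto
  with elim show ?case unfolding hit_time_finite_iff by blast
qed

lemma path_sum_lvec:
  assumes "left_steps X n n = 0"
  shows "path_sum g 0 (lvec n X) = (\<Sum>x<n. g (left_steps X n (x + 1)) (left_steps X n x))"
  using path_sum_rev_upt[of g "left_steps X n" n] assms unfolding lvec_def by simp

lemma expectation_Ann_lvec:
  fixes f :: "nat list \<Rightarrow> 'b::{banach, second_countable_topology}"
  shows "(\<integral>X. f (lvec n X) \<partial>Ann) = expect (path_pmf Q_pmf n 0) f"
  unfolding distr_lvec[symmetric]
  by (rule integral_distr[symmetric]) (use measurable_lvec sets_Ann in \<open>simp_all cong: measurable_cong_sets\<close>)

lemma measurable_Ann_lvec: "(\<lambda>X. f (lvec n X)) \<in> borel_measurable Ann"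
proof -
  have "lvec n \<in> measurable Ann (count_space UNIV)"
    using measurable_lvec sets_Ann by (simp cong: measurable_cong_sets)
  then show ?thesis by (rule measurable_compose) simp
qed

lemma measurable_score_sum [measurable]: "score_sum n \<in> borel_measurable Ann" "info_sum n \<in> borel_measurable Ann"
  unfolding score_sum_def[abs_def] info_sum_def[abs_def] by (rule measurable_Ann_lvec)+

lemma score_sum_bounded: "\<bar>score_sum n X\<bar> \<le> real n * score_bound" "\<bar>info_sum n X\<bar> \<le> real n * score_bound\<^sup>2"
  using path_sum_bounded[of "score p" score_bound 0 "lvec n X", OF score_le_score_bound]
    path_sum_bounded[of "\<lambda>u v. (score p u v)\<^sup>2" "score_bound\<^sup>2" 0 "lvec n X", OF score_sq_le]
  unfolding score_sum_def info_sum_def by simp_all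

lemma integrable_Ann_bounded:
  fixes f :: "(nat \<Rightarrow> int) \<Rightarrow> real"
  assumes "f \<in> borel_measurable Ann" "\<And>X. \<bar>f X\<bar> \<le> B"
  shows "integrable Ann f"
proof -
  interpret A: prob_space Ann by (rule prob_space_Ann)
  show ?thesis using assms by (intro A.integrable_const_bound[where B=B]) auto
qed

lemma Ann_concentration:
  assumes "0 < e"
  shows "(\<lambda>n. measure Ann {X \<in> space Ann. e \<le> \<bar>score_sum n X / real n\<bar>}) \<longlonglongrightarrow> 0"
    and "(\<lambda>n. measure Ann {X \<in> space Ann. e \<le> \<bar>info_sum n X / real n - fisher\<bar>}) \<longlonglongrightarrow> 0"
proof -
  have gen: "(\<lambda>n. measure Ann {X \<in> space Ann. e \<le> \<bar>path_sum g 0 (lvec n X) / real n - c\<bar>}) \<longlonglongrightarrow> 0"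
    if g: "\<And>u v. \<bar>g u v\<bar> \<le> B" and c: "c = expect pi_pmf (\<lambda>u. expect (Q_pmf u) (g u))" for g B c
  proof (rule tendsto_sandwich[OF _ _ tendsto_const])
    let ?E = "\<lambda>n. expect (path_pmf Q_pmf n 0) (\<lambda>l. \<bar>path_sum g 0 l / real n - c\<bar>)"
    have "?E \<longlonglongrightarrow> 0" by (rule chain.lln_abs[OF g c])
    from tendsto_divide[OF this tendsto_const[of e]] assms show "(\<lambda>n. ?E n / e) \<longlonglongrightarrow> 0" by simp
    show "\<forall>\<^sub>F n in sequentially. measure Ann {X \<in> space Ann. e \<le> \<bar>path_sum g 0 (lvec n X) / real n - c\<bar>} \<le> ?E n / e"
    proof (intro always_eventually allI)
      fix n
      let ?f = "\<lambda>X. \<bar>path_sum g 0 (lvec n X) / real n - c\<bar>"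
      have B: "0 \<le> B" using g[of 0 0] by linarith
      have r: "\<bar>path_sum g 0 (lvec n X) / real n\<bar> \<le> B" for X
        using path_sum_bounded[of g B 0 "lvec n X", OF g] B by (cases "n = 0") (auto simp: field_simps)
      have b: "\<bar>?f X\<bar> \<le> B + \<bar>c\<bar>" for X
        using r[of X] abs_triangle_ineq4[of "path_sum g 0 (lvec n X) / real n" c] by simp
      have m: "?f \<in> borel_measurable Ann"
        by (rule measurable_Ann_lvec[where f="\<lambda>l. \<bar>path_sum g 0 l / real n - c\<bar>"])
      have "measure Ann {X \<in> space Ann. e \<le> ?f X} \<le> (\<integral>X. ?f X \<partial>Ann) / e"
        using integrable_Ann_bounded[OF m b] assms by (intro integral_Markov_inequality_measure[where A="{}"]) auto
      then show "measure Ann {X \<in> space Ann. e \<le> ?f X} \<le> ?E n / e"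
        using expectation_Ann_lvec[where f="\<lambda>l. \<bar>path_sum g 0 l / real n - c\<bar>" and n=n] by simp
    qed
  qed simp
  show "(\<lambda>n. measure Ann {X \<in> space Ann. e \<le> \<bar>info_sum n X / real n - fisher\<bar>}) \<longlonglongrightarrow> 0"
    unfolding info_sum_def by (rule gen[OF score_sq_le]) (simp add: fisher_def)
  show "(\<lambda>n. measure Ann {X \<in> space Ann. e \<le> \<bar>score_sum n X / real n\<bar>}) \<longlonglongrightarrow> 0"
    using gen[of "score p" score_bound 0, OF score_le_score_bound] unfolding score_sum_def by (simp add: score_centered)
qed

text \<open>The threshold for the score is tuned to the localization of the maximizer: if the
  normalized information is at least \<open>fisher / 2\<close>, then \<open>e * fisher / 8\<close>
  is at most \<open>e / 4\<close> times that information.\<close>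

definition bad :: "real \<Rightarrow> nat \<Rightarrow> (nat \<Rightarrow> int) set" where
  "bad e n = {X \<in> space Ann. e * fisher / 8 \<le> \<bar>score_sum n X / real n\<bar>} \<union> {X \<in> space Ann. e \<le> \<bar>info_sum n X / real n - fisher\<bar>}"

lemma sets_bad: "bad e n \<in> sets Ann"
  unfolding bad_def by measurable

lemma bad_tendsto_0:
  assumes "0 < e"
  shows "(\<lambda>n. measure Ann (bad e n)) \<longlonglongrightarrow> 0"
proof (rule tendsto_sandwich[OF _ _ tendsto_const])
  let ?A = "\<lambda>n. {X \<in> space Ann. e * fisher / 8 \<le> \<bar>score_sum n X / real n\<bar>}"
  let ?B = "\<lambda>n. {X \<in> space Ann. e \<le> \<bar>info_sum n X / real n - fisher\<bar>}"
  interpret A: prob_space Ann by (rule prob_space_Ann)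
  have "0 < e * fisher / 8" using assms fisher_pos by simp
  from tendsto_add[OF Ann_concentration(1)[OF this] Ann_concentration(2)[OF assms]]
  show "(\<lambda>n. measure Ann (?A n) + measure Ann (?B n)) \<longlonglongrightarrow> 0" by simp
  have "?A n \<in> sets Ann" "?B n \<in> sets Ann" for n by measurable
  then show "\<forall>\<^sub>F n in sequentially. measure Ann (bad e n) \<le> measure Ann (?A n) + measure Ann (?B n)"
    unfolding bad_def by (intro always_eventually allI measure_subadditive) auto
qed simp

end

text \<open>The radius \<open>e0\<close> has four uses: the interval around \<open>p\<close> lies in
  \<Theta>, so a maximizer close to \<open>p\<close> is a critical point; the ratios
  \<open>1 + h * x\<close> stay at least 1/2; the error of the linearization can be absorbed; and
  off the bad event the normalized information is at least half of \<open>fisher\<close>.\<close>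

locale two_point_mle = transient_two_point_env +
  fixes \<Theta> :: "real set" and \<theta>0 e0 :: real and est :: "nat \<Rightarrow> (nat \<Rightarrow> int) \<Rightarrow> real"
  assumes \<Theta>: "\<Theta> \<subseteq> {0<..<1}"
    and e0: "0 < e0" "{p - e0<..<p + e0} \<subseteq> \<Theta>" "e0 * score_bound \<le> 1 / 2" "e0 * (1 + 2 * score_bound ^ 3) \<le> fisher / 2" "e0 \<le> fisher / 2"
    and est_measurable: "\<And>n. est n \<in> borel_measurable path_space"
    and est_max: "\<And>n. AE X in Ann. hit_time X n < \<infinity> \<longrightarrow>
          is_arg_max (criterion (two_point a1 a2) \<theta>0 n X) (\<lambda>\<theta>. \<theta> \<in> \<Theta>) (est n X)"
begin

lemma est_measurable_Ann [measurable]: "est n \<in> borel_measurable Ann"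
  using est_measurable sets_Ann by (simp cong: measurable_cong_sets)

text \<open>Off the bad event, comparison with the value at \<open>p\<close> puts the estimator
  within \<open>e\<close> of \<open>p\<close>. There it is an interior local maximum, and the
  vanishing derivative is the score equation behind the second bound.\<close>

lemma AE_est:
  assumes e: "0 < e" "e \<le> e0" and n: "0 < n"
  shows "AE X in Ann. X \<notin> bad e n \<longrightarrow> \<bar>est n X - p\<bar> < e \<and>
    \<bar>(est n X - p) * info_sum n X - score_sum n X\<bar> \<le> 2 * real n * score_bound ^ 3 * (est n X - p)\<^sup>2"
  using est_max[of n] AE_left_steps_top[of n]
proof eventually_elim
  case (elim X)
  show ?case
  proof
    assume good: "X \<notin> bad e n"
    define x where "x k = score p (left_steps X n (k + 1)) (left_steps X n k)" for k
    define h where "h = est n X - p"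
    have S: "score_sum n X = (\<Sum>k<n. x k)" and V: "info_sum n X = (\<Sum>k<n. (x k)\<^sup>2)"
      unfolding score_sum_def info_sum_def x_def using elim(2) by (simp_all add: path_sum_lvec)
    have xM: "\<bar>x k\<bar> \<le> score_bound" for k unfolding x_def by (rule score_le_score_bound)
    \<comment> \<open>The reference parameter \<open>\<theta>0\<close> cancels in the
      difference.\<close>
    have crit: "criterion (two_point a1 a2) \<theta>0 n X t - criterion (two_point a1 a2) \<theta>0 n X p = (\<Sum>k<n. ln (1 + (t - p) * x k))"
      if "t \<in> \<Theta>" for t
    proof -
      have "0 < t" "t < 1" using \<Theta> that by auto
      from phi_diff(1)[OF this] show ?thesis
        unfolding criterion_def x_def sum_subtractf[symmetric] by simp
    qed
    have pos: "0 < 1 + (t - p) * x k" if "t \<in> \<Theta>" for t k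
    proof -
      have "0 < t" "t < 1" using \<Theta> that by auto
      from phi_diff(2)[OF this] show ?thesis unfolding x_def .
    qed
    have p\<Theta>: "p \<in> \<Theta>" using e0 by auto
    have est: "est n X \<in> \<Theta>" and max: "\<And>t. t \<in> \<Theta> \<Longrightarrow>
        criterion (two_point a1 a2) \<theta>0 n X t \<le> criterion (two_point a1 a2) \<theta>0 n X (est n X)"
      using elim unfolding is_arg_max_def by (auto simp: not_less)
    have good1: "\<bar>score_sum n X / real n\<bar> < e * fisher / 8" and good2: "\<bar>info_sum n X / real n - fisher\<bar> < e"
      using good unfolding bad_def by auto
    have "fisher / 2 \<le> info_sum n X / real n" using good2 e e0 by linarith
    then have V2: "real n * (fisher / 2) \<le> info_sum n X" using n by (simp add: field_simps)
    have S2: "\<bar>score_sum n X\<bar> < real n * (e * fisher / 8)" using good1 n by (simp add: abs_divide field_simps)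
    have h: "\<bar>h\<bar> < e"
    proof (rule loglik_argmax_localized[where N="{..<n}" and x=x and M=score_bound])
      show "{..<n} \<noteq> {}" using n by auto
      show "e * score_bound \<le> 1 / 2" using e e0(3) score_bound_pos mult_right_mono[of e e0 score_bound] by linarith
      show "0 < 1 + h * x k" for k unfolding h_def by (rule pos[OF est])
      show "0 \<le> (\<Sum>k<n. ln (1 + h * x k))" using crit[OF est] max[OF p\<Theta>] unfolding h_def by simp
      have "\<bar>\<Sum>k<n. x k\<bar> < e / 4 * (real n * (fisher / 2))" using S2 unfolding S by (simp add: field_simps)
      also have "\<dots> \<le> e / 4 * info_sum n X" using V2 e by (intro mult_left_mono) auto
      finally show "\<bar>\<Sum>k<n. x k\<bar> < e / 4 * (\<Sum>k<n. (x k)\<^sup>2)" unfolding V .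
    qed (use e xM in auto)
    define F where "F t = (\<Sum>k<n. ln (1 + t * x k))" for t
    have in\<Theta>: "p + t \<in> \<Theta>" if "\<bar>t\<bar> < e0" for t using that e0(2) by (auto simp: abs_less_iff)
    have "(F has_real_derivative (\<Sum>k<n. x k / (1 + h * x k))) (at h)"
      unfolding F_def using pos[OF est]
      by (auto intro!: derivative_eq_intros sum.cong simp: h_def)
    \<comment> \<open>The ball around \<open>h\<close> of radius \<open>e - \<bar>h\<bar>\<close>
      stays within distance \<open>e \<le> e0\<close> of 0, so \<open>p + t\<close> remains in
      \<Theta>.\<close>
    moreover have "F t \<le> F h" if "\<bar>h - t\<bar> < e - \<bar>h\<bar>" for t
    proof -
      have "\<bar>t\<bar> < e0" using that e by linarith
      from in\<Theta>[OF this] max crit[OF est] crit[of "p + t"] show ?thesis unfolding F_def h_def by fastforce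
    qed
    ultimately have root: "(\<Sum>k<n. x k / (1 + h * x k)) = 0"
      using h by (intro DERIV_local_max[of F _ h "e - \<bar>h\<bar>"]) auto
    have "\<bar>h\<bar> * score_bound \<le> e0 * score_bound" using h e score_bound_pos by (intro mult_right_mono) auto
    then have "\<bar>h * (\<Sum>k<n. (x k)\<^sup>2) - (\<Sum>k<n. x k)\<bar> \<le> 2 * real (card {..<n}) * score_bound ^ 3 * h\<^sup>2"
      using e0(3) xM by (intro score_root_expansion[OF _ _ _ root]) auto
    with h show "\<bar>est n X - p\<bar> < e \<and>
        \<bar>(est n X - p) * info_sum n X - score_sum n X\<bar> \<le> 2 * real n * score_bound ^ 3 * (est n X - p)\<^sup>2"
      unfolding h_def S V by simp
  qed
qed

lemma consistent: "tendsto_in_prob Ann est p"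
  unfolding tendsto_in_prob_def
proof (intro allI impI)
  fix \<epsilon> :: real assume \<epsilon>: "0 < \<epsilon>"
  interpret A: prob_space Ann by (rule prob_space_Ann)
  define e where "e = min \<epsilon> e0"
  have e: "0 < e" "e \<le> e0" "e \<le> \<epsilon>" using \<epsilon> e0 unfolding e_def by auto
  show "(\<lambda>n. measure Ann {X \<in> space Ann. \<epsilon> < \<bar>est n X - p\<bar>}) \<longlonglongrightarrow> 0"
  proof (rule tendsto_sandwich[OF _ _ tendsto_const bad_tendsto_0[OF e(1)]])
    show "\<forall>\<^sub>F n in sequentially. measure Ann {X \<in> space Ann. \<epsilon> < \<bar>est n X - p\<bar>} \<le> measure Ann (bad e n)"
      using eventually_gt_at_top[of 0]
    proof eventually_elim
      case (elim n)
      show ?case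
      proof (rule A.finite_measure_mono_AE[OF _ sets_bad])
        show "AE X in Ann. X \<in> {X \<in> space Ann. \<epsilon> < \<bar>est n X - p\<bar>} \<longrightarrow> X \<in> bad e n"
          using AE_est[OF e(1,2) elim] by eventually_elim (use e in auto)
      qed
    qed
  qed simp
qed

definition lin_const :: real where "lin_const = 2 * (1 + 2 * score_bound ^ 3) / fisher\<^sup>2"

text \<open>Slutsky's argument on characteristic functions: off the bad event, the normalized error and the
  normalized score differ by at most \<open>e\<close> times a tight sequence.\<close>

lemma char_difference:
  assumes e: "0 < e" "e \<le> e0" and n: "0 < n"
  shows "norm ((\<integral>X. iexp (t * (sqrt (real n) * (est n X - p))) \<partial>Ann)
      - (\<integral>X. iexp (t * (score_sum n X / (sqrt (real n) * fisher))) \<partial>Ann))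
    \<le> 2 * measure Ann (bad e n) + \<bar>t\<bar> * lin_const * (1 + score_bound\<^sup>2) * e"
proof -
  interpret A: prob_space Ann by (rule prob_space_Ann)
  let ?f = "\<lambda>X. iexp (t * (sqrt (real n) * (est n X - p)))"
  let ?g = "\<lambda>X. iexp (t * (score_sum n X / (sqrt (real n) * fisher)))"
  have f: "integrable Ann ?f" by (intro A.integrable_const_bound[where B=1]) auto
  have g: "integrable Ann ?g" by (intro A.integrable_const_bound[where B=1]) auto
  have C0: "0 \<le> lin_const" unfolding lin_const_def using score_bound_pos by (simp add: add_nonneg_nonneg)
  \<comment> \<open>By \<open>s \<le> 1 + s\<^sup>2\<close> this dominates the absolute normalized
    score, and its mean is at most \<open>1 + score_bound\<^sup>2\<close> by orthogonality of the
    increments. The second moment provides the tightness.\<close>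
  let ?T = "\<lambda>X. 1 + (score_sum n X)\<^sup>2 / real n"
  have S2: "\<bar>(score_sum n X)\<^sup>2\<bar> \<le> (real n * score_bound)\<^sup>2" for X
    using score_sum_bounded(1)[of n X] score_bound_pos abs_le_square_iff[of "score_sum n X" "real n * score_bound"] by simp
  have iS: "integrable Ann (\<lambda>X. (score_sum n X)\<^sup>2)" by (rule integrable_Ann_bounded[OF _ S2]) measurable
  have ES: "(\<integral>X. (score_sum n X)\<^sup>2 \<partial>Ann) \<le> real n * score_bound\<^sup>2"
    unfolding score_sum_def expectation_Ann_lvec[where f="\<lambda>l. (path_sum (score p) 0 l)\<^sup>2"]
    by (rule expectation_path_sum_sq_centered[OF score_le_score_bound score_centered])
  have ib: "integrable Ann (\<lambda>X. indicator (bad e n) X :: real)" using sets_bad by (intro integrable_real_indicator) (auto simp: A.emeasure_eq_measure)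
  have "norm ((\<integral>X. ?f X \<partial>Ann) - (\<integral>X. ?g X \<partial>Ann)) = norm (\<integral>X. ?f X - ?g X \<partial>Ann)" using f g by simp
  also have "\<dots> \<le> (\<integral>X. norm (?f X - ?g X) \<partial>Ann)" by (rule integral_norm_bound)
  also have "\<dots> \<le> (\<integral>X. 2 * indicator (bad e n) X + \<bar>t\<bar> * lin_const * e * ?T X \<partial>Ann)"
  proof (rule integral_mono_AE)
    show "integrable Ann (\<lambda>X. norm (?f X - ?g X))" using f g by auto
    show "integrable Ann (\<lambda>X. 2 * indicator (bad e n) X + \<bar>t\<bar> * lin_const * e * ?T X)"
      using iS ib by simp
    show "AE X in Ann. norm (?f X - ?g X) \<le> 2 * indicator (bad e n) X + \<bar>t\<bar> * lin_const * e * ?T X"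
      using AE_est[OF e n]
    proof eventually_elim
      case (elim X)
      have T0: "0 \<le> \<bar>t\<bar> * lin_const * e * ?T X" using C0 e by simp
      show ?case
      proof (cases "X \<in> bad e n")
        case True
        have "norm (?f X - ?g X) \<le> norm (?f X) + norm (?g X)" by (rule norm_triangle_ineq4)
        then show ?thesis using True T0 by simp
      next
        case False
        then have h: "\<bar>est n X - p\<bar> < e" and r: "\<bar>(est n X - p) * info_sum n X - score_sum n X\<bar> \<le> 2 * real n * score_bound ^ 3 * (est n X - p)\<^sup>2"
          and v: "\<bar>info_sum n X / real n - fisher\<bar> < e"
          using elim unfolding bad_def by auto
        define y where "y = sqrt (real n) * (est n X - p)"
        define z where "z = score_sum n X / (sqrt (real n) * fisher)"
        have "\<bar>y - z\<bar> \<le> 2 * (1 + 2 * score_bound ^ 3) / fisher\<^sup>2 * e * (\<bar>score_sum n X\<bar> / sqrt (real n))"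
          unfolding y_def z_def
        proof (rule argmax_linearization)
          have "e * (1 + 2 * score_bound ^ 3) \<le> e0 * (1 + 2 * score_bound ^ 3)" using e score_bound_pos by (intro mult_right_mono) (auto intro: add_nonneg_nonneg)
          then show "e * (1 + 2 * score_bound ^ 3) \<le> fisher / 2" using e0(4) by linarith
        qed (use n fisher_pos score_bound_pos v h r in auto)
        also have "\<dots> = lin_const * e * (\<bar>score_sum n X\<bar> / sqrt (real n))" unfolding lin_const_def ..
        also have "\<dots> \<le> lin_const * e * ?T X"
        proof (intro mult_left_mono)
          have "s \<le> 1 + s\<^sup>2" for s :: real
          proof -
            have "0 \<le> (s - 1 / 2)\<^sup>2" by simp
            then show ?thesis by (simp add: power2_eq_square algebra_simps)
          qed
          from this[of "\<bar>score_sum n X\<bar> / sqrt (real n)"] show "\<bar>score_sum n X\<bar> / sqrt (real n) \<le> ?T X"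
            by (simp add: power_divide)
        qed (use C0 e in auto)
        finally have yz: "\<bar>y - z\<bar> \<le> lin_const * e * ?T X" .
        have "norm (?f X - ?g X) = norm (iexp (t * y) - iexp (t * z))"
          unfolding y_def z_def by (rule refl)
        also have "iexp (t * y) = iexp (t * z) * iexp (t * (y - z))"
          by (simp add: exp_add[symmetric] algebra_simps)
        also have "iexp (t * z) * iexp (t * (y - z)) - iexp (t * z) = iexp (t * z) * (iexp (t * (y - z)) - 1)"
          by (simp only: right_diff_distrib mult_1_right)
        also have "norm (iexp (t * z) * (iexp (t * (y - z)) - 1)) = norm (iexp (t * (y - z)) - 1)"
          by (simp add: norm_mult)
        also have "\<dots> \<le> \<bar>t * (y - z)\<bar>" using iexp_approx1[of "t * (y - z)" 0] by simp
        also have "\<dots> \<le> \<bar>t\<bar> * (lin_const * e * ?T X)" unfolding abs_mult[of t] by (intro mult_left_mono yz) simp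
        finally show ?thesis using False by (simp add: mult.assoc)
      qed
    qed
  qed
  also have "\<dots> = 2 * measure Ann (bad e n) + \<bar>t\<bar> * lin_const * e * (1 + (\<integral>X. (score_sum n X)\<^sup>2 \<partial>Ann) / real n)"
    using iS ib sets_bad A.prob_space by simp
  also have "\<dots> \<le> 2 * measure Ann (bad e n) + \<bar>t\<bar> * lin_const * e * (1 + score_bound\<^sup>2)"
    using ES n C0 e by (intro add_left_mono mult_left_mono) (auto simp: field_simps)
  finally show ?thesis by (simp add: ac_simps)
qed

lemma char_est_tendsto:
  "(\<lambda>n. \<integral>X. iexp (t * (sqrt (real n) * (est n X - p))) \<partial>Ann)
    \<longlonglongrightarrow> complex_of_real (exp (- (t\<^sup>2 * inverse fisher / 2)))"
proof -
  let ?f = "\<lambda>n. \<integral>X. iexp (t * (sqrt (real n) * (est n X - p))) \<partial>Ann"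
  let ?g = "\<lambda>n. \<integral>X. iexp (t * (score_sum n X / (sqrt (real n) * fisher))) \<partial>Ann"
  have C0: "0 \<le> lin_const" unfolding lin_const_def using score_bound_pos by (simp add: add_nonneg_nonneg)
  have "(\<lambda>n. ?f n - ?g n) \<longlonglongrightarrow> 0"
  proof (rule LIMSEQ_I)
    fix r :: real assume r: "0 < r"
    \<comment> \<open>The added 1 keeps \<open>B\<close> positive even for
      \<open>t = 0\<close>.\<close>
    define B where "B = \<bar>t\<bar> * lin_const * (1 + score_bound\<^sup>2) + 1"
    have B: "0 < B" unfolding B_def using C0 by (intro add_nonneg_pos) auto
    define e where "e = min e0 (r / (2 * B))"
    have e: "0 < e" "e \<le> e0" unfolding e_def using e0 r B by auto
    have "e * B \<le> r / 2" unfolding e_def using B r by (simp add: min_def field_simps)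
    moreover have "\<bar>t\<bar> * lin_const * (1 + score_bound\<^sup>2) * e \<le> e * B" unfolding B_def using e by (simp add: algebra_simps)
    ultimately have eB: "\<bar>t\<bar> * lin_const * (1 + score_bound\<^sup>2) * e \<le> r / 2" by linarith
    have "\<forall>\<^sub>F n in sequentially. measure Ann (bad e n) < r / 4"
      using order_tendstoD(2)[OF bad_tendsto_0[OF e(1)], of "r / 4"] r by simp
    then have "\<forall>\<^sub>F n in sequentially. norm (?f n - ?g n - 0) < r"
      using eventually_gt_at_top[of 0]
    proof eventually_elim
      case (elim n)
      show ?case using char_difference[OF e elim(2), of t] elim(1) eB by simp
    qed
    then show "\<exists>no. \<forall>n\<ge>no. norm (?f n - ?g n - 0) < r" by (simp add: eventually_sequentially)
  qed
  moreover have "?g \<longlonglongrightarrow> complex_of_real (exp (- (t\<^sup>2 * inverse fisher / 2)))"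
  proof -
    \<comment> \<open>The division by \<open>fisher\<close> is moved into the frequency:
      \<open>t / fisher\<close> against the variance \<open>fisher\<close> yields the limit variance
      \<open>1 / fisher\<close>.\<close>
    have "?g n = expect (path_pmf Q_pmf n 0) (\<lambda>l. iexp ((t / fisher) * (path_sum (score p) 0 l / sqrt (real n))))" for n
      unfolding expectation_Ann_lvec[symmetric] score_sum_def by (intro Bochner_Integration.integral_cong) (auto simp: mult.commute)
    moreover have "(t / fisher)\<^sup>2 * fisher / 2 = t\<^sup>2 * inverse fisher / 2"
      using fisher_pos by (simp add: power2_eq_square field_simps)
    ultimately show ?thesis
      using chain.martingale_char_tendsto[OF score_le_score_bound score_centered fisher_def, of 0 "t / fisher"] by simp
  qed
  ultimately show ?thesis using tendsto_add[of "\<lambda>n. ?f n - ?g n" 0 _ ?g] by simp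
qed

lemma asymptotically_normal:
  "weak_conv_m (\<lambda>n. distr Ann borel (\<lambda>X. sqrt (real n) * (est n X - p)))
     (density lborel (normal_density 0 (sqrt (inverse fisher))))"
proof (rule levy_continuity)
  interpret A: prob_space Ann by (rule prob_space_Ann)
  have s: "0 < sqrt (inverse fisher)" using fisher_pos by simp
  show "real_distribution (density lborel (normal_density 0 (sqrt (inverse fisher))))"
    by (rule real_distribution_normal[OF s])
  show "real_distribution (distr Ann borel (\<lambda>X. sqrt (real n) * (est n X - p)))" for n
    by (intro A.real_distribution_distr) measurable
  show "(\<lambda>n. char (distr Ann borel (\<lambda>X. sqrt (real n) * (est n X - p))) t)
      \<longlonglongrightarrow> char (density lborel (normal_density 0 (sqrt (inverse fisher)))) t" for t
  proof -
    have "char (distr Ann borel (\<lambda>X. sqrt (real n) * (est n X - p))) t = (\<integral>X. iexp (t * (sqrt (real n) * (est n X - p))) \<partial>Ann)" for n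
      unfolding char_def by (subst integral_distr) auto
    then show ?thesis
      using char_est_tendsto[of t] fisher_pos unfolding char_normal[OF s] by simp
  qed
qed

end

section \<open>Sums against the weights\<close>

context transient_two_point_env
begin

text \<open>The stationary law of two consecutive states. Its masses are the weights
  \<open>tpi_wt\<close>, so sums against them become expectations.\<close>

definition pairs :: "(nat \<times> nat) pmf" where
  "pairs = bind_pmf pi_pmf (\<lambda>u. map_pmf (Pair u) (Q_pmf u))"

lemma pmf_pairs: "pmf pairs (u, v) = tpi_wt Nu u v"
proof -
  have "pmf (map_pmf (Pair u') (Q_pmf u')) (u, v) = pmf (Q_pmf u) v * indicator {u} u'" for u'
  proof (cases "u' = u")
    case True
    then show ?thesis by (simp add: pmf_map_inj' inj_on_def)
  next
    case False
    then show ?thesis by (auto simp: pmf_eq_0_set_pmf)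
  qed
  then have "pmf pairs (u, v) = expect pi_pmf (\<lambda>u'. pmf (Q_pmf u) v * indicator {u} u')"
    unfolding pairs_def pmf_bind by simp
  then show ?thesis
    by (simp add: measure_pmf_single pmf_pi_pmf pmf_Q_pmf tpi_wt_def mult.commute)
qed

text \<open>The weights have total mass 1, so every finite partial sum is at most \<open>C\<close>,
  and a sum of nonnegative terms is the supremum of these.\<close>

lemma tpi_nn_bounded:
  assumes "\<And>u v. g u v \<le> ennreal C"
  shows "tpi_nn Nu g < \<infinity>"
proof -
  have "tpi_nn Nu g = (SUP F\<in>{F. finite F \<and> F \<subseteq> UNIV}. \<Sum>z\<in>F. ennreal (pmf pairs z) * g (fst z) (snd z))"
    unfolding tpi_nn_def by (subst nonneg_infsum_complete) (auto simp: split_beta' pmf_pairs[symmetric])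
  also have "\<dots> \<le> ennreal C"
  proof (rule SUP_least)
    fix F :: "(nat \<times> nat) set" assume "F \<in> {F. finite F \<and> F \<subseteq> UNIV}"
    then have F: "finite F" by simp
    have "(\<Sum>z\<in>F. ennreal (pmf pairs z) * g (fst z) (snd z)) \<le> (\<Sum>z\<in>F. ennreal (pmf pairs z) * ennreal C)"
      by (intro sum_mono mult_left_mono assms) simp
    also have "\<dots> = emeasure pairs F * ennreal C"
      unfolding sum_distrib_right[symmetric] using F by (subst emeasure_measure_pmf_finite) (simp_all add: sum_ennreal)
    also have "\<dots> \<le> 1 * ennreal C" by (intro mult_right_mono measure_pmf.emeasure_le_1) simp
    finally show "(\<Sum>z\<in>F. ennreal (pmf pairs z) * g (fst z) (snd z)) \<le> ennreal C" by simp
  qed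
  also have "\<dots> < \<infinity>" by simp
  finally show ?thesis .
qed

lemma tpi_bounded:
  assumes g: "\<And>u v. \<bar>g u v\<bar> \<le> C"
  shows "tpi_summable Nu g"
    and "tpi Nu g = expect pi_pmf (\<lambda>u. expect (Q_pmf u) (g u))"
proof -
  let ?g = "\<lambda>z. g (fst z) (snd z)"
  have eq: "(\<lambda>(u, v). tpi_wt Nu u v * g u v) = (\<lambda>z. pmf pairs z * ?g z)"
    by (auto simp: fun_eq_iff pmf_pairs)
  have "integrable pairs ?g" using g by (intro integrable_pmf_bounded[where B=C]) auto
  then have "integrable (count_space UNIV) (\<lambda>z. pmf pairs z * ?g z)"
    unfolding measure_pmf_eq_density by (subst (asm) integrable_density) auto
  then have abs: "Infinite_Set_Sum.abs_summable_on (\<lambda>z. pmf pairs z * ?g z) UNIV"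
    unfolding Infinite_Set_Sum.abs_summable_on_def .
  then show "tpi_summable Nu g"
    unfolding tpi_summable_def eq using abs_summable_equivalent abs_summable_summable by blast
  have "tpi Nu g = expect pairs ?g"
    unfolding tpi_def eq pmf_expectation_eq_infsetsum by (rule infsetsum_infsum[OF abs, symmetric])
  also have "\<dots> = expect pi_pmf (\<lambda>u. expect (Q_pmf u) (g u))"
    unfolding pairs_def using g by (subst expectation_bind_pmf_real[where B=C]) auto
  finally show "tpi Nu g = \<dots>" .
qed

end

lemma compact_subset_unit_margin:
  fixes T :: "real set"
  assumes "compact T" "T \<subseteq> {0<..<1}"
  obtains c where "0 < c" "\<And>t. t \<in> T \<Longrightarrow> c \<le> t \<and> t \<le> 1 - c"
proof (cases "T = {}")
  case True
  then show ?thesis using that[of 1] by auto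
next
  case False
  obtain x y where "x \<in> T" "\<And>t. t \<in> T \<Longrightarrow> x \<le> t" "y \<in> T" "\<And>t. t \<in> T \<Longrightarrow> t \<le> y"
    using compact_attains_inf[OF assms(1) False] compact_attains_sup[OF assms(1) False] by metis
  moreover have "0 < x" "y < 1" using assms calculation by auto
  ultimately show ?thesis by (intro that[of "min x (1 - y)"]) (auto, force+)
qed

theorem proposition2p7:
  fixes a1 a2 \<theta>0 :: real and \<Theta> :: "real set" and \<nu> :: "real \<Rightarrow> real measure"
  defines "\<nu> \<equiv> two_point a1 a2"
  assumes a: "0 < a1" "a1 < a2" "a2 < 1"
    and \<Theta>: "compact \<Theta>" "\<Theta> \<subseteq> {0<..<1}"
    and \<theta>0: "\<theta>0 \<in> \<Theta>"
    and log_integrable: "\<And>\<theta>. \<theta> \<in> \<Theta> \<Longrightarrow> integrable (env_law (\<nu> \<theta>)) (\<lambda>\<omega>. \<bar>ln (rho \<omega> 0)\<bar>)"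
    and transient: "\<And>\<theta>. \<theta> \<in> \<Theta> \<Longrightarrow> (\<integral>\<omega>. ln (rho \<omega> 0) \<partial>env_law (\<nu> \<theta>)) < 0"
    and rho_integrable: "\<And>\<theta>. \<theta> \<in> \<Theta> \<Longrightarrow> integrable (env_law (\<nu> \<theta>)) (\<lambda>\<omega>. rho \<omega> 0)"
    and subballistic: "\<And>\<theta>. \<theta> \<in> \<Theta> \<Longrightarrow> 1 \<le> (\<integral>\<omega>. rho \<omega> 0 \<partial>env_law (\<nu> \<theta>))"
  shows
    \<comment> \<open>(2.i)\<close>
    "(\<forall>x y. continuous_on \<Theta> (\<lambda>\<theta>. phi (\<nu> \<theta>) x y)) \<and>
    \<comment> \<open>(2.ii)\<close>
     (\<forall>\<theta>\<in>\<Theta>. \<forall>\<theta>'\<in>\<Theta>. \<nu> \<theta> \<noteq> \<nu> \<theta>' \<longleftrightarrow> \<theta> \<noteq> \<theta>') \<and>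
    \<comment> \<open>(2.iii)\<close>
     (\<forall>\<theta>\<in>\<Theta>. tpi_nn (\<nu> \<theta>)
        (\<lambda>x y. SUP \<theta>'\<in>\<Theta>. ennreal \<bar>phi (\<nu> \<theta>') x y - phi (\<nu> \<theta>0) x y\<bar>) < \<infinity>) \<and>
    \<comment> \<open>(3.i)\<close>
     (\<forall>x y. C2_on \<Theta> (\<lambda>\<theta>. phi (\<nu> \<theta>) x y)) \<and>
    \<comment> \<open>(3.ii)\<close>
     (\<forall>\<theta>\<in>\<Theta>. \<exists>q>1. tpi_nn (\<nu> \<theta>) (\<lambda>x y. ennreal (norm (dphi \<nu> \<theta> x y) powr (2 * q))) < \<infinity>) \<and>
    \<comment> \<open>(3.iii)\<close>
     (\<forall>\<theta>\<in>\<Theta>. \<forall>u.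
        (\<forall>\<^sub>F t in nhds \<theta>. summable (Qker (\<nu> t) u)) \<and>
        (\<forall>v. (\<lambda>t. Qker (\<nu> t) u v) differentiable at \<theta>) \<and>
        (\<lambda>t. \<Sum>v. Qker (\<nu> t) u v) differentiable at \<theta> \<and>
        (\<lambda>v. deriv (\<lambda>t. Qker (\<nu> t) u v) \<theta>) sums deriv (\<lambda>t. \<Sum>v. Qker (\<nu> t) u v) \<theta>) \<and>
    \<comment> \<open>(3.iv)\<close>
     (\<forall>\<theta>\<in>\<Theta>. \<exists>V. open V \<and> \<theta> \<in> V \<and> V \<subseteq> {0<..<1} \<and>
        tpi_nn (\<nu> \<theta>) (\<lambda>x y. SUP \<theta>'\<in>V. ennreal ((norm (dphi \<nu> \<theta>' x y))\<^sup>2)) < \<infinity> \<and>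
        tpi_nn (\<nu> \<theta>) (\<lambda>x y. SUP \<theta>'\<in>V. ennreal (norm (ddphi \<nu> \<theta>' x y))) < \<infinity>) \<and>
    \<comment> \<open>(3.v)\<close>
     (\<forall>\<theta>\<in>\<Theta>. tpi_summable (\<nu> \<theta>) (\<lambda>x y. (dphi \<nu> \<theta> x y)\<^sup>2) \<and>
        tpi_summable (\<nu> \<theta>) (ddphi \<nu> \<theta>) \<and>
        Sigma_info \<nu> \<theta> = - tpi (\<nu> \<theta>) (ddphi \<nu> \<theta>) \<and>
        Sigma_info \<nu> \<theta> \<noteq> 0) \<and>
    \<comment> \<open>consistency and asymptotic normality\<close>
     (\<forall>\<theta>s\<in>interior \<Theta>. \<forall>est. argmax_estimator \<nu> \<Theta> \<theta>0 \<theta>s est \<longrightarrow>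
        tendsto_in_prob (annealed (\<nu> \<theta>s)) est \<theta>s \<and>
        weak_conv_m
          (\<lambda>n. distr (annealed (\<nu> \<theta>s)) borel (\<lambda>X. sqrt (real n) * (est n X - \<theta>s)))
          (density lborel (normal_density 0 (sqrt (inverse (Sigma_info \<nu> \<theta>s))))))"
proof (intro conjI)
  have \<Theta>': "0 < \<theta>" "\<theta> < 1" if "\<theta> \<in> \<Theta>" for \<theta> using \<Theta> that by auto
  have loc: "transient_two_point_env a1 a2 \<theta>" if "\<theta> \<in> \<Theta>" for \<theta>
  proof -
    have "(\<integral>\<omega>. ln (rho \<omega> 0) \<partial>env_law (two_point a1 a2 \<theta>)) = \<theta> * ln ((1 - a1) / a1) + (1 - \<theta>) * ln ((1 - a2) / a2)"
      using log_integrable[OF that] unfolding \<nu>_def by (rule expectation_ln_rho[OF a \<Theta>'[OF that]])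
    with transient[OF that] show ?thesis
      using a \<Theta>'[OF that] unfolding \<nu>_def by unfold_locales auto
  qed
  have score_bd: "\<bar>mix_score a1 a2 \<theta> u v\<bar> \<le> 1 / \<theta> + 1 / (1 - \<theta>)" if "0 < \<theta>" "\<theta> < 1" for \<theta> u v
    using mix_score_bounded[OF a that] .
  have dphi: "dphi \<nu> \<theta> u v = mix_score a1 a2 \<theta> u v" and ddphi: "ddphi \<nu> \<theta> u v = - (mix_score a1 a2 \<theta> u v)\<^sup>2"
    if "0 < \<theta>" "\<theta> < 1" for \<theta> u v
    unfolding \<nu>_def using dphi_eq[OF a that] ddphi_eq[OF a that] by auto
  have sq: "(mix_score a1 a2 \<theta> u v)\<^sup>2 \<le> C\<^sup>2" if "0 < \<theta>" "\<theta> < 1" "1 / \<theta> + 1 / (1 - \<theta>) \<le> C" for \<theta> u v C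
  proof -
    have "\<bar>mix_score a1 a2 \<theta> u v\<bar> \<le> \<bar>C\<bar>" using score_bd[OF that(1,2), of u v] that(3) by linarith
    then show ?thesis by (simp add: abs_le_square_iff)
  qed
  show "\<forall>x y. continuous_on \<Theta> (\<lambda>\<theta>. phi (\<nu> \<theta>) x y)"
    unfolding \<nu>_def using phi_deriv[OF a] \<Theta>'
    by (intro allI continuous_at_imp_continuous_on ballI DERIV_isCont) blast
  show "\<forall>\<theta>\<in>\<Theta>. \<forall>\<theta>'\<in>\<Theta>. \<nu> \<theta> \<noteq> \<nu> \<theta>' \<longleftrightarrow> \<theta> \<noteq> \<theta>'"
    unfolding \<nu>_def using two_point_inject[OF a] \<Theta>' by simp
  show "\<forall>\<theta>\<in>\<Theta>. tpi_nn (\<nu> \<theta>) (\<lambda>x y. SUP \<theta>'\<in>\<Theta>. ennreal \<bar>phi (\<nu> \<theta>') x y - phi (\<nu> \<theta>0) x y\<bar>) < \<infinity>"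
  proof
    fix \<theta> assume \<theta>: "\<theta> \<in> \<Theta>"
    obtain c where c: "0 < c" "\<And>t. t \<in> \<Theta> \<Longrightarrow> c \<le> t \<and> t \<le> 1 - c"
      using compact_subset_unit_margin[OF \<Theta>] by blast
    show "tpi_nn (\<nu> \<theta>) (\<lambda>x y. SUP \<theta>'\<in>\<Theta>. ennreal \<bar>phi (\<nu> \<theta>') x y - phi (\<nu> \<theta>0) x y\<bar>) < \<infinity>"
      unfolding \<nu>_def
    proof (intro transient_two_point_env.tpi_nn_bounded[OF loc[OF \<theta>], where C="ln (1 / c)"] SUP_least ennreal_leI)
      fix x y \<theta>' assume "\<theta>' \<in> \<Theta>"
      then show "\<bar>phi (two_point a1 a2 \<theta>') x y - phi (two_point a1 a2 \<theta>0) x y\<bar> \<le> ln (1 / c)"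
        using c \<theta>0 by (intro phi_diff_bound[OF a c(1), where T=\<Theta>]) auto
    qed
  qed
  show "\<forall>x y. C2_on \<Theta> (\<lambda>\<theta>. phi (\<nu> \<theta>) x y)"
    unfolding \<nu>_def using C2_phi[OF a \<Theta>(2)] by blast
  show "\<forall>\<theta>\<in>\<Theta>. \<exists>q>1. tpi_nn (\<nu> \<theta>) (\<lambda>x y. ennreal (norm (dphi \<nu> \<theta> x y) powr (2 * q))) < \<infinity>"
  \<comment> \<open>The score is bounded, so every exponent is admissible; \<open>q = 2\<close> is a
    convenient one.\<close>
  proof (intro ballI exI[of _ 2] conjI)
    fix \<theta> assume \<theta>: "\<theta> \<in> \<Theta>"
    show "tpi_nn (\<nu> \<theta>) (\<lambda>x y. ennreal (norm (dphi \<nu> \<theta> x y) powr (2 * 2))) < \<infinity>"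
      unfolding dphi[OF \<Theta>'[OF \<theta>]] unfolding \<nu>_def
    proof (rule transient_two_point_env.tpi_nn_bounded[OF loc[OF \<theta>]])
      show "ennreal (norm (mix_score a1 a2 \<theta> u v) powr (2 * 2)) \<le> ennreal ((1 / \<theta> + 1 / (1 - \<theta>)) powr (2 * 2))" for u v
        using score_bd[OF \<Theta>'[OF \<theta>]] by (intro ennreal_leI powr_mono2) auto
    qed
  qed simp
  show "\<forall>\<theta>\<in>\<Theta>. \<forall>u.
        (\<forall>\<^sub>F t in nhds \<theta>. summable (Qker (\<nu> t) u)) \<and>
        (\<forall>v. (\<lambda>t. Qker (\<nu> t) u v) differentiable at \<theta>) \<and>
        (\<lambda>t. \<Sum>v. Qker (\<nu> t) u v) differentiable at \<theta> \<and>
        (\<lambda>v. deriv (\<lambda>t. Qker (\<nu> t) u v) \<theta>) sums deriv (\<lambda>t. \<Sum>v. Qker (\<nu> t) u v) \<theta>"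
    unfolding \<nu>_def using Qker_derivative_sums[OF a \<Theta>'] by blast
  show "\<forall>\<theta>\<in>\<Theta>. \<exists>V. open V \<and> \<theta> \<in> V \<and> V \<subseteq> {0<..<1} \<and>
        tpi_nn (\<nu> \<theta>) (\<lambda>x y. SUP \<theta>'\<in>V. ennreal ((norm (dphi \<nu> \<theta>' x y))\<^sup>2)) < \<infinity> \<and>
        tpi_nn (\<nu> \<theta>) (\<lambda>x y. SUP \<theta>'\<in>V. ennreal (norm (ddphi \<nu> \<theta>' x y))) < \<infinity>"
  proof
    fix \<theta> assume \<theta>: "\<theta> \<in> \<Theta>"
    note t = \<Theta>'[OF \<theta>]
    \<comment> \<open>At least half the distance from \<open>\<theta>\<close> to either end of
      \<open>(0, 1)\<close> is kept, so the score bound at most doubles on \<open>V\<close>.\<close>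
    define V where "V = {\<theta> / 2<..<(1 + \<theta>) / 2}"
    define C where "C = 2 / \<theta> + 2 / (1 - \<theta>)"
    have V: "0 < s" "s < 1" "1 / s + 1 / (1 - s) \<le> C" if "s \<in> V" for s
    proof -
      show s: "0 < s" "s < 1" using that t unfolding V_def by auto
      have "1 / s \<le> 1 / (\<theta> / 2)" by (rule frac_le) (use that t in \<open>simp_all add: V_def\<close>)
      moreover have "1 / (1 - s) \<le> 1 / ((1 - \<theta>) / 2)"
        by (rule frac_le) (use that t in \<open>simp_all add: V_def\<close>)
      ultimately show "1 / s + 1 / (1 - s) \<le> C" unfolding C_def by simp
    qed
    have "tpi_nn (\<nu> \<theta>) (\<lambda>x y. SUP \<theta>'\<in>V. ennreal ((norm (dphi \<nu> \<theta>' x y))\<^sup>2)) < \<infinity>"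
      unfolding \<nu>_def
    proof (intro transient_two_point_env.tpi_nn_bounded[OF loc[OF \<theta>], where C="C\<^sup>2"] SUP_least ennreal_leI)
      fix x y s assume s: "s \<in> V"
      show "(norm (dphi (two_point a1 a2) s x y))\<^sup>2 \<le> C\<^sup>2"
        using sq[OF V[OF s]] dphi[OF V(1,2)[OF s]] unfolding \<nu>_def by simp
    qed
    moreover have "tpi_nn (\<nu> \<theta>) (\<lambda>x y. SUP \<theta>'\<in>V. ennreal (norm (ddphi \<nu> \<theta>' x y))) < \<infinity>"
      unfolding \<nu>_def
    proof (intro transient_two_point_env.tpi_nn_bounded[OF loc[OF \<theta>], where C="C\<^sup>2"] SUP_least ennreal_leI)
      fix x y s assume s: "s \<in> V"
      show "norm (ddphi (two_point a1 a2) s x y) \<le> C\<^sup>2"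
        using sq[OF V[OF s]] ddphi[OF V(1,2)[OF s]] unfolding \<nu>_def by simp
    qed
    ultimately show "\<exists>V. open V \<and> \<theta> \<in> V \<and> V \<subseteq> {0<..<1} \<and>
        tpi_nn (\<nu> \<theta>) (\<lambda>x y. SUP \<theta>'\<in>V. ennreal ((norm (dphi \<nu> \<theta>' x y))\<^sup>2)) < \<infinity> \<and>
        tpi_nn (\<nu> \<theta>) (\<lambda>x y. SUP \<theta>'\<in>V. ennreal (norm (ddphi \<nu> \<theta>' x y))) < \<infinity>"
      using V t by (intro exI[of _ V]) (auto simp: V_def)
  qed
  have Sigma: "Sigma_info \<nu> \<theta> = transient_two_point_env.fisher a1 a2 \<theta>" if \<theta>: "\<theta> \<in> \<Theta>" for \<theta>
  proof -
    interpret T: transient_two_point_env a1 a2 \<theta> by (rule loc[OF \<theta>])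
    have "dphi (two_point a1 a2) \<theta> u v = mix_score a1 a2 \<theta> u v" for u v
      using dphi[OF \<Theta>'[OF \<theta>]] unfolding \<nu>_def .
    then show ?thesis
      unfolding Sigma_info_def \<nu>_def T.fisher_def using T.tpi_bounded(2)[OF T.score_sq_le] by simp
  qed
  show "\<forall>\<theta>\<in>\<Theta>. tpi_summable (\<nu> \<theta>) (\<lambda>x y. (dphi \<nu> \<theta> x y)\<^sup>2) \<and>
        tpi_summable (\<nu> \<theta>) (ddphi \<nu> \<theta>) \<and>
        Sigma_info \<nu> \<theta> = - tpi (\<nu> \<theta>) (ddphi \<nu> \<theta>) \<and>
        Sigma_info \<nu> \<theta> \<noteq> 0"
  proof (intro ballI conjI)
    fix \<theta> assume \<theta>: "\<theta> \<in> \<Theta>"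
    note t = \<Theta>'[OF \<theta>]
    interpret T: transient_two_point_env a1 a2 \<theta> by (rule loc[OF \<theta>])
    have b: "\<bar>(dphi \<nu> \<theta> x y)\<^sup>2\<bar> \<le> (1 / \<theta> + 1 / (1 - \<theta>))\<^sup>2" "\<bar>ddphi \<nu> \<theta> x y\<bar> \<le> (1 / \<theta> + 1 / (1 - \<theta>))\<^sup>2" for x y
      unfolding dphi[OF t] ddphi[OF t] using sq[OF t order_refl] by simp_all
    show "tpi_summable (\<nu> \<theta>) (\<lambda>x y. (dphi \<nu> \<theta> x y)\<^sup>2)" "tpi_summable (\<nu> \<theta>) (ddphi \<nu> \<theta>)"
      using T.tpi_bounded(1)[OF b(1)] T.tpi_bounded(1)[OF b(2)] unfolding \<nu>_def by auto
    show "Sigma_info \<nu> \<theta> = - tpi (\<nu> \<theta>) (ddphi \<nu> \<theta>)"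
      unfolding Sigma_info_def tpi_def dphi[OF t] ddphi[OF t] infsum_uminus[symmetric]
      by (intro infsum_cong) auto
    show "Sigma_info \<nu> \<theta> \<noteq> 0" unfolding Sigma[OF \<theta>] using T.fisher_pos by simp
  qed
  show "\<forall>\<theta>s\<in>interior \<Theta>. \<forall>est. argmax_estimator \<nu> \<Theta> \<theta>0 \<theta>s est \<longrightarrow>
        tendsto_in_prob (annealed (\<nu> \<theta>s)) est \<theta>s \<and>
        weak_conv_m
          (\<lambda>n. distr (annealed (\<nu> \<theta>s)) borel (\<lambda>X. sqrt (real n) * (est n X - \<theta>s)))
          (density lborel (normal_density 0 (sqrt (inverse (Sigma_info \<nu> \<theta>s)))))"
  proof (intro ballI allI impI)
    fix \<theta>s est assume \<theta>s: "\<theta>s \<in> interior \<Theta>" and est: "argmax_estimator \<nu> \<Theta> \<theta>0 \<theta>s est"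
    have s: "\<theta>s \<in> \<Theta>" using \<theta>s interior_subset by blast
    interpret T: transient_two_point_env a1 a2 \<theta>s by (rule loc[OF s])
    \<comment> \<open>Interiority of the true parameter enters here: it supplies an interval around
      it inside \<Theta>.\<close>
    obtain r where r: "0 < r" "ball \<theta>s r \<subseteq> \<Theta>" using \<theta>s by (auto simp: mem_interior)
    have M: "0 < T.score_bound" "0 < 1 + 2 * T.score_bound ^ 3" and f: "0 < T.fisher"
      using T.score_bound_pos T.fisher_pos by (auto intro: add_pos_pos)
    have ex: "\<exists>e>0. e \<le> r \<and> e \<le> x \<and> e \<le> y \<and> e \<le> z" if "0 < x" "0 < y" "0 < z" for x y z
      using that r(1) by (intro exI[of _ "min r (min x (min y z))"]) auto
    have "0 < 1 / (2 * T.score_bound)" "0 < T.fisher / 2 / (1 + 2 * T.score_bound ^ 3)" "0 < T.fisher / 2"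
      using M f by simp_all
    from ex[OF this] obtain e0 where e0: "0 < e0" "e0 \<le> r" "e0 \<le> 1 / (2 * T.score_bound)"
        "e0 \<le> T.fisher / 2 / (1 + 2 * T.score_bound ^ 3)" "e0 \<le> T.fisher / 2"
      by blast
    interpret two_point_mle a1 a2 \<theta>s \<Theta> \<theta>0 e0 est
    proof
      show "\<Theta> \<subseteq> {0<..<1}" "0 < e0" "e0 \<le> T.fisher / 2" by fact+
      show "{\<theta>s - e0<..<\<theta>s + e0} \<subseteq> \<Theta>" using r(2) e0(2) by (auto simp: ball_def dist_real_def abs_less_iff)
      show "e0 * T.score_bound \<le> 1 / 2" using mult_right_mono[OF e0(3), of T.score_bound] M by simp
      show "e0 * (1 + 2 * T.score_bound ^ 3) \<le> T.fisher / 2"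
        using e0(4) by (simp only: pos_le_divide_eq[OF M(2)])
    qed (use est in \<open>auto simp: argmax_estimator_def \<nu>_def\<close>)
    show "tendsto_in_prob (annealed (\<nu> \<theta>s)) est \<theta>s \<and>
        weak_conv_m
          (\<lambda>n. distr (annealed (\<nu> \<theta>s)) borel (\<lambda>X. sqrt (real n) * (est n X - \<theta>s)))
          (density lborel (normal_density 0 (sqrt (inverse (Sigma_info \<nu> \<theta>s)))))"
      using consistent asymptotically_normal unfolding Sigma[OF s] unfolding \<nu>_def by blast
  qed
qed

end
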